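(* Let $\varphi\in L^2(K)$ be a compactly supported refinable function with $\hat\varphi(0)=1$ and refinement mask $m_0$, i.e. $\hat\varphi(\xi)=m_0(\mathfrak p\xi)\hat\varphi(\mathfrak p\xi)$, and let $m_1,\dots,m_L$ be framelet masks satisfying the unitary extension principle together with $m_0$, i.e. $\sum_{\ell=0}^L\overline{m_\ell(\xi)}\,m_\ell(\xi+\mathfrak pu(k))=\delta_{0,k}$ for $k=0,1,\dots,q-1$ and a.e. $\xi$. Let $A(\xi)=\big(a_{k,\ell}(\xi)\big)_{1\le k,\ell\le2L}$ be a $2L\times2L$ paraunitary matrix. For $k=1,\dots,2L$ define $$G_k(\xi)=\sum_{\ell=1}^La_{k,\ell}(\mathfrak p^{-1}\xi)\,m_\ell(\xi),\qquad\tilde G_k(\xi)=\sum_{\ell=L+1}^{2L}a_{k,\ell}(\mathfrak p^{-1}\xi)\,m_{\ell-L}(\xi),$$ and define $\psi_k^*,\phi_k^*\in L^2(K)$ by $$\hat\psi_k^*(\mathfrak p^{-1}\xi)=G_k(\xi)\hat\varphi(\xi),\qquad\hat\phi_k^*(\mathfrak p^{-1}\xi)=\tilde G_k(\xi)\hat\varphi(\xi).$$ Then the wavelet systems $\mathcal F(\Psi^* )$ and $\mathcal F(\Phi^* )$ generated by $\Psi^*=\{\psi_1^*,\dots,\psi_{2L}^*\}$ and $\Phi^*=\{\phi_1^*,\dots,\phi_{2L}^*\}$ are a pair of orthogonal wavelet frames for $L^2(K)$.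
   Context: $K$ is a local field (locally compact, non-discrete, totally disconnected) of positive characteristic $p$, with ring of integers $\mathfrak D=\{|x|\le1\}$, prime ideal $\mathfrak B=\{|x|<1\}$, a fixed prime element $\mathfrak p$ (so $\mathfrak B=\mathfrak p\mathfrak D$), and residue field $\mathfrak D/\mathfrak B\cong GF(q)$, $q=p^c$; $|\mathfrak p|=q^{-1}$, and Haar measure $dx$ on $K^+$ is normalized so that $\mathfrak D$ has measure 1. Fix $1=\zeta_0,\zeta_1,\dots,\zeta_{c-1}\in\mathfrak D\setminus\mathfrak B$ spanning over $GF(p)$ a copy of $GF(q)$ in $K$. Let $\chi$ be the character of $K^+$, trivial on $\mathfrak D$, with $\chi(\zeta_\mu\mathfrak p^{-j})=e^{2\pi i/p}$ if $\mu=0$ and $j=1$, and $=1$ if $\mu\in\{1,\dots,c-1\}$ or $j\ne1$. Put $\chi_y(x)=\chi(yx)$. For $0\le n<q$, $n=a_0+a_1p+\dots+a_{c-1}p^{c-1}$ with $0\le a_k<p$, set $u(n)=(a_0+a_1\zeta_1+\dots+a_{c-1}\zeta_{c-1})\mathfrak p^{-1}$; for $n=b_0+b_1q+\dots+b_sq^s$ with $0\le b_k<q$ set $u(n)=u(b_0)+u(b_1)\mathfrak p^{-1}+\dots+u(b_s)\mathfrak p^{-s}$. Then $\{u(n):n\in\mathbb N_0\}$ is a complete set of coset representatives of $\mathfrak D$ in $K^+$. Write $\chi_n=\chi_{u(n)}$. The Fourier transform is $\hat f(\xi)=\int_Kf(x)\overline{\chi_\xi(x)}\,dx$ on $L^1(K)\cap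 L^2(K)$, extended to a unitary operator on $L^2(K)$. A mask is a function of the form $m(\xi)=\frac1{\sqrt q}\sum_{k\in\mathbb N_0}d_k\overline{\chi_k(\xi)}$ with square-summable complex coefficients $d_k$; it satisfies $m(\xi+u(k))=m(\xi)$ for all $k\in\mathbb N_0$. A paraunitary matrix $A(\xi)$ is a square matrix whose entries are polynomials in the characters (finite linear combinations of the functions $\overline{\chi_k}$, $k\in\mathbb N_0$; in particular each entry $a$ satisfies $a(\xi+u(k))=a(\xi)$ for all $k$) and such that $A(\xi)^*A(\xi)=I$ for a.e. $\xi$, where $^*$ is conjugate transpose. For $\Psi=\{\psi_1,\dots,\psi_N\}\subset L^2(K)$, the wavelet system is $\mathcal F(\Psi)=\{\psi_{\ell,j,k}(x)=q^{j/2}\psi_\ell(\mathfrak p^{-j}x-u(k)):j\in\mathbb Z,\,k\in\mathbb N_0,\,1\le\ell\le N\}$. It is a wavelet frame if there are constants $A,B>0$ with $A\|f\|_2^2\le\sum_{\ell,j,k}|\langle f,\psi_{\ell,j,k}\rangle|^2\le B\|f\|_2^2$ for all $f\in L^2(K)$. Two wavelet frames $\mathcal F(\Psi)$ and $\mathcal F(\Phi)$ with the same number $N$ of generators are orthogonal if $\sum_{\ell=1}^N\sum_{j\in\mathbb Z}\sum_{k\in\mathbb N_0}\langle f,\psi_{\ell,j,k}\rangle\phi_{\ell,j,k}=0$ for all $f\in L^2(K)$. *)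

theory Defs
  imports "HOL-Analysis.Analysis"
begin

section \<open>Local fields\<close>

text \<open>
  A local field is a locally compact, non-discrete (\<^class>\<open>perfect_space\<close>), totally disconnected
  topological field. The metric is the one given by its absolute value, \<open>dist x y = |x - y|\<close>, so
  \<open>|x|\<close> is \<open>dist x 0\<close>. The normalization \<open>|\<pp>| = 1/q\<close> is imposed in
  \<open>local_field_setting\<close> below. Continuity of the field operations follows from the axioms.
\<close>

class local_field = field + metric_space + perfect_space +
  assumes dist_add_right: "dist (x + z) (y + z) = dist x y"
    and dist_mult_zero: "dist (x * y) 0 = dist x 0 * dist y 0"
    and dist_ultrametric: "dist x z \<le> max (dist x y) (dist y z)"
    and locally_compact: "\<exists>U C. open U \<and> compact C \<and> x \<in> U \<and> U \<subseteq> C"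
    and totally_disconnected: "connected S \<Longrightarrow> x \<in> S \<Longrightarrow> y \<in> S \<Longrightarrow> x = y"

definition absv :: "'k::local_field \<Rightarrow> real" where
  "absv x = dist x 0"

definition int_ring :: "'k::local_field set" where
  "int_ring = {x. absv x \<le> 1}"

definition prime_ideal :: "'k::local_field set" where
  "prime_ideal = {x. absv x < 1}"

text \<open>The objects fixed throughout: \<open>c\<close>, the prime element \<open>\<pp>\<close>, the elements \<open>\<zeta>\<^sub>0, \<dots>, \<zeta>\<^sub>c\<^sub>-\<^sub>1\<close>,
  the character \<open>\<chi>\<close> and the normalized Haar measure of the additive group.\<close>

record 'k lf_data =
  res_deg :: nat
  prm :: 'k
  zeta :: "nat \<Rightarrow> 'k"
  chi :: "'k \<Rightarrow> complex"
  haar :: "'k measure"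

definition res_card :: "('k::local_field) lf_data \<Rightarrow> nat" where
  "res_card K = CHAR('k) ^ res_deg K"

definition zeta_span :: "('k::local_field) lf_data \<Rightarrow> 'k set" where
  "zeta_span K = {\<Sum>i<res_deg K. of_nat (a i) * zeta K i | a :: nat \<Rightarrow> nat. \<forall>i. a i < CHAR('k)}"

definition is_subfield :: "'k::field set \<Rightarrow> bool" where
  "is_subfield F \<longleftrightarrow> 0 \<in> F \<and> 1 \<in> F \<and>
     (\<forall>x\<in>F. \<forall>y\<in>F. x - y \<in> F \<and> x * y \<in> F) \<and> (\<forall>x\<in>F. inverse x \<in> F)"

text \<open>A finite field is determined up to isomorphism by its cardinality, so being a copy of
  \<open>GF(q)\<close> is expressed by having exactly \<open>q\<close> elements.\<close>

locale local_field_setting =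
  fixes K :: "('k::local_field) lf_data"
  assumes char_pos: "CHAR('k) > 0"
    and residue_field:
      "card (int_ring // {(x, y). x \<in> (int_ring :: 'k set) \<and> y \<in> int_ring \<and> x - y \<in> prime_ideal})
         = res_card K"
    and prime_element: "(prime_ideal :: 'k set) = (\<lambda>x. prm K * x) ` int_ring"
    and absv_prime_element: "absv (prm K) = 1 / real (res_card K)"
    and zeta_0: "zeta K 0 = 1"
    and zeta_unit: "\<And>i. i < res_deg K \<Longrightarrow> zeta K i \<in> int_ring - prime_ideal"
    and zeta_span_subfield: "is_subfield (zeta_span K)"
    and card_zeta_span: "card (zeta_span K) = res_card K"
    and chi_add: "\<And>x y. chi K (x + y) = chi K x * chi K y"
    and chi_norm: "\<And>x. cmod (chi K x) = 1"
    and chi_continuous: "continuous_on UNIV (chi K)"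
    and chi_int_ring: "\<And>x. x \<in> int_ring \<Longrightarrow> chi K x = 1"
    and chi_zeta: "\<And>i j :: nat. i < res_deg K \<Longrightarrow> j \<ge> 1 \<Longrightarrow>
      chi K (zeta K i * prm K powi (- int j))
        = (if i = 0 \<and> j = 1 then exp (2 * of_real pi * \<i> / of_nat CHAR('k)) else 1)"
    and haar_sets: "sets (haar K) = sets borel"
    and haar_translation: "\<And>A x. A \<in> sets borel \<Longrightarrow> emeasure (haar K) ((+) x ` A) = emeasure (haar K) A"
    and haar_compact: "\<And>C. compact C \<Longrightarrow> emeasure (haar K) C < \<infinity>"
    and haar_normalized: "emeasure (haar K) int_ring = 1"

section \<open>The translations \<open>u(n)\<close> and the characters \<open>\<chi>\<^sub>n\<close>\<close>

definition u_digit :: "('k::local_field) lf_data \<Rightarrow> nat \<Rightarrow> 'k" where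
  "u_digit K n =
     (\<Sum>i<res_deg K. of_nat ((n div CHAR('k) ^ i) mod CHAR('k)) * zeta K i) * prm K powi (- 1)"

text \<open>The base-\<open>q\<close> digits of \<open>n\<close> with index above \<open>n\<close> vanish, and \<open>u_digit K 0 = 0\<close>, so the sum
  below is the sum over all digits.\<close>

definition u_rep :: "('k::local_field) lf_data \<Rightarrow> nat \<Rightarrow> 'k" where
  "u_rep K n = (\<Sum>i\<le>n. u_digit K ((n div res_card K ^ i) mod res_card K) * prm K powi (- int i))"

definition chi_n :: "('k::local_field) lf_data \<Rightarrow> nat \<Rightarrow> 'k \<Rightarrow> complex" where
  "chi_n K n x = chi K (u_rep K n * x)"

section \<open>Square-integrable functions and the Fourier transform\<close>

text \<open>Elements of \<open>L\<^sup>2(K)\<close> are represented by functions, and \<open>l2sq K f\<close> is \<open>\<parallel>f\<parallel>\<^sub>2\<^sup>2\<close>.\<close>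

definition l2sq :: "('k::local_field) lf_data \<Rightarrow> ('k \<Rightarrow> complex) \<Rightarrow> ennreal" where
  "l2sq K f = (\<integral>\<^sup>+x. ennreal ((cmod (f x))\<^sup>2) \<partial>haar K)"

definition L2 :: "('k::local_field) lf_data \<Rightarrow> ('k \<Rightarrow> complex) \<Rightarrow> bool" where
  "L2 K f \<longleftrightarrow> f \<in> borel_measurable (haar K) \<and> l2sq K f < \<infinity>"

definition l2_inner :: "('k::local_field) lf_data \<Rightarrow> ('k \<Rightarrow> complex) \<Rightarrow> ('k \<Rightarrow> complex) \<Rightarrow> complex" where
  "l2_inner K f g = (\<integral>x. f x * cnj (g x) \<partial>haar K)"

definition fourier_int :: "('k::local_field) lf_data \<Rightarrow> ('k \<Rightarrow> complex) \<Rightarrow> 'k \<Rightarrow> complex" where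
  "fourier_int K f \<xi> = (\<integral>x. f x * cnj (chi K (\<xi> * x)) \<partial>haar K)"

definition is_L2_fourier ::
  "('k::local_field) lf_data \<Rightarrow> ('k \<Rightarrow> complex) \<Rightarrow> ('k \<Rightarrow> complex) \<Rightarrow> bool" where
  "is_L2_fourier K f g \<longleftrightarrow> L2 K g \<and>
     (\<exists>F :: nat \<Rightarrow> 'k \<Rightarrow> complex. (\<forall>n. integrable (haar K) (F n) \<and> L2 K (F n)) \<and>
        (\<lambda>n. l2sq K (\<lambda>x. F n x - f x)) \<longlonglongrightarrow> 0 \<and>
        (\<lambda>n. l2sq K (\<lambda>\<xi>. fourier_int K (F n) \<xi> - g \<xi>)) \<longlonglongrightarrow> 0)"

text \<open>For an integrable function the transform is the integral itself, which is a continuous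
  function and so may be evaluated at a point; otherwise it is some representative of the
  \<open>L\<^sup>2\<close>-limit, determined up to null sets.\<close>

definition fourier :: "('k::local_field) lf_data \<Rightarrow> ('k \<Rightarrow> complex) \<Rightarrow> 'k \<Rightarrow> complex" where
  "fourier K f = (if integrable (haar K) f then fourier_int K f else (SOME g. is_L2_fourier K f g))"

definition compactly_supported :: "('k::local_field) lf_data \<Rightarrow> ('k \<Rightarrow> complex) \<Rightarrow> bool" where
  "compactly_supported K f \<longleftrightarrow> (\<exists>C. compact C \<and> (AE x in haar K. x \<notin> C \<longrightarrow> f x = 0))"

section \<open>Masks and paraunitary matrices\<close>

text \<open>The series of a mask converges in \<open>L\<^sup>2\<close> of every coset of the ring of integers (these are
  the closed unit balls); the \<open>\<chi>\<^sub>k\<close> are orthonormal on each of them.\<close>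

definition is_mask :: "('k::local_field) lf_data \<Rightarrow> ('k \<Rightarrow> complex) \<Rightarrow> bool" where
  "is_mask K m \<longleftrightarrow> m \<in> borel_measurable (haar K) \<and>
     (\<exists>d :: nat \<Rightarrow> complex. summable (\<lambda>k. (cmod (d k))\<^sup>2) \<and>
        (\<forall>a. (\<lambda>n. \<integral>\<^sup>+\<xi>\<in>{\<xi>. \<xi> - a \<in> int_ring}.
               ennreal ((cmod (m \<xi> - 1 / of_real (sqrt (real (res_card K))) *
                                       (\<Sum>k<n. d k * cnj (chi_n K k \<xi>))))\<^sup>2) \<partial>haar K) \<longlonglongrightarrow> 0))"

definition char_poly_fun :: "('k::local_field) lf_data \<Rightarrow> ('k \<Rightarrow> complex) \<Rightarrow> bool" where
  "char_poly_fun K a \<longleftrightarrow>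
     (\<exists>S d. finite S \<and> (\<forall>\<xi>. a \<xi> = (\<Sum>k\<in>S. d k * cnj (chi_n K k \<xi>))))"

text \<open>Matrices have rows and columns indexed by \<open>1, \<dots>, n\<close>; the second condition is the entrywise
  form of \<open>A(\<xi>)\<^sup>* A(\<xi>) = I\<close>.\<close>

definition paraunitary ::
  "('k::local_field) lf_data \<Rightarrow> nat \<Rightarrow> (nat \<Rightarrow> nat \<Rightarrow> 'k \<Rightarrow> complex) \<Rightarrow> bool" where
  "paraunitary K n A \<longleftrightarrow>
     (\<forall>k\<in>{1..n}. \<forall>l\<in>{1..n}. char_poly_fun K (A k l)) \<and>
     (AE \<xi> in haar K. \<forall>i\<in>{1..n}. \<forall>j\<in>{1..n}.
        (\<Sum>k=1..n. cnj (A k i \<xi>) * A k j \<xi>) = (if i = j then 1 else 0))"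

definition unitary_extension_principle ::
  "('k::local_field) lf_data \<Rightarrow> nat \<Rightarrow> (nat \<Rightarrow> 'k \<Rightarrow> complex) \<Rightarrow> bool" where
  "unitary_extension_principle K L m \<longleftrightarrow>
     (AE \<xi> in haar K. \<forall>k<res_card K.
        (\<Sum>l=0..L. cnj (m l \<xi>) * m l (\<xi> + prm K * u_rep K k)) = (if k = 0 then 1 else 0))"

section \<open>Wavelet systems\<close>

definition wavelet :: "('k::local_field) lf_data \<Rightarrow> ('k \<Rightarrow> complex) \<Rightarrow> int \<Rightarrow> nat \<Rightarrow> 'k \<Rightarrow> complex" where
  "wavelet K \<psi> j k x =
     of_real (real (res_card K) powr (of_int j / 2)) * \<psi> (prm K powi (- j) * x - u_rep K k)"

definition wavelet_index :: "nat \<Rightarrow> (nat \<times> int \<times> nat) set" where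
  "wavelet_index N = {1..N} \<times> UNIV \<times> UNIV"

definition wavelet_frame ::
  "('k::local_field) lf_data \<Rightarrow> nat \<Rightarrow> (nat \<Rightarrow> 'k \<Rightarrow> complex) \<Rightarrow> bool" where
  "wavelet_frame K N \<Psi> \<longleftrightarrow>
     (\<forall>l\<in>{1..N}. L2 K (\<Psi> l)) \<and>
     (\<exists>A B :: real. A > 0 \<and> B > 0 \<and>
        (\<forall>f. L2 K f \<longrightarrow>
           (let S = (\<Sum>\<^sub>\<infinity>(l, j, k)\<in>wavelet_index N.
                       ennreal ((cmod (l2_inner K f (wavelet K (\<Psi> l) j k)))\<^sup>2))
            in ennreal A * l2sq K f \<le> S \<and> S \<le> ennreal B * l2sq K f)))"

text \<open>The series defining orthogonality converges to 0 unconditionally in the norm of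
  \<open>L\<^sup>2(K)\<close>.\<close>

definition orthogonal_wavelet_frames ::
  "('k::local_field) lf_data \<Rightarrow> nat \<Rightarrow> (nat \<Rightarrow> 'k \<Rightarrow> complex) \<Rightarrow> (nat \<Rightarrow> 'k \<Rightarrow> complex) \<Rightarrow> bool" where
  "orthogonal_wavelet_frames K N \<Psi> \<Phi> \<longleftrightarrow>
     wavelet_frame K N \<Psi> \<and> wavelet_frame K N \<Phi> \<and>
     (\<forall>f. L2 K f \<longrightarrow>
        ((\<lambda>F. l2sq K (\<lambda>x. \<Sum>(l, j, k)\<in>F.
                 l2_inner K f (wavelet K (\<Psi> l) j k) * wavelet K (\<Phi> l) j k x)) \<longlongrightarrow> 0)
          (finite_subsets_at_top (wavelet_index N)))"

end

theory Submission
  imports Defs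
begin

text \<open>
  Everything happens on the Fourier side. By the Plancherel theorem (\<open>Plancherel\<close>,
  \<open>is_L2_fourier_exists\<close>, \<open>Parseval\<close>) the frame coefficients of \<open>f\<close> are the inner products of
  \<open>h = f\<^sup>^\<close> with the transforms of the wavelets, and moving the dilation onto \<open>h\<close> turns the
  coefficients at scale \<open>j\<close> into the Fourier coefficients on \<open>\<DD>\<close> of the bracket
  \<open>\<Sum>\<^sub>n D\<^sup>jh(\<xi> + u(n)) cnj(w(\<xi> + u(n)))\<close>, where \<open>w\<close> is the transform of the generator and \<open>D\<close>
  the unitary dilation. By Parseval on \<open>\<DD>\<close> their squared sum, the energy, is the squared
  \<open>L\<^sup>2\<close> norm of the bracket.

  Let the generators satisfy \<open>w\<^sub>r(\<xi>) = \<Sum>\<^sub>l b\<^sub>r\<^sub>l(\<xi>) m\<^sub>l(\<pp>\<xi>) \<phi>\<^sup>^(\<pp>\<xi>)\<close> with periodic \<open>b\<^sub>r\<^sub>l\<close> such that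
  the matrix \<open>(b\<^sub>r\<^sub>l)\<close> has orthonormal columns. Splitting the index \<open>n = c + q k\<close> in the bracket,
  the matrix of masks \<open>m\<^sub>l(\<pp>\<xi> + \<pp>u(c))\<close>, which is isometric by the unitary extension principle, and
  the isometric matrix \<open>b\<close> drop out, and the energies of \<open>\<phi>\<close> and of the generators at one scale add up
  to the energy of \<open>\<phi>\<close> at the next one (\<open>energy_generated\<close>, \<open>energy_step\<close>). Summing over the scales
  telescopes. Since \<open>\<phi>\<close> has compact support, \<open>\<phi>\<^sup>^\<close> equals 1 on a whole disc around 0; hence for
  bounded \<open>h\<close> supported in an annulus the energy of \<open>\<phi>\<close> equals \<open>\<parallel>h\<parallel>\<^sup>2\<close> at all fine scales, and it tends to 0
  at coarse scales (\<open>energy_eq_norm\<close>, \<open>energy_tendsto_0\<close>). So such a family is a tight frame with bound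
  1, first for these \<open>h\<close> and by density for all (\<open>tight_frame\<close>).

  Write \<open>A = (A\<^sub>1 A\<^sub>2)\<close> with two blocks of \<open>L\<close> columns. Then \<open>\<Psi>\<^sup>*\<close> and \<open>\<Phi>\<^sup>*\<close> belong to \<open>b = A\<^sub>1\<close> and
  \<open>b = A\<^sub>2\<close>, and \<open>(A\<^sub>1 + \<omega>A\<^sub>2)/\<surd>2\<close> has orthonormal columns too whenever \<open>|\<omega>| = 1\<close>. Hence
  \<open>(\<Psi>\<^sup>* + \<omega>\<Phi>\<^sup>*)/\<surd>2\<close> generates a tight frame with the same bound for every such \<open>\<omega>\<close>, so the polarized
  sum of \<open>\<langle>f,\<psi>\<^sub>i\<rangle> cnj \<langle>f,\<phi>\<^sub>i\<rangle>\<close> over the frame is 0 (\<open>orthogonal_frames\<close>). Polarizing in \<open>f\<close>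
  as well gives orthogonality in the weak sense, and the Bessel property upgrades it to unconditional
  norm convergence (\<open>mixed_expansion_tendsto_0\<close>).
\<close>

section \<open>Square-integrable functions on a measure space\<close>

definition square_integrable :: "'a measure \<Rightarrow> ('a \<Rightarrow> complex) \<Rightarrow> bool" where
  "square_integrable M f \<longleftrightarrow> f \<in> borel_measurable M \<and> integrable M (\<lambda>x. (cmod (f x))\<^sup>2)"

text \<open>If \<open>|f|\<^sup>2\<close> is not integrable, the integral below is 0 by convention.\<close>

definition l2norm :: "'a measure \<Rightarrow> ('a \<Rightarrow> complex) \<Rightarrow> real" where
  "l2norm M f = sqrt (\<integral>x. (cmod (f x))\<^sup>2 \<partial>M)"

lemma borel_measurable_cnj [measurable (raw)]:
  "f \<in> borel_measurable M \<Longrightarrow> (\<lambda>x. cnj (f x)) \<in> borel_measurable M"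
  using borel_measurable_continuous_on[OF linear_continuous_on[OF bounded_linear_cnj]] by auto

lemma square_integrable_measurable [measurable_dest]:
  "square_integrable M f \<Longrightarrow> f \<in> borel_measurable M"
  by (simp add: square_integrable_def)

lemma square_integrable_integrable:
  "square_integrable M f \<Longrightarrow> integrable M (\<lambda>x. (cmod (f x))\<^sup>2)"
  by (simp add: square_integrable_def)

lemma l2norm_nonneg [simp]: "l2norm M f \<ge> 0"
  by (simp add: l2norm_def)

lemma l2norm_power2: "(l2norm M f)\<^sup>2 = (\<integral>x. (cmod (f x))\<^sup>2 \<partial>M)"
  by (simp add: l2norm_def)

lemma nn_integral_cmod_power2:
  "square_integrable M f \<Longrightarrow> (\<integral>\<^sup>+x. ennreal ((cmod (f x))\<^sup>2) \<partial>M) = ennreal ((l2norm M f)\<^sup>2)"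
  unfolding l2norm_power2 by (intro nn_integral_eq_integral square_integrable_integrable) auto

lemma square_integrable_iff_nn_integral:
  "square_integrable M f \<longleftrightarrow>
     f \<in> borel_measurable M \<and> (\<integral>\<^sup>+x. ennreal ((cmod (f x))\<^sup>2) \<partial>M) < \<infinity>"
  by (auto simp: square_integrable_def integrable_iff_bounded)

lemma square_integrable_cong_AE:
  assumes "square_integrable M f" "g \<in> borel_measurable M" "AE x in M. f x = g x"
  shows "square_integrable M g" "l2norm M g = l2norm M f"
proof -
  have [measurable]: "f \<in> borel_measurable M" "g \<in> borel_measurable M"
    using assms by (auto simp: square_integrable_def)
  have ae: "AE x in M. (cmod (f x))\<^sup>2 = (cmod (g x))\<^sup>2"
    using assms(3) by eventually_elim simp
  show "square_integrable M g"
    unfolding square_integrable_def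
    using integrable_cong_AE[OF _ _ ae] square_integrable_integrable[OF assms(1)] by simp
  show "l2norm M g = l2norm M f"
    unfolding l2norm_def using integral_cong_AE[OF _ _ ae] by simp
qed

lemma square_integrable_bound:
  assumes "square_integrable M f" "g \<in> borel_measurable M"
    and "AE x in M. cmod (g x) \<le> c * cmod (f x)"
  shows "square_integrable M g"
  unfolding square_integrable_def
proof (intro conjI Bochner_Integration.integrable_bound[OF integrable_mult_right[OF square_integrable_integrable[OF assms(1)], of "c\<^sup>2"]])
  show "AE x in M. norm ((cmod (g x))\<^sup>2) \<le> norm (c\<^sup>2 * (cmod (f x))\<^sup>2)"
    using assms(3)
  proof eventually_elim
    case (elim x)
    then have "(cmod (g x))\<^sup>2 \<le> (c * cmod (f x))\<^sup>2"
      by (intro power_mono) auto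
    then show ?case by (simp add: power_mult_distrib)
  qed
qed (use assms(2) in measurable)

lemma integrable_mult_cnj:
  assumes "square_integrable M f" "square_integrable M g"
  shows "integrable M (\<lambda>x. f x * cnj (g x))" "integrable M (\<lambda>x. cmod (f x) * cmod (g x))"
proof -
  note [measurable] = assms[THEN square_integrable_measurable]
  have i: "integrable M (\<lambda>x. (cmod (f x))\<^sup>2 + (cmod (g x))\<^sup>2)"
    using assms by (simp add: square_integrable_def)
  have b: "cmod (f x) * cmod (g x) \<le> (cmod (f x))\<^sup>2 + (cmod (g x))\<^sup>2" for x
    using sum_squares_bound[of "cmod (f x)" "cmod (g x)"]
      mult_nonneg_nonneg[OF norm_ge_zero[of "f x"] norm_ge_zero[of "g x"]] by linarith
  show "integrable M (\<lambda>x. f x * cnj (g x))" "integrable M (\<lambda>x. cmod (f x) * cmod (g x))"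
    using b by (auto intro!: Bochner_Integration.integrable_bound[OF i] borel_measurable_times
        borel_measurable_cnj simp: norm_mult)
qed

lemma square_integrable_zero [simp]: "square_integrable M (\<lambda>x. 0)"
  by (simp add: square_integrable_def)

lemma l2norm_zero [simp]: "l2norm M (\<lambda>x. 0) = 0"
  by (simp add: l2norm_def)

lemma square_integrable_scale:
  "square_integrable M f \<Longrightarrow> square_integrable M (\<lambda>x. c * f x)"
  by (auto simp: square_integrable_def norm_mult power_mult_distrib intro: borel_measurable_times)

lemma l2norm_scale: "l2norm M (\<lambda>x. c * f x) = cmod c * l2norm M f"
  by (simp add: l2norm_def norm_mult power_mult_distrib real_sqrt_mult)

lemma l2norm_minus: "l2norm M (\<lambda>x. f x - g x) = l2norm M (\<lambda>x. g x - f x)"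
  by (simp add: l2norm_def norm_minus_commute)

lemma square_integrable_cnj: "square_integrable M f \<Longrightarrow> square_integrable M (\<lambda>x. cnj (f x))"
  by (simp add: square_integrable_def borel_measurable_cnj)

lemma square_integrable_add:
  assumes "square_integrable M f" "square_integrable M g"
  shows "square_integrable M (\<lambda>x. f x + g x)"
proof -
  note [measurable] = assms[THEN square_integrable_measurable]
  have i: "integrable M (\<lambda>x. (cmod (f x))\<^sup>2 + 2 * (cmod (f x) * cmod (g x)) + (cmod (g x))\<^sup>2)"
    using assms integrable_mult_cnj(2)[OF assms] by (simp add: square_integrable_def)
  have "(cmod (f x + g x))\<^sup>2 \<le> (cmod (f x))\<^sup>2 + 2 * (cmod (f x) * cmod (g x)) + (cmod (g x))\<^sup>2" for x
    using power_mono[OF norm_triangle_ineq[of "f x" "g x"], of 2] by (simp add: power2_sum)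
  then show ?thesis
    unfolding square_integrable_def
    by (intro conjI Bochner_Integration.integrable_bound[OF i]) (auto intro!: AE_I2)
qed

lemma square_integrable_diff:
  assumes "square_integrable M f" "square_integrable M g"
  shows "square_integrable M (\<lambda>x. f x - g x)"
  using square_integrable_add[OF assms(1) square_integrable_scale[OF assms(2), of "-1"]] by simp

lemma square_integrable_sum:
  "(\<And>i. i \<in> I \<Longrightarrow> square_integrable M (f i)) \<Longrightarrow> square_integrable M (\<lambda>x. \<Sum>i\<in>I. f i x)"
  by (induction I rule: infinite_finite_induct) (auto intro: square_integrable_add)

lemma Cauchy_Schwarz_integral_cmod:
  assumes "square_integrable M f" "square_integrable M g"
  shows "(\<integral>x. cmod (f x) * cmod (g x) \<partial>M) \<le> l2norm M f * l2norm M g"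
proof -
  note [measurable] = assms[THEN square_integrable_measurable]
  let ?I = "\<integral>x. cmod (f x) * cmod (g x) \<partial>M"
  have "ennreal (?I\<^sup>2) = (\<integral>\<^sup>+x. ennreal (cmod (f x)) * ennreal (cmod (g x)) \<partial>M)\<^sup>2"
    using nn_integral_eq_integral[OF integrable_mult_cnj(2)[OF assms]]
    by (simp add: ennreal_mult' ennreal_power)
  also have "\<dots> \<le> (\<integral>\<^sup>+x. ennreal (cmod (f x)) ^ 2 \<partial>M) * (\<integral>\<^sup>+x. ennreal (cmod (g x)) ^ 2 \<partial>M)"
    by (rule Cauchy_Schwarz_nn_integral) auto
  also have "\<dots> = ennreal ((l2norm M f * l2norm M g)\<^sup>2)"
    using assms by (simp add: ennreal_power nn_integral_cmod_power2 ennreal_mult' power_mult_distrib)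
  finally have "?I\<^sup>2 \<le> (l2norm M f * l2norm M g)\<^sup>2"
    by simp
  then show ?thesis
    by (rule power2_le_imp_le) simp
qed

lemma Cauchy_Schwarz_integral:
  assumes "square_integrable M f" "square_integrable M g"
  shows "cmod (\<integral>x. f x * cnj (g x) \<partial>M) \<le> l2norm M f * l2norm M g"
  using integral_norm_bound[of M "\<lambda>x. f x * cnj (g x)"] Cauchy_Schwarz_integral_cmod[OF assms]
  by (simp add: norm_mult)

lemma l2norm_triangle:
  assumes "square_integrable M f" "square_integrable M g"
  shows "l2norm M (\<lambda>x. f x + g x) \<le> l2norm M f + l2norm M g"
proof (rule power2_le_imp_le)
  note [measurable] = assms[THEN square_integrable_measurable]
  have i: "integrable M (\<lambda>x. (cmod (f x))\<^sup>2)" "integrable M (\<lambda>x. (cmod (g x))\<^sup>2)"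
    "integrable M (\<lambda>x. cmod (f x) * cmod (g x))"
    using assms integrable_mult_cnj(2)[OF assms] by (auto simp: square_integrable_def)
  have "(l2norm M (\<lambda>x. f x + g x))\<^sup>2
      \<le> (\<integral>x. (cmod (f x))\<^sup>2 + 2 * (cmod (f x) * cmod (g x)) + (cmod (g x))\<^sup>2 \<partial>M)"
    unfolding l2norm_power2
  proof (rule integral_mono)
    show "integrable M (\<lambda>x. (cmod (f x + g x))\<^sup>2)"
      using square_integrable_add[OF assms] by (simp add: square_integrable_def)
    show "(cmod (f x + g x))\<^sup>2 \<le> (cmod (f x))\<^sup>2 + 2 * (cmod (f x) * cmod (g x)) + (cmod (g x))\<^sup>2" for x
      using power_mono[OF norm_triangle_ineq[of "f x" "g x"], of 2] by (simp add: power2_sum)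
  qed (use i in auto)
  also have "\<dots> = (l2norm M f)\<^sup>2 + 2 * (\<integral>x. cmod (f x) * cmod (g x) \<partial>M) + (l2norm M g)\<^sup>2"
    using i by (simp add: l2norm_power2)
  also have "\<dots> \<le> (l2norm M f + l2norm M g)\<^sup>2"
    using Cauchy_Schwarz_integral_cmod[OF assms] by (simp add: power2_sum)
  finally show "(l2norm M (\<lambda>x. f x + g x))\<^sup>2 \<le> (l2norm M f + l2norm M g)\<^sup>2" .
qed simp

lemma l2norm_triangle_diff:
  assumes "square_integrable M f" "square_integrable M g" "square_integrable M h"
  shows "l2norm M (\<lambda>x. f x - h x) \<le> l2norm M (\<lambda>x. f x - g x) + l2norm M (\<lambda>x. g x - h x)"
  using l2norm_triangle[of M "\<lambda>x. f x - g x" "\<lambda>x. g x - h x"] assms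
  by (simp add: square_integrable_diff)

lemma l2norm_diff_bound:
  assumes "square_integrable M f" "square_integrable M g"
  shows "\<bar>l2norm M f - l2norm M g\<bar> \<le> l2norm M (\<lambda>x. f x - g x)"
  using l2norm_triangle_diff[OF assms square_integrable_zero]
    l2norm_triangle_diff[OF assms(2,1) square_integrable_zero] l2norm_minus[of M f g]
  by simp

lemma tendsto_l2norm:
  assumes f: "\<And>n. square_integrable M (f n)" "square_integrable M g"
    and lim: "((\<lambda>n. l2norm M (\<lambda>x. f n x - g x)) \<longlongrightarrow> 0) F"
  shows "((\<lambda>n. l2norm M (f n)) \<longlongrightarrow> l2norm M g) F"
proof -
  have "((\<lambda>n. l2norm M (f n) - l2norm M g) \<longlongrightarrow> 0) F"
    by (rule Lim_null_comparison[OF _ lim]) (use f in \<open>auto intro!: always_eventually l2norm_diff_bound\<close>)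
  then show ?thesis by (simp add: LIM_zero_iff)
qed

text \<open>Fatou's lemma, in the form that limits of bounded sequences stay in the ball.\<close>

lemma l2norm_Fatou:
  assumes f: "\<And>n. square_integrable M (f n)" and g [measurable]: "g \<in> borel_measurable M"
    and lim: "AE x in M. (\<lambda>n. f n x) \<longlonglongrightarrow> g x"
    and bd: "eventually (\<lambda>n. l2norm M (f n) \<le> C) sequentially"
  shows "square_integrable M g" "l2norm M g \<le> C"
proof -
  note [measurable] = f[THEN square_integrable_measurable]
  have C: "C \<ge> 0"
  proof -
    obtain n where "l2norm M (f n) \<le> C"
      using eventually_happens'[OF sequentially_bot bd] by blast
    then show ?thesis using l2norm_nonneg[of M "f n"] by linarith
  qed
  have "(\<integral>\<^sup>+x. ennreal ((cmod (g x))\<^sup>2) \<partial>M) = (\<integral>\<^sup>+x. liminf (\<lambda>n. ennreal ((cmod (f n x))\<^sup>2)) \<partial>M)"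
  proof (rule nn_integral_cong_AE, use lim in eventually_elim)
    case (elim x)
    have "(\<lambda>n. ennreal ((cmod (f n x))\<^sup>2)) \<longlonglongrightarrow> ennreal ((cmod (g x))\<^sup>2)"
      by (intro tendsto_ennrealI tendsto_power tendsto_norm elim)
    then show ?case
      by (metis lim_imp_Liminf sequentially_bot)
  qed
  also have "\<dots> \<le> liminf (\<lambda>n. \<integral>\<^sup>+x. ennreal ((cmod (f n x))\<^sup>2) \<partial>M)"
    by (rule nn_integral_liminf) auto
  also have "\<dots> \<le> liminf (\<lambda>n::nat. ennreal (C\<^sup>2))"
    by (rule Liminf_mono, use bd in eventually_elim)
       (simp add: nn_integral_cmod_power2[OF f] ennreal_leI power_mono)
  finally have le: "(\<integral>\<^sup>+x. ennreal ((cmod (g x))\<^sup>2) \<partial>M) \<le> ennreal (C\<^sup>2)"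
    by (simp add: Liminf_const)
  then show g2: "square_integrable M g"
    unfolding square_integrable_iff_nn_integral using le_less_trans[OF le] by simp
  have "(l2norm M g)\<^sup>2 \<le> C\<^sup>2"
    using le unfolding nn_integral_cmod_power2[OF g2] by (subst (asm) ennreal_le_iff) auto
  then show "l2norm M g \<le> C"
    using C by (rule power2_le_imp_le)
qed

text \<open>An isometry into another \<open>L\<^sup>2\<close> space that is only known along a convergent sequence extends to
  its limit as soon as the images converge pointwise: the tails of the image sequence are controlled
  by Fatou's lemma. The isometry is the Fourier transform in the proof of the Plancherel theorem, and
  the map to the frame coefficients, with counting measure on the index set, for tight frames.\<close>

lemma isometry_limit:
  assumes v: "\<And>n. square_integrable M (v n)" and f: "square_integrable M f"
    and vf: "(\<lambda>n. l2norm M (\<lambda>x. v n x - f x)) \<longlonglongrightarrow> 0"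
    and V: "\<And>n. square_integrable N (V n)" and F: "F \<in> borel_measurable N"
    and VF: "AE y in N. (\<lambda>n. V n y) \<longlonglongrightarrow> F y"
    and iso: "\<And>m n. l2norm N (\<lambda>y. V n y - V m y) = l2norm M (\<lambda>x. v n x - v m x)"
    and iso1: "\<And>n. l2norm N (V n) = l2norm M (v n)"
  shows "square_integrable N F" "l2norm N F = l2norm M f"
    "(\<lambda>n. l2norm N (\<lambda>y. V n y - F y)) \<longlonglongrightarrow> 0"
proof -
  note [measurable] = V[THEN square_integrable_measurable] F
  have tail: "square_integrable N (\<lambda>y. V m y - F y) \<and>
      l2norm N (\<lambda>y. V m y - F y) \<le> l2norm M (\<lambda>x. v m x - f x) + e" if "e > 0" for m e
  proof -
    have ev: "eventually (\<lambda>n. l2norm N (\<lambda>y. V m y - V n y) \<le> l2norm M (\<lambda>x. v m x - f x) + e) sequentially"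
      using order_tendstoD(2)[OF vf \<open>e > 0\<close>]
    proof eventually_elim
      case (elim n)
      have "l2norm N (\<lambda>y. V m y - V n y) = l2norm M (\<lambda>x. v m x - v n x)"
        by (rule iso)
      also have "\<dots> \<le> l2norm M (\<lambda>x. v m x - f x) + l2norm M (\<lambda>x. f x - v n x)"
        by (intro l2norm_triangle_diff v f)
      finally show ?case using elim l2norm_minus[of M "v n" f] by simp
    qed
    have ae: "AE y in N. (\<lambda>n. V m y - V n y) \<longlonglongrightarrow> V m y - F y"
      using VF by eventually_elim (intro tendsto_intros)
    show ?thesis
      by (intro conjI l2norm_Fatou[OF square_integrable_diff[OF V V] _ ae ev]) measurable
  qed
  have F2: "square_integrable N F"
    using square_integrable_diff[OF V[of 0] conjunct1[OF tail[of 1 0]]] by simp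
  have le: "l2norm N (\<lambda>y. V m y - F y) \<le> l2norm M (\<lambda>x. v m x - f x)" for m
    by (rule field_le_epsilon) (rule conjunct2[OF tail])
  show lim: "(\<lambda>n. l2norm N (\<lambda>y. V n y - F y)) \<longlonglongrightarrow> 0"
    by (rule Lim_null_comparison[OF _ vf]) (use le in auto)
  show "square_integrable N F" by (rule F2)
  have "(\<lambda>n. l2norm M (v n)) \<longlonglongrightarrow> l2norm N F"
    using tendsto_l2norm[OF V F2 lim] by (simp add: iso1)
  then show "l2norm N F = l2norm M f"
    using tendsto_l2norm[OF v f vf] LIMSEQ_unique by blast
qed

lemma l2_dominated_convergence:
  assumes f: "square_integrable M f" and g [measurable]: "\<And>n. g n \<in> borel_measurable M"
    and lim: "AE x in M. (\<lambda>n. g n x) \<longlonglongrightarrow> f x"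
    and bd: "\<And>n. AE x in M. cmod (g n x) \<le> c * cmod (f x)"
  shows "(\<lambda>n. l2norm M (\<lambda>x. g n x - f x)) \<longlonglongrightarrow> 0"
proof -
  note [measurable] = f[THEN square_integrable_measurable]
  have "(\<lambda>n. \<integral>x. (cmod (g n x - f x))\<^sup>2 \<partial>M) \<longlonglongrightarrow> (\<integral>x. 0 \<partial>M)"
  proof (rule integral_dominated_convergence)
    show "integrable M (\<lambda>x. (c + 1)\<^sup>2 * (cmod (f x))\<^sup>2)"
      using f by (intro integrable_mult_right square_integrable_integrable)
    show "AE x in M. (\<lambda>n. (cmod (g n x - f x))\<^sup>2) \<longlonglongrightarrow> 0"
      using lim
    proof eventually_elim
      case (elim x)
      show ?case
        using tendsto_power[OF tendsto_norm[OF LIM_zero[OF elim]], of 2] by simp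
    qed
    show "AE x in M. norm ((cmod (g n x - f x))\<^sup>2) \<le> (c + 1)\<^sup>2 * (cmod (f x))\<^sup>2" for n
      using bd[of n]
    proof eventually_elim
      case (elim x)
      have "cmod (g n x - f x) \<le> (c + 1) * cmod (f x)"
        using norm_triangle_ineq4[of "g n x" "f x"] elim by (simp add: algebra_simps)
      from power_mono[OF this, of 2] show ?case by (simp add: power_mult_distrib)
    qed
  qed auto
  from tendsto_real_sqrt[OF this] show ?thesis
    by (simp add: l2norm_def)
qed

text \<open>The Riesz--Fischer theorem. Along a subsequence with
  \<open>\<parallel>f\<^sub>k\<^sub>+\<^sub>1 - f\<^sub>k\<parallel>\<^sub>2 < 8\<^sup>-\<^sup>k\<close> the function \<open>\<Sum>\<^sub>k 2\<^sup>k |f\<^sub>k\<^sub>+\<^sub>1 - f\<^sub>k|\<^sup>2\<close> is integrable, so almost everywhere the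
  increments decrease geometrically.\<close>

lemma l2_complete:
  assumes f: "\<And>n. square_integrable M (f n)"
    and cauchy: "\<And>e. e > 0 \<Longrightarrow> \<exists>N. \<forall>m\<ge>N. \<forall>n\<ge>N. l2norm M (\<lambda>x. f m x - f n x) < e"
  obtains g where "square_integrable M g" "(\<lambda>n. l2norm M (\<lambda>x. f n x - g x)) \<longlonglongrightarrow> 0"
proof -
  note [measurable] = f[THEN square_integrable_measurable]
  have "\<exists>N. \<forall>m\<ge>N. \<forall>n\<ge>N. l2norm M (\<lambda>x. f m x - f n x) < (1/8) ^ k" for k
    by (rule cauchy) simp
  then obtain N where N: "\<And>k m n. m \<ge> N k \<Longrightarrow> n \<ge> N k \<Longrightarrow> l2norm M (\<lambda>x. f m x - f n x) < (1/8) ^ k"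
    by metis
  \<comment> \<open>Taking the maximum makes every later \<open>r k\<close> admissible for the accuracy \<open>8\<^sup>-\<^sup>j\<close> as well.\<close>
  define r where "r k = Max (N ` {..k}) + k" for k
  have rN: "r k \<ge> N j" if "j \<le> k" for j k
    using Max_ge[of "N ` {..k}" "N j"] that by (simp add: r_def trans_le_add1)
  define d where "d k x = f (r (Suc k)) x - f (r k) x" for k x
  have [measurable]: "d k \<in> borel_measurable M" for k
    unfolding d_def by measurable
  have d2: "square_integrable M (d k)" for k
    unfolding d_def by (intro square_integrable_diff f)
  have dn: "l2norm M (d k) < (1/8) ^ k" for k
    unfolding d_def by (rule N) (auto intro: rN)
  have "(\<integral>\<^sup>+x. (\<Sum>k. ennreal (2 ^ k * (cmod (d k x))\<^sup>2)) \<partial>M)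
      = (\<Sum>k. \<integral>\<^sup>+x. ennreal (2 ^ k * (cmod (d k x))\<^sup>2) \<partial>M)"
    by (rule nn_integral_suminf) auto
  also have "\<dots> = (\<Sum>k. ennreal (2 ^ k * (l2norm M (d k))\<^sup>2))"
    by (simp add: ennreal_mult nn_integral_cmult nn_integral_cmod_power2[OF d2])
  also have "\<dots> \<le> (\<Sum>k. ennreal ((1/2) ^ k))"
  proof (intro suminf_le ennreal_leI summableI)
    fix k
    have "(l2norm M (d k))\<^sup>2 \<le> ((1/8) ^ k)\<^sup>2"
      using dn[of k] by (intro power_mono) auto
    also have "\<dots> = (1/64) ^ k"
      by (simp add: power2_eq_square power_mult_distrib[symmetric])
    finally have "2 ^ k * (l2norm M (d k))\<^sup>2 \<le> 2 ^ k * (1/64) ^ k"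
      by (intro mult_left_mono) auto
    also have "\<dots> = (1/32) ^ k"
      by (simp add: power_mult_distrib[symmetric])
    also have "\<dots> \<le> (1/2) ^ k"
      by (intro power_mono) auto
    finally show "2 ^ k * (l2norm M (d k))\<^sup>2 \<le> (1/2) ^ k" .
  qed
  also have "\<dots> = ennreal (\<Sum>k. (1/2) ^ k)"
    by (intro suminf_ennreal2) (auto intro: summable_geometric)
  also have "\<dots> < \<infinity>"
    by simp
  finally have "(\<integral>\<^sup>+x. (\<Sum>k. ennreal (2 ^ k * (cmod (d k x))\<^sup>2)) \<partial>M) \<noteq> \<infinity>"
    by (rule less_imp_neq)
  then have "AE x in M. (\<Sum>k. ennreal (2 ^ k * (cmod (d k x))\<^sup>2)) \<noteq> \<infinity>"
    by (intro nn_integral_noteq_infinite) auto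
  then have conv: "AE x in M. convergent (\<lambda>k. f (r k) x)"
  proof eventually_elim
    case (elim x)
    have "summable (\<lambda>k. 2 ^ k * (cmod (d k x))\<^sup>2)"
      using elim by (intro summable_suminf_not_top) (auto simp: infinity_ennreal_def)
    then have "Bseq (\<lambda>k. 2 ^ k * (cmod (d k x))\<^sup>2)"
      by (intro convergent_imp_Bseq) (auto dest: summable_LIMSEQ_zero simp: convergent_def)
    then obtain C where C: "C > 0" "\<And>k. 2 ^ k * (cmod (d k x))\<^sup>2 \<le> C"
      by (auto simp: Bseq_def)
    have bd: "norm (d k x) \<le> sqrt C * (sqrt (1/2)) ^ k" for k
    proof -
      have "(cmod (d k x))\<^sup>2 \<le> C * (1/2) ^ k"
        using C(2)[of k] by (simp add: field_simps)
      then have "sqrt ((cmod (d k x))\<^sup>2) \<le> sqrt (C * (1/2) ^ k)"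
        by (rule real_sqrt_le_mono)
      then show ?thesis by (simp add: real_sqrt_mult real_sqrt_power)
    qed
    have "sqrt (1/2) < (1::real)"
      by (simp add: real_sqrt_lt_1_iff)
    then have "summable (\<lambda>k. sqrt C * (sqrt (1/2)) ^ k)"
      by (intro summable_mult summable_geometric) (simp add: real_sqrt_ge_zero)
    then have "summable (\<lambda>k. d k x)"
      by (rule summable_comparison_test') (use bd in auto)
    then have "convergent (\<lambda>k. \<Sum>i<k. d i x)"
      by (simp add: summable_iff_convergent)
    moreover have "(\<Sum>i<k. d i x) = f (r k) x - f (r 0) x" for k
      unfolding d_def by (rule sum_lessThan_telescope)
    ultimately show ?case
      using convergent_add[OF _ convergent_const[of "f (r 0) x"], of "\<lambda>k. f (r k) x - f (r 0) x"] by simp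
  qed
  define g where "g x = lim (\<lambda>k. f (r k) x)" for x
  have [measurable]: "g \<in> borel_measurable M"
    unfolding g_def by measurable
  have lim: "AE x in M. (\<lambda>k. f (r k) x) \<longlonglongrightarrow> g x"
    using conv by eventually_elim (simp add: g_def convergent_LIMSEQ_iff)
  have tail: "square_integrable M (\<lambda>x. f n x - g x) \<and> l2norm M (\<lambda>x. f n x - g x) \<le> (1/8) ^ K"
    if "n \<ge> N K" for n K
  proof -
    have ae: "AE x in M. (\<lambda>k. f n x - f (r k) x) \<longlonglongrightarrow> f n x - g x"
      using lim by eventually_elim (intro tendsto_intros)
    have ev: "eventually (\<lambda>k. l2norm M (\<lambda>x. f n x - f (r k) x) \<le> (1/8) ^ K) sequentially"
      using eventually_ge_at_top[of K]
      by eventually_elim (rule less_imp_le, rule N, auto intro: that rN)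
    show ?thesis
      by (intro conjI l2norm_Fatou[OF square_integrable_diff[OF f f] _ ae ev]) measurable
  qed
  show ?thesis
  proof
    show "square_integrable M g"
      using square_integrable_diff[OF f[of "N 0"] conjunct1[OF tail[of 0 "N 0"]]] by simp
    show "(\<lambda>n. l2norm M (\<lambda>x. f n x - g x)) \<longlonglongrightarrow> 0"
    proof (rule LIMSEQ_I)
      fix e :: real assume "e > 0"
      then obtain K where "(1/8::real) ^ K < e"
        using real_arch_pow_inv[of e "1/8"] by auto
      then show "\<exists>no. \<forall>n\<ge>no. norm (l2norm M (\<lambda>x. f n x - g x) - 0) < e"
        using tail[of K] by (intro exI[of _ "N K"]) fastforce
    qed
  qed
qed

lemma polarization:
  fixes a b :: complex
  shows "4 * (a * cnj b) = of_real ((cmod (a + b))\<^sup>2) - of_real ((cmod (a - b))\<^sup>2)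
    + \<i> * of_real ((cmod (a + \<i> * b))\<^sup>2) - \<i> * of_real ((cmod (a - \<i> * b))\<^sup>2)"
  unfolding complex_norm_square by (simp add: algebra_simps)

text \<open>Norms determine inner products. This reduces both the Parseval identity and the orthogonality of
  two frames to statements about norms.\<close>

lemma polarization_integral:
  assumes f: "square_integrable M f" and g: "square_integrable M g"
  shows "4 * (\<integral>x. f x * cnj (g x) \<partial>M)
    = of_real ((l2norm M (\<lambda>x. f x + g x))\<^sup>2) - of_real ((l2norm M (\<lambda>x. f x - g x))\<^sup>2)
    + \<i> * of_real ((l2norm M (\<lambda>x. f x + \<i> * g x))\<^sup>2) - \<i> * of_real ((l2norm M (\<lambda>x. f x - \<i> * g x))\<^sup>2)"
proof -
  have i: "integrable M (\<lambda>x. complex_of_real ((cmod (f x + c * g x))\<^sup>2))" for c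
    by (intro integrable_of_real square_integrable_integrable square_integrable_add
        square_integrable_scale f g)
  have "4 * (\<integral>x. f x * cnj (g x) \<partial>M) = (\<integral>x. 4 * (f x * cnj (g x)) \<partial>M)"
    by simp
  also have "\<dots> = (\<integral>x. of_real ((cmod (f x + g x))\<^sup>2) - of_real ((cmod (f x - g x))\<^sup>2)
    + \<i> * of_real ((cmod (f x + \<i> * g x))\<^sup>2) - \<i> * of_real ((cmod (f x - \<i> * g x))\<^sup>2) \<partial>M)"
    by (simp only: polarization)
  finally show ?thesis
    using i[of 1] i[of "-1"] i[of \<i>] i[of "- \<i>"]
    by (simp only: l2norm_power2 integral_complex_of_real[symmetric]
        Bochner_Integration.integral_add Bochner_Integration.integral_diff
        Bochner_Integration.integrable_add Bochner_Integration.integrable_diff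
        integrable_mult_right integral_mult_right_zero mult_1 mult_minus_left
        diff_conv_add_uminus[symmetric])
qed

section \<open>The absolute value and the discs\<close>

lemma dist_eq_absv: "dist x y = absv (x - y)" for x y :: "'k::local_field"
  using dist_add_right[of x "- y" y] by (simp add: absv_def)

lemma absv_nonneg [simp]: "0 \<le> absv x"
  by (simp add: absv_def)

lemma absv_eq_0_iff [simp]: "absv x = 0 \<longleftrightarrow> x = 0"
  by (simp add: absv_def)

lemma absv_0 [simp]: "absv 0 = 0"
  by simp

lemma absv_pos_iff [simp]: "0 < absv x \<longleftrightarrow> x \<noteq> 0"
  using absv_nonneg[of x] absv_eq_0_iff[of x] by linarith

lemma absv_mult: "absv (x * y) = absv x * absv y"
  by (simp add: absv_def dist_mult_zero)

lemma absv_1 [simp]: "absv (1 :: 'k::local_field) = 1"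
  using absv_mult[of "1 :: 'k" 1] by simp

lemma absv_minus [simp]: "absv (- x) = absv x"
  using dist_eq_absv[of 0 x] by (simp add: absv_def dist_commute)

lemma absv_diff_le: "absv (x - y) \<le> max (absv x) (absv y)"
  using dist_ultrametric[of x y 0] by (simp add: dist_eq_absv)

lemma absv_add_le: "absv (x + y) \<le> max (absv x) (absv y)"
  using absv_diff_le[of x "- y"] by simp

lemma absv_inverse: "absv (inverse x) = inverse (absv x)"
proof (cases "x = 0")
  case False
  then have "absv x * absv (inverse x) = 1"
    by (simp flip: absv_mult)
  then show ?thesis using inverse_unique by force
qed simp

lemma absv_power: "absv (x ^ n) = absv x ^ n"
  by (induction n) (simp_all add: absv_mult)

lemma absv_power_int: "absv (x powi n) = absv x powi n"
  by (simp add: power_int_def absv_power absv_inverse)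

lemma absv_of_nat_le: "absv (of_nat n :: 'k::local_field) \<le> 1"
proof (induction n)
  case (Suc n)
  then show ?case using absv_add_le[of "1::'k" "of_nat n"] by simp
qed simp

lemma absv_sum_le: "(\<And>i. i \<in> I \<Longrightarrow> absv (f i) \<le> r) \<Longrightarrow> 0 \<le> r \<Longrightarrow> absv (sum f I) \<le> r"
proof (induction I rule: infinite_finite_induct)
  case (insert x F)
  then have "absv (f x) \<le> r" "absv (sum f F) \<le> r" by auto
  then have "absv (f x + sum f F) \<le> r"
    using absv_add_le[of "f x" "sum f F"] by linarith
  then show ?case using insert by simp
qed auto

lemma continuous_on_affine: "continuous_on UNIV (\<lambda>x::'k::local_field. a * x + b)"
  unfolding continuous_on_iff
proof safe
  fix x :: 'k and e :: real assume "e > 0"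
  then have "dist (a * y + b) (a * x + b) < e" if "dist y x < e / (absv a + 1)" for y
  proof -
    have "absv (a * y + b - (a * x + b)) = absv a * absv (y - x)"
      by (simp add: algebra_simps flip: absv_mult)
    also have "\<dots> \<le> (absv a + 1) * absv (y - x)"
      by (intro mult_right_mono) auto
    also have "\<dots> < e"
      using that by (simp add: dist_eq_absv pos_less_divide_eq add_nonneg_pos mult.commute)
    finally show ?thesis by (simp add: dist_eq_absv)
  qed
  then show "\<exists>d>0. \<forall>x'\<in>UNIV. dist x' x < d \<longrightarrow> dist (a * x' + b) (a * x + b) < e"
    using \<open>e > 0\<close> by (intro exI[of _ "e / (absv a + 1)"]) (auto intro!: divide_pos_pos add_nonneg_pos)
qed

text \<open>Any prescribed sequence of \<open>c\<close> digits is realized below \<open>p\<^sup>c\<close>; this makes the digit expansion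
  underlying \<open>u\<close> surjective onto the span of the \<open>\<zeta>\<^sub>i\<close>.\<close>

lemma digits_exist:
  assumes "\<And>i. a i < p"
  shows "\<exists>b < p ^ c. \<forall>i<c. (b div p ^ i) mod p = (a i :: nat)"
  using assms
proof (induction c arbitrary: a)
  case (Suc c)
  from Suc.IH[of "\<lambda>i. a (Suc i)"] Suc.prems
  obtain b where b: "b < p ^ c" "\<And>i. i < c \<Longrightarrow> (b div p ^ i) mod p = a (Suc i)"
    by auto
  have a0: "a 0 < p" by (rule Suc.prems)
  have "a 0 + p * b < p * (b + 1)"
    using a0 by simp
  also have "\<dots> \<le> p * p ^ c"
    using b(1) by (intro mult_left_mono) auto
  finally have "a 0 + p * b < p ^ Suc c" by simp
  moreover have "((a 0 + p * b) div p ^ i) mod p = a i" if "i < Suc c" for i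
  proof (cases i)
    case 0
    then show ?thesis using a0 by simp
  next
    case (Suc j)
    have "(a 0 + p * b) div p ^ i = b div p ^ j"
      using a0 by (simp add: Suc div_mult2_eq)
    then show ?thesis using b(2)[of j] that Suc by simp
  qed
  ultimately show ?case by blast
qed auto

text \<open>Expanding the squares leaves the Gram matrix of the columns, which is the identity.\<close>

lemma orthonormal_columns_isometry:
  fixes b :: "'r \<Rightarrow> 'l \<Rightarrow> complex"
  assumes "finite J" and orth: "\<And>l l'. l \<in> J \<Longrightarrow> l' \<in> J \<Longrightarrow> (\<Sum>r\<in>R. cnj (b r l) * b r l') = (if l = l' then 1 else 0)"
  shows "(\<Sum>r\<in>R. (cmod (\<Sum>l\<in>J. cnj (b r l) * x l))\<^sup>2) = (\<Sum>l\<in>J. (cmod (x l))\<^sup>2)"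
proof -
  have "complex_of_real (\<Sum>r\<in>R. (cmod (\<Sum>l\<in>J. cnj (b r l) * x l))\<^sup>2)
      = (\<Sum>r\<in>R. (\<Sum>l\<in>J. cnj (b r l) * x l) * (\<Sum>l'\<in>J. b r l' * cnj (x l')))"
    by (simp add: complex_norm_square cnj_sum del: of_real_power)
  also have "\<dots> = (\<Sum>r\<in>R. \<Sum>l\<in>J. \<Sum>l'\<in>J. (x l * cnj (x l')) * (cnj (b r l) * b r l'))"
    by (simp add: sum_product mult_ac)
  also have "\<dots> = (\<Sum>l\<in>J. \<Sum>r\<in>R. \<Sum>l'\<in>J. (x l * cnj (x l')) * (cnj (b r l) * b r l'))"
    by (rule sum.swap)
  also have "\<dots> = (\<Sum>l\<in>J. \<Sum>l'\<in>J. \<Sum>r\<in>R. (x l * cnj (x l')) * (cnj (b r l) * b r l'))"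
    by (rule sum.cong[OF refl], rule sum.swap)
  also have "\<dots> = (\<Sum>l\<in>J. \<Sum>l'\<in>J. if l' = l then x l * cnj (x l) else 0)"
    unfolding sum_distrib_left[symmetric] by (intro sum.cong refl) (auto simp: orth)
  also have "\<dots> = complex_of_real (\<Sum>l\<in>J. (cmod (x l))\<^sup>2)"
    using \<open>finite J\<close> by (simp add: complex_norm_square del: of_real_power)
  finally show ?thesis unfolding of_real_eq_iff .
qed

lemma sum_lessThan_mult_nat:
  fixes g :: "nat \<Rightarrow> 'a::comm_monoid_add"
  shows "(\<Sum>n<q * M. g n) = (\<Sum>b<q. \<Sum>k<M. g (b + q * k))"
proof -
  have "(\<Sum>n<q * M. g n) = (\<Sum>k<M. sum g {k * q ..< k * q + q})"
    by (simp add: sum.nat_group mult.commute)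
  also have "\<dots> = (\<Sum>k<M. \<Sum>b<q. g (b + q * k))"
    by (simp add: sum.atLeastLessThan_shift_0[of _ "_ * q"] atLeast0LessThan algebra_simps)
  also have "\<dots> = (\<Sum>b<q. \<Sum>k<M. g (b + q * k))"
    by (rule sum.swap)
  finally show ?thesis .
qed

context local_field_setting
begin

abbreviation q :: nat where "q \<equiv> res_card K"
abbreviation pp :: 'k ("\<pp>") where "\<pp> \<equiv> prm K"
abbreviation u :: "nat \<Rightarrow> 'k" where "u \<equiv> u_rep K"
abbreviation mu :: "'k measure" ("\<mu>") where "\<mu> \<equiv> haar K"

lemma CHAR_ge_2: "CHAR('k) \<ge> 2"
  using char_pos CHAR_not_1'[where 'a = 'k] by linarith

lemma absv_prm_less_1: "absv \<pp> < 1"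
proof -
  have "\<pp> * 1 \<in> prime_ideal"
    unfolding prime_element by (rule imageI) (simp add: int_ring_def)
  then show ?thesis by (simp add: prime_ideal_def)
qed

lemma q_ge_2: "q \<ge> 2"
proof -
  have "q \<noteq> 0" using char_pos by (simp add: res_card_def)
  moreover have "q \<noteq> 1"
    using absv_prm_less_1 absv_prime_element by auto
  ultimately show ?thesis by linarith
qed

lemma q_gt_0 [simp]: "q > 0" "real q > 0" "real q > 1"
  using q_ge_2 by auto

lemma q_neq_0 [simp]: "real q \<noteq> 0" "q \<noteq> 0"
  using q_ge_2 by auto

lemma res_deg_pos: "res_deg K > 0"
  using q_ge_2 by (cases "res_deg K") (auto simp: res_card_def)

lemma prm_neq_0 [simp]: "\<pp> \<noteq> 0"
  using absv_prime_element q_gt_0 by (metis absv_0 divide_eq_0_iff less_irrefl zero_neq_one)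

lemma absv_prm_powi: "absv (\<pp> powi j) = real q powi (- j)"
  by (simp add: absv_power_int absv_prime_element power_int_minus power_int_inverse divide_inverse)

lemma q_powi_le_iff [simp]: "real q powi a \<le> real q powi b \<longleftrightarrow> a \<le> b"
proof
  assume "a \<le> b"
  then show "real q powi a \<le> real q powi b"
    using q_gt_0(3) by (intro power_int_increasing) linarith+
next
  assume le: "real q powi a \<le> real q powi b"
  show "a \<le> b"
  proof (rule ccontr)
    assume "\<not> a \<le> b"
    then have "real q powi b < real q powi a"
      using q_gt_0(3) by (intro power_int_strict_increasing) auto
    with le show False by simp
  qed
qed

lemma q_powi_less_iff [simp]: "real q powi a < real q powi b \<longleftrightarrow> a < b"
  by (meson linorder_not_le q_powi_le_iff)

lemma q_powi_pos [simp]: "0 < real q powi a"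
  by simp

text \<open>The ball \<open>\<pp>\<^sup>-\<^sup>n\<DD>\<close>. The exponent is chosen so that the radius and the Haar measure are both \<open>q\<^sup>n\<close>.\<close>

definition disc :: "int \<Rightarrow> 'k set" where
  "disc n = {x. absv x \<le> real q powi n}"

lemma disc_0_eq: "disc 0 = int_ring"
  by (simp add: disc_def int_ring_def)

lemma zero_in_disc [simp]: "0 \<in> disc n"
  by (simp add: disc_def)

lemma disc_mono: "m \<le> n \<Longrightarrow> disc m \<subseteq> disc n"
  by (auto simp: disc_def intro: order_trans)

lemma disc_mono': "x \<in> disc m \<Longrightarrow> m \<le> n \<Longrightarrow> x \<in> disc n"
  using disc_mono by blast

lemma disc_add: "x \<in> disc n \<Longrightarrow> y \<in> disc n \<Longrightarrow> x + y \<in> disc n"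
  using absv_add_le[of x y] by (auto simp: disc_def max_def split: if_splits)

lemma disc_diff: "x \<in> disc n \<Longrightarrow> y \<in> disc n \<Longrightarrow> x - y \<in> disc n"
  using absv_diff_le[of x y] by (auto simp: disc_def max_def split: if_splits)

lemma disc_minus [simp]: "- x \<in> disc n \<longleftrightarrow> x \<in> disc n"
  by (simp add: disc_def)

lemma disc_add_iff: "y \<in> disc n \<Longrightarrow> x + y \<in> disc n \<longleftrightarrow> x \<in> disc n"
  using disc_add[of x n y] disc_diff[of "x + y" n y] by auto

lemma disc_mult: "x \<in> disc m \<Longrightarrow> y \<in> disc n \<Longrightarrow> x * y \<in> disc (m + n)"
  by (auto simp: disc_def absv_mult power_int_add intro!: mult_mono)

lemma prm_powi_mult_disc [simp]: "\<pp> powi j * x \<in> disc n \<longleftrightarrow> x \<in> disc (n + j)"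
  by (simp add: disc_def absv_mult absv_prm_powi power_int_add power_int_minus field_simps)

lemma prm_power_mult_disc [simp]: "\<pp> ^ j * x \<in> disc n \<longleftrightarrow> x \<in> disc (n + int j)"
  using prm_powi_mult_disc[of "int j" x n] by simp

lemma prm_mult_disc [simp]: "\<pp> * x \<in> disc n \<longleftrightarrow> x \<in> disc (n + 1)"
  using prm_powi_mult_disc[of 1 x n] by simp

lemma inverse_prm_mult_disc [simp]: "inverse \<pp> * x \<in> disc n \<longleftrightarrow> x \<in> disc (n - 1)"
  using prm_powi_mult_disc[of "-1" x n] by (simp add: power_int_minus)

lemma prm_powi_disc [simp]: "\<pp> powi j \<in> disc n \<longleftrightarrow> - j \<le> n"
  by (simp add: disc_def absv_prm_powi)

lemma prime_ideal_eq_disc: "prime_ideal = disc (- 1)"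
proof -
  have "x \<in> (\<lambda>x. \<pp> * x) ` int_ring \<longleftrightarrow> x \<in> disc (- 1)" for x
  proof
    assume "x \<in> disc (- 1)"
    then have "inverse \<pp> * x \<in> int_ring"
      by (simp flip: disc_0_eq)
    then show "x \<in> (\<lambda>x. \<pp> * x) ` int_ring"
      by (intro image_eqI[of _ _ "inverse \<pp> * x"]) (auto simp flip: mult.assoc)
  qed (auto simp flip: disc_0_eq)
  then show ?thesis unfolding prime_element by blast
qed

text \<open>The absolute value is discrete: the prime ideal is \<open>\<pp>\<DD>\<close>, so no value lies strictly between
  \<open>1/q\<close> and 1, and scaling by powers of \<open>\<pp>\<close> excludes all other intervals.\<close>

lemma absv_less_imp_disc:
  assumes "absv x < real q powi n"
  shows "x \<in> disc (n - 1)"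
proof -
  have "absv (\<pp> powi n * x) < 1"
    using assms by (simp add: absv_mult absv_prm_powi power_int_minus field_simps)
  then have "\<pp> powi n * x \<in> disc (- 1)"
    by (simp flip: prime_ideal_eq_disc add: prime_ideal_def)
  then show ?thesis by (simp add: add.commute)
qed

lemma not_disc_absv: "x \<notin> disc n \<Longrightarrow> real q powi (n + 1) \<le> absv x"
  using absv_less_imp_disc[of x "n + 1"] by force

lemma q_powi_unbounded: "\<exists>n::nat. r < real q powi int n"
  using real_arch_pow[OF q_gt_0(3), of r] by (simp add: power_int_of_nat)

lemma ex_disc: "\<exists>n::nat. x \<in> disc (int n)"
  using q_powi_unbounded[of "absv x"] by (auto simp: disc_def intro: less_imp_le)

lemma ex_not_disc:
  assumes "x \<noteq> 0" shows "\<exists>n::nat. x \<notin> disc (- int n)"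
proof -
  obtain n :: nat where "inverse (absv x) < real q powi int n"
    using q_powi_unbounded by blast
  then have "real q powi (- int n) < absv x"
    using assms by (simp add: power_int_minus field_simps)
  then show ?thesis by (auto simp: disc_def not_le)
qed

section \<open>The translations as coset representatives\<close>

text \<open>The element of the copy of \<open>GF(q)\<close> encoded by the base-\<open>p\<close> digits of \<open>b\<close>, that is,
  \<open>\<pp> u(b)\<close> for \<open>b < q\<close>.\<close>

definition digit_value :: "nat \<Rightarrow> 'k" where
  "digit_value b = (\<Sum>i<res_deg K. of_nat ((b div CHAR('k) ^ i) mod CHAR('k)) * zeta K i)"

lemma u_digit_eq: "u_digit K b = digit_value b * inverse \<pp>"
  by (simp add: u_digit_def digit_value_def power_int_minus)

lemma digit_value_image: "digit_value ` {..<q} = zeta_span K"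
proof (intro equalityI subsetI)
  fix x assume "x \<in> digit_value ` {..<q}"
  then show "x \<in> zeta_span K"
    using char_pos by (auto simp: digit_value_def zeta_span_def)
next
  fix x assume "x \<in> zeta_span K"
  then obtain a :: "nat \<Rightarrow> nat" where a: "\<And>i. a i < CHAR('k)"
    "x = (\<Sum>i<res_deg K. of_nat (a i) * zeta K i)"
    by (auto simp: zeta_span_def)
  obtain b where "b < CHAR('k) ^ res_deg K"
    "\<And>i. i < res_deg K \<Longrightarrow> (b div CHAR('k) ^ i) mod CHAR('k) = a i"
    using digits_exist[of a "CHAR('k)" "res_deg K"] a(1) by auto
  then show "x \<in> digit_value ` {..<q}"
    using a(2) by (intro image_eqI[of _ _ b]) (auto simp: digit_value_def res_card_def)
qed

lemma inj_on_digit_value: "inj_on digit_value {..<q}"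
  by (rule eq_card_imp_inj_on) (simp_all add: digit_value_image card_zeta_span)

lemma digit_value_0 [simp]: "digit_value 0 = 0"
  by (simp add: digit_value_def)

lemma zeta_span_disc: "x \<in> zeta_span K \<Longrightarrow> x \<in> disc 0"
proof -
  assume "x \<in> zeta_span K"
  then obtain a :: "nat \<Rightarrow> nat" where "x = (\<Sum>i<res_deg K. of_nat (a i) * zeta K i)"
    by (auto simp: zeta_span_def)
  moreover have "absv (of_nat (a i) * zeta K i) \<le> 1" if "i < res_deg K" for i
    using zeta_unit[OF that] absv_of_nat_le[of "a i", where 'k = 'k]
    by (auto simp: absv_mult int_ring_def intro!: mult_le_one)
  ultimately show ?thesis
    by (auto simp: disc_def intro!: absv_sum_le)
qed

text \<open>A nonzero element of a subfield contained in the ring of integers is a unit, so distinct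
  elements of the span of the \<open>\<zeta>\<^sub>i\<close> lie in distinct residue classes.\<close>

lemma zeta_span_separated:
  assumes "x \<in> zeta_span K" "y \<in> zeta_span K" "x - y \<in> disc (- 1)"
  shows "x = y"
proof (rule ccontr)
  assume "x \<noteq> y"
  have "x - y \<in> zeta_span K" "inverse (x - y) \<in> zeta_span K"
    using assms zeta_span_subfield by (auto simp: is_subfield_def)
  then have "inverse (x - y) \<in> disc 0" by (simp add: zeta_span_disc)
  then have "(x - y) * inverse (x - y) \<in> disc (- 1 + 0)"
    using assms(3) by (intro disc_mult)
  then have "1 \<in> disc (- 1)" using \<open>x \<noteq> y\<close> by simp
  then show False using prm_powi_disc[of 0 "- 1"] by simp
qed

text \<open>The \<open>q\<close> elements of the subfield occupy \<open>q\<close> distinct residue classes, which are then all of them.\<close>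

lemma residue_representative:
  assumes "x \<in> disc 0"
  obtains b where "b < q" "x - digit_value b \<in> disc (- 1)"
proof -
  define R where "R = {(x, y). x \<in> (int_ring :: 'k set) \<and> y \<in> int_ring \<and> x - y \<in> prime_ideal}"
  have card: "card (int_ring // R) = q"
    using residue_field by (simp add: R_def)
  have R_iff: "(x, y) \<in> R \<longleftrightarrow> x \<in> disc 0 \<and> y \<in> disc 0 \<and> x - y \<in> disc (- 1)" for x y
    by (simp add: R_def disc_0_eq prime_ideal_eq_disc)
  define cl where "cl z = R `` {z}" for z
  have "inj_on cl (zeta_span K)"
  proof (rule inj_onI)
    fix x y assume xy: "x \<in> zeta_span K" "y \<in> zeta_span K" "cl x = cl y"
    then have "y \<in> cl x"
      by (auto simp: cl_def R_iff zeta_span_disc)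
    then show "x = y"
      using zeta_span_separated[OF xy(1,2)] by (simp add: cl_def R_iff)
  qed
  then have "card (cl ` zeta_span K) = q"
    by (simp add: card_image card_zeta_span)
  moreover have "cl ` zeta_span K \<subseteq> int_ring // R"
    using zeta_span_disc by (auto simp: cl_def quotient_def disc_0_eq)
  moreover have "finite (int_ring // R)"
    using card q_gt_0(1) card_ge_0_finite by metis
  ultimately have "cl ` zeta_span K = int_ring // R"
    using card by (intro card_subset_eq) auto
  moreover have "cl x \<in> int_ring // R"
    using assms by (auto simp: cl_def quotient_def disc_0_eq)
  ultimately obtain z where z: "z \<in> zeta_span K" "cl x = cl z"
    by (metis imageE)
  moreover have "z \<in> cl z"
    using z(1) by (simp add: cl_def R_iff zeta_span_disc)
  ultimately have "x - z \<in> disc (- 1)"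
    by (metis Image_singleton_iff R_iff cl_def)
  moreover obtain b where "b < q" "z = digit_value b"
    using z(1) by (auto simp flip: digit_value_image)
  ultimately show ?thesis using that by blast
qed

text \<open>The number of summands in the definition of \<open>u(n)\<close> depends on \<open>n\<close>; a common bound is needed to
  compare \<open>u(b + q k)\<close> with \<open>u(k)\<close>.\<close>

lemma u_eq_sum:
  assumes "n < N"
  shows "u n = (\<Sum>i<N. u_digit K ((n div q ^ i) mod q) * \<pp> powi (- int i))"
  unfolding u_rep_def
proof (rule sum.mono_neutral_left)
  show "\<forall>i\<in>{..<N} - {..n}. u_digit K (n div q ^ i mod q) * \<pp> powi (- int i) = 0"
  proof
    fix i assume "i \<in> {..<N} - {..n}"
    then have "n < i" by auto
    also have "i < q ^ i"
      using q_ge_2 by (metis less_exp order_less_le_trans power_mono zero_le_numeral)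
    finally show "u_digit K (n div q ^ i mod q) * \<pp> powi (- int i) = 0"
      by (simp add: u_digit_eq)
  qed
qed (use assms in auto)

text \<open>Splitting off the lowest base-\<open>q\<close> digit. The representation of cosets and, later, one step of
  the refinement rest on this recursion.\<close>

lemma u_rec:
  assumes "b < q"
  shows "u (b + q * k) = inverse \<pp> * (digit_value b + u k)"
proof -
  define n where "n = b + q * k"
  have nk: "n div q ^ Suc i = k div q ^ i" for i
    using assms by (simp add: n_def div_mult2_eq)
  have kn: "k < Suc n"
    using q_ge_2 by (simp add: n_def less_Suc_eq_le trans_le_add2)
  have "u n = (\<Sum>i<Suc (Suc n). u_digit K ((n div q ^ i) mod q) * \<pp> powi (- int i))"
    by (rule u_eq_sum) simp
  also have "\<dots> = u_digit K (n mod q) +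
      (\<Sum>i<Suc n. u_digit K ((k div q ^ i) mod q) * \<pp> powi (- int (Suc i)))"
    by (subst sum.lessThan_Suc_shift) (simp add: nk del: power_Suc)
  also have "(\<Sum>i<Suc n. u_digit K ((k div q ^ i) mod q) * \<pp> powi (- int (Suc i)))
      = inverse \<pp> * u k"
    unfolding u_eq_sum[OF kn] sum_distrib_left
  proof (intro sum.cong refl)
    fix i
    have "\<pp> powi (- int (Suc i)) = \<pp> powi (-1 + - int i)"
      by (simp add: algebra_simps)
    also have "\<dots> = inverse \<pp> * \<pp> powi (- int i)"
      by (subst power_int_add) (simp_all add: power_int_minus)
    finally have "\<pp> powi (- int (Suc i)) = inverse \<pp> * \<pp> powi (- int i)" .
    then show "u_digit K ((k div q ^ i) mod q) * \<pp> powi (- int (Suc i))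
        = inverse \<pp> * (u_digit K ((k div q ^ i) mod q) * \<pp> powi (- int i))"
      by simp
  qed
  also have "n mod q = b"
    using assms by (simp add: n_def)
  finally show ?thesis
    by (simp add: n_def u_digit_eq algebra_simps)
qed

lemma u_0 [simp]: "u 0 = 0"
  by (simp add: u_rep_def u_digit_eq)

lemma u_less_q: "b < q \<Longrightarrow> u b = inverse \<pp> * digit_value b"
  using u_rec[of b 0] by simp

lemma u_rec': "b < q \<Longrightarrow> u (b + q * k) = u b + inverse \<pp> * u k"
  by (simp add: u_rec u_less_q distrib_left)

lemma u_cases:
  obtains b k where "b < q" "n = b + q * k"
  by (rule that[of "n mod q" "n div q"]) simp_all

lemma digit_value_disc: "b < q \<Longrightarrow> digit_value b \<in> disc 0"
  using digit_value_image zeta_span_disc by blast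

lemma u_in_disc: "n < q ^ N \<Longrightarrow> u n \<in> disc (int N)"
proof (induction N arbitrary: n)
  case (Suc N)
  obtain b k where bk: "b < q" "n = b + q * k"
    by (rule u_cases)
  have "q * k < q * q ^ N"
    using Suc.prems unfolding bk(2) power_Suc by linarith
  then have "k < q ^ N"
    by (metis mult_less_cancel1)
  then have "u k \<in> disc (int N)"
    by (rule Suc.IH)
  then show ?case
    using bk digit_value_disc[OF bk(1)] by (auto simp: u_rec intro!: disc_add intro: disc_mono')
qed simp

text \<open>Together with \<open>u_in_disc\<close> and \<open>u_separated\<close>: the \<open>u(n)\<close> with \<open>n < q\<^sup>N\<close> represent the cosets of
  \<open>\<DD>\<close> in the disc of radius \<open>q\<^sup>N\<close>. In the inductive step the lowest digit is found in the residue
  field, after dividing out \<open>\<pp>\<^sup>-\<^sup>1\<close>.\<close>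

lemma u_cover:
  assumes "x \<in> disc (int N)"
  shows "\<exists>n < q ^ N. x - u n \<in> disc 0"
  using assms
proof (induction N arbitrary: x)
  case (Suc N)
  then have "\<pp> * x \<in> disc (int N)" by (simp add: add.commute)
  then obtain k where k: "k < q ^ N" "\<pp> * x - u k \<in> disc 0"
    using Suc.IH by blast
  from residue_representative[OF k(2)]
  obtain b where b: "b < q" "\<pp> * x - u k - digit_value b \<in> disc (- 1)"
    by blast
  have "x - u (b + q * k) = inverse \<pp> * (\<pp> * x - u k - digit_value b)"
    unfolding u_rec[OF b(1)] by (simp add: ring_distribs flip: mult.assoc)
  then have "x - u (b + q * k) \<in> disc 0"
    using b(2) by simp
  moreover have "b + q * k < q ^ Suc N"
  proof -
    have "b + q * k < q * (k + 1)" using b(1) by simp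
    also have "\<dots> \<le> q * q ^ N" using k(1) by (intro mult_left_mono) auto
    finally show ?thesis by simp
  qed
  ultimately show ?case by blast
qed auto

lemma u_separated:
  assumes "u m - u n \<in> disc 0"
  shows "m = n"
  using assms
proof (induction "m + n" arbitrary: m n rule: less_induct)
  case less
  obtain b k where bk: "b < q" "m = b + q * k"
    by (rule u_cases)
  obtain c l where cl: "c < q" "n = c + q * l"
    by (rule u_cases)
  have eq: "u m - u n = inverse \<pp> * ((digit_value b - digit_value c) + (u k - u l))"
    unfolding bk(2) cl(2) u_rec[OF bk(1)] u_rec[OF cl(1)] by (simp only: algebra_simps)
  then have *: "(digit_value b - digit_value c) + (u k - u l) \<in> disc (- 1)"
    using less.prems by simp
  have d0: "digit_value b - digit_value c \<in> disc 0"
    using bk cl by (intro disc_diff digit_value_disc)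
  have ukl: "u k - u l \<in> disc 0"
    using disc_diff[OF disc_mono'[OF *, of 0] d0] by simp
  have "k = l"
  proof (cases "m + n = 0")
    case True
    then show ?thesis using bk cl by simp
  next
    case False
    have "2 * k \<le> m" "2 * l \<le> n"
      using bk(2) cl(2) mult_le_mono1[OF q_ge_2, of k] mult_le_mono1[OF q_ge_2, of l] by linarith+
    then have "k + l < m + n"
      using False by linarith
    then show ?thesis
      using less.hyps[OF _ ukl] by blast
  qed
  then have "digit_value b - digit_value c \<in> disc (- 1)"
    using * by simp
  then have "digit_value b = digit_value c"
    using bk cl zeta_span_separated digit_value_image by blast
  then have "b = c"
    using bk cl inj_on_digit_value by (auto dest: inj_onD)
  then show ?case using bk cl \<open>k = l\<close> by simp
qed

section \<open>The character\<close>

lemma chi_neq_0 [simp]: "chi K x \<noteq> 0"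
  using chi_norm[of x] by auto

lemma chi_0 [simp]: "chi K 0 = 1"
  using chi_add[of 0 0] by simp

lemma chi_minus: "chi K (- x) = cnj (chi K x)"
proof -
  have "chi K x * chi K (- x) = 1"
    using chi_add[of x "- x"] by simp
  moreover have "chi K x * cnj (chi K x) = 1"
    using complex_norm_square[of "chi K x"] by (simp add: chi_norm)
  ultimately have "chi K x * chi K (- x) = chi K x * cnj (chi K x)"
    by simp
  then show ?thesis by simp
qed

lemma chi_diff: "chi K (x - y) = chi K x * cnj (chi K y)"
  using chi_add[of x "- y"] by (simp add: chi_minus)

lemma chi_mult_cnj [simp]: "chi K x * cnj (chi K x) = 1"
  using chi_diff[of x x] by simp

lemma chi_disc_0: "x \<in> disc 0 \<Longrightarrow> chi K x = 1"
  by (simp add: disc_0_eq chi_int_ring)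

lemma chi_sum: "chi K (sum f I) = (\<Prod>i\<in>I. chi K (f i))"
  by (induction I rule: infinite_finite_induct) (simp_all add: chi_add)

lemma chi_of_nat_mult: "chi K (of_nat n * x) = chi K x ^ n"
  by (induction n) (simp_all add: chi_add distrib_right)

lemma chi_zeta_span:
  assumes "z \<in> zeta_span K" "n \<ge> 2"
  shows "chi K (z * \<pp> powi (- int n)) = 1"
proof -
  obtain a :: "nat \<Rightarrow> nat" where "z = (\<Sum>i<res_deg K. of_nat (a i) * zeta K i)"
    using assms(1) by (auto simp: zeta_span_def)
  then have "chi K (z * \<pp> powi (- int n))
      = (\<Prod>i<res_deg K. chi K (of_nat (a i) * (zeta K i * \<pp> powi (- int n))))"
    by (simp add: sum_distrib_right chi_sum mult.assoc)
  also have "\<dots> = 1"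
    using assms(2) by (intro prod.neutral) (simp add: chi_of_nat_mult chi_zeta)
  finally show ?thesis .
qed

text \<open>A product \<open>u(j) u(k)\<close> has only terms of degree at most \<open>-2\<close> in \<open>\<pp>\<close>, and its coefficients
  lie in the subfield spanned by the \<open>\<zeta>\<^sub>i\<close>; on such terms the character is trivial.\<close>

lemma chi_u_mult_u [simp]: "chi K (u j * u k) = 1"
proof -
  have digit: "digit_value (n mod q) \<in> zeta_span K" for n
    using digit_value_image by auto
  have trivial: "chi K ((digit_value (m mod q) * inverse \<pp> * \<pp> powi (- int i)) *
       (digit_value (n mod q) * inverse \<pp> * \<pp> powi (- int i'))) = 1" for m n i i'
  proof -
    have eq: "(digit_value (m mod q) * inverse \<pp> * \<pp> powi (- int i)) *
       (digit_value (n mod q) * inverse \<pp> * \<pp> powi (- int i'))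
      = (digit_value (m mod q) * digit_value (n mod q)) * \<pp> powi (- int (i + i' + 2))"
      unfolding power_int_minus power_int_of_nat
      by (simp add: power_add power2_eq_square mult_ac)
    have "digit_value (m mod q) * digit_value (n mod q) \<in> zeta_span K"
      using digit[of m] digit[of n] zeta_span_subfield by (auto simp: is_subfield_def)
    then show ?thesis unfolding eq by (rule chi_zeta_span) simp
  qed
  show ?thesis
    unfolding u_rep_def u_digit_eq sum_product chi_sum
    by (intro prod.neutral ballI trivial)
qed

lemma chi_n_add_u [simp]: "chi_n K k (x + u j) = chi_n K k x"
  by (simp add: chi_n_def distrib_left chi_add)

text \<open>The set \<open>a \<pp>\<^sup>-\<^sup>n\<DD>\<close> contains \<open>\<pp>\<^sup>-\<^sup>1\<close>, on which the character is a primitive \<open>p\<close>-th root of unity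
  because \<open>\<zeta>\<^sub>0 = 1\<close>.\<close>

lemma chi_nontrivial:
  assumes "a \<notin> disc (- n)"
  obtains y where "y \<in> disc n" "chi K (a * y) \<noteq> 1"
proof
  have a: "a \<noteq> 0" using assms by auto
  have "real q powi (- n + 1) \<le> absv a"
    by (rule not_disc_absv[OF assms])
  then have "absv (inverse a) \<le> inverse (real q powi (- n + 1))"
    by (simp add: absv_inverse le_imp_inverse_le)
  also have "\<dots> = real q powi (n - 1)"
    by (simp flip: power_int_minus)
  finally show "inverse \<pp> * inverse a \<in> disc n"
    by (simp only: inverse_prm_mult_disc) (simp add: disc_def)
  have "chi K (a * (inverse \<pp> * inverse a)) = chi K (zeta K 0 * \<pp> powi (- int 1))"
    using a by (simp add: zeta_0 power_int_minus mult.left_commute[of a])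
  also have "\<dots> = exp (2 * of_real pi * \<i> / of_nat CHAR('k))"
    using res_deg_pos by (subst chi_zeta) auto
  also have "\<dots> \<noteq> 1"
  proof
    assume "exp (2 * of_real pi * \<i> / of_nat CHAR('k)) = (1 :: complex)"
    then have "exp (2 * of_real pi * \<i> * of_nat 1 / of_nat CHAR('k)) = (1 :: complex)"
      by simp
    then have "CHAR('k) dvd 1"
      using CHAR_ge_2 complex_root_unity_eq_1[of "CHAR('k)" 1] by simp
    then show False using CHAR_ge_2 by simp
  qed
  finally show "chi K (a * (inverse \<pp> * inverse a)) \<noteq> 1" .
qed

section \<open>Balls and the Haar measure\<close>

definition coset :: "'k \<Rightarrow> int \<Rightarrow> 'k set" where
  "coset a n = {x. x - a \<in> disc n}"

lemma mem_coset [simp]: "x \<in> coset a n \<longleftrightarrow> x - a \<in> disc n"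
  by (simp add: coset_def)

lemma coset_0 [simp]: "coset 0 n = disc n"
  by (simp add: coset_def)

lemma coset_eq: "b \<in> coset a n \<Longrightarrow> coset b n = coset a n"
proof -
  assume "b \<in> coset a n"
  then have b: "b - a \<in> disc n" by simp
  have "x - b \<in> disc n \<longleftrightarrow> x - a \<in> disc n" for x
    using disc_add_iff[OF b, of "x - b"] by simp
  then show ?thesis by auto
qed

lemma coset_Int:
  "coset a m \<inter> coset b n \<in> {{}, coset a m, coset b n}"
proof (cases "coset a m \<inter> coset b n = {}")
  case False
  then obtain c where "c \<in> coset a m" "c \<in> coset b n" by blast
  then have c: "coset a m = coset c m" "coset b n = coset c n"
    using coset_eq by blast+
  have "coset c m \<subseteq> coset c n \<or> coset c n \<subseteq> coset c m"
    using disc_mono[of m n] disc_mono[of n m] by (cases "m \<le> n") (auto simp: coset_def)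
  then show ?thesis
    unfolding c by blast
qed simp

lemma open_coset: "open (coset a n)"
  unfolding open_contains_ball
proof
  fix x assume x: "x \<in> coset a n"
  have "ball x (real q powi n) \<subseteq> coset x n"
    by (auto simp: dist_eq_absv disc_def) (metis absv_minus less_imp_le minus_diff_eq)
  then show "\<exists>e>0. ball x e \<subseteq> coset a n"
    using coset_eq[OF x] by (intro exI[of _ "real q powi n"]) auto
qed

lemma coset_subset_ball:
  assumes "e > 0" obtains n where "coset x n \<subseteq> ball x e"
proof -
  obtain n :: nat where n: "inverse e < real q powi int n"
    using q_powi_unbounded by blast
  then have "real q powi (- int n) < e"
    using assms by (simp add: power_int_minus field_simps)
  then have "coset x (- int n) \<subseteq> ball x e"
    by (auto simp: dist_eq_absv disc_def) (metis absv_minus le_less_trans minus_diff_eq)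
  then show ?thesis by (rule that)
qed

definition balls :: "'k set set" where
  "balls = range (\<lambda>(a, n). coset a n)"

lemma coset_in_balls: "coset a n \<in> balls"
  by (auto simp: balls_def)

text \<open>Every ball of radius \<open>q\<^sup>n\<close> has a centre of the form \<open>\<pp>\<^sup>-\<^sup>n u(k)\<close>, so there are only countably
  many balls.\<close>

lemma coset_eq_coset_u: obtains k where "coset a n = coset (\<pp> powi (- n) * u k) n"
proof -
  obtain N :: nat where "\<pp> powi n * a \<in> disc (int N)"
    using ex_disc by blast
  then obtain k where "\<pp> powi n * a - u k \<in> disc 0"
    using u_cover by blast
  moreover have "\<pp> powi n * (a - \<pp> powi (- n) * u k) = \<pp> powi n * a - u k"
    by (simp add: algebra_simps power_int_minus)
  ultimately have "a - \<pp> powi (- n) * u k \<in> disc n"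
    using prm_powi_mult_disc[of n "a - \<pp> powi (- n) * u k" 0] by simp
  then have "coset a n = coset (\<pp> powi (- n) * u k) n"
    by (intro coset_eq) simp
  then show ?thesis by (rule that)
qed

lemma countable_balls: "countable balls"
proof -
  have "balls \<subseteq> range (\<lambda>(k, n). coset (\<pp> powi (- n) * u k) n)"
  proof
    fix B assume "B \<in> balls"
    then obtain a n where B: "B = coset a n" by (auto simp: balls_def)
    obtain k where "coset a n = coset (\<pp> powi (- n) * u k) n"
      by (rule coset_eq_coset_u)
    then show "B \<in> range (\<lambda>(k, n). coset (\<pp> powi (- n) * u k) n)"
      unfolding B by (intro image_eqI[of _ _ "(k, n)"]) auto
  qed
  then show ?thesis
    by (rule countable_subset) simp
qed

lemma borel_eq_sigma_balls: "(borel :: 'k measure) = sigma UNIV balls"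
proof (rule borel_eq_countable_basis[OF countable_balls])
  show "topological_basis balls"
  proof (rule topological_basisI)
    fix O' :: "'k set" and x assume "open O'" "x \<in> O'"
    then obtain e where "e > 0" "ball x e \<subseteq> O'"
      by (meson openE)
    then obtain n where "coset x n \<subseteq> O'"
      using coset_subset_ball[of e x] by (metis order_trans)
    then show "\<exists>B'\<in>balls. x \<in> B' \<and> B' \<subseteq> O'"
      by (intro bexI[of _ "coset x n"]) (auto simp: coset_in_balls)
  qed (auto simp: balls_def open_coset)
qed

text \<open>The empty set is added to the balls so that the generator is stable under intersections.\<close>

lemma sets_borel_eq_balls: "sets (borel :: 'k measure) = sigma_sets UNIV (insert {} balls)"
proof -
  have "sigma_sets UNIV (insert {} balls) = sigma_sets UNIV balls"
    by (rule sigma_sets_eqI) (auto intro: sigma_sets.Empty)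
  then show ?thesis
    by (subst borel_eq_sigma_balls) simp
qed

lemma Int_stable_balls: "Int_stable (insert {} balls)"
proof (rule Int_stableI)
  fix A B assume "A \<in> insert {} balls" "B \<in> insert {} balls"
  then consider "A = {}" | "B = {}" | a m b n where "A = coset a m" "B = coset b n"
    by (auto simp: balls_def)
  then show "A \<inter> B \<in> insert {} balls"
  proof cases
    case 3
    then show ?thesis
      using coset_Int[of a m b n] coset_in_balls[of a m] coset_in_balls[of b n] by auto
  qed auto
qed

lemma space_haar [simp]: "space \<mu> = UNIV"
  using sets_eq_imp_space_eq[OF haar_sets] by simp

lemma measurable_haar [simp]: "measurable \<mu> N = measurable borel N" "measurable N \<mu> = measurable N borel"
  by (simp_all cong: measurable_cong_sets add: haar_sets)

lemma coset_sets [measurable, simp]: "coset a n \<in> sets borel"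
  using open_coset by simp

lemma disc_sets [measurable, simp]: "disc n \<in> sets borel"
  using coset_sets[of 0 n] by simp

lemma emeasure_coset: "emeasure \<mu> (coset a n) = emeasure \<mu> (disc n)"
proof -
  have "coset a n = (+) a ` disc n"
    by (auto simp: image_iff) (metis add_diff_cancel_left' diff_add_cancel add.commute)
  then show ?thesis by (simp add: haar_translation)
qed

lemma disc_eq_UN_coset: "disc (n + int N) = (\<Union>k<q ^ N. coset (\<pp> powi (- n) * u k) n)"
proof (intro equalityI subsetI)
  fix x assume "x \<in> disc (n + int N)"
  then have "\<pp> powi n * x \<in> disc (int N)" by (simp add: add.commute)
  then obtain k where k: "k < q ^ N" "\<pp> powi n * x - u k \<in> disc 0"
    using u_cover by blast
  moreover have "\<pp> powi n * (x - \<pp> powi (- n) * u k) = \<pp> powi n * x - u k"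
    by (simp add: algebra_simps power_int_minus)
  ultimately have "x - \<pp> powi (- n) * u k \<in> disc n"
    using prm_powi_mult_disc[of n "x - \<pp> powi (- n) * u k" 0] by simp
  then show "x \<in> (\<Union>k<q ^ N. coset (\<pp> powi (- n) * u k) n)"
    using k(1) by auto
next
  fix x assume "x \<in> (\<Union>k<q ^ N. coset (\<pp> powi (- n) * u k) n)"
  then obtain k where k: "k < q ^ N" "x - \<pp> powi (- n) * u k \<in> disc n" by auto
  have "(x - \<pp> powi (- n) * u k) + \<pp> powi (- n) * u k \<in> disc (n + int N)"
    by (rule disc_add) (use k u_in_disc[OF k(1)] in \<open>auto intro: disc_mono' simp: add.commute\<close>)
  then show "x \<in> disc (n + int N)" by simp
qed

lemma coset_u_disjoint:
  assumes "x \<in> coset (\<pp> powi (- n) * u j) n" "x \<in> coset (\<pp> powi (- n) * u k) n"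
  shows "j = k"
proof -
  have "(x - \<pp> powi (- n) * u k) - (x - \<pp> powi (- n) * u j) \<in> disc n"
    by (rule disc_diff) (use assms in \<open>simp_all only: mem_coset\<close>)
  moreover have "(x - \<pp> powi (- n) * u k) - (x - \<pp> powi (- n) * u j) = \<pp> powi (- n) * (u j - u k)"
    by (simp add: algebra_simps)
  ultimately have "u j - u k \<in> disc 0" by simp
  then show ?thesis by (rule u_separated)
qed

text \<open>The larger disc consists of \<open>q\<^sup>N\<close> disjoint translates of the smaller one; with
  \<open>\<DD>\<close> of measure 1 this determines the measure of every ball.\<close>

lemma emeasure_disc_add: "emeasure \<mu> (disc (n + int N)) = ennreal (real q ^ N) * emeasure \<mu> (disc n)"
proof -
  have "emeasure \<mu> (disc (n + int N)) = (\<Sum>k<q ^ N. emeasure \<mu> (coset (\<pp> powi (- n) * u k) n))"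
    unfolding disc_eq_UN_coset
    by (rule sum_emeasure[symmetric])
       (auto simp: haar_sets disjoint_family_on_def dest: coset_u_disjoint simp del: mem_coset)
  also have "\<dots> = of_nat (q ^ N) * emeasure \<mu> (disc n)"
    by (simp add: emeasure_coset)
  finally show ?thesis by (simp add: ennreal_of_nat_eq_real_of_nat)
qed

lemma emeasure_disc [simp]: "emeasure \<mu> (disc n) = ennreal (real q powi n)"
proof (cases "n \<ge> 0")
  case True
  then obtain N where "n = int N" using nonneg_int_cases by blast
  then show ?thesis
    using emeasure_disc_add[of 0 N] haar_normalized by (simp add: disc_0_eq)
next
  case False
  define N where "N = nat (- n)"
  have n: "n = - int N" using False by (simp add: N_def)
  have one: "1 = ennreal (real q ^ N) * emeasure \<mu> (disc n)"
    using emeasure_disc_add[of n N] haar_normalized by (simp add: n disc_0_eq)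
  have "ennreal (real q powi n) * ennreal (real q ^ N) = 1"
    by (simp add: n power_int_minus flip: ennreal_mult)
  then show ?thesis
    using one by (metis mult.assoc mult.commute mult.left_neutral)
qed

lemma affine_measurable [measurable]: "(\<lambda>x::'k. a * x + b) \<in> borel_measurable borel"
  by (rule borel_measurable_continuous_onI continuous_on_affine)+

lemma plus_measurable [measurable]: "(\<lambda>x. x + b) \<in> borel_measurable (borel :: 'k measure)"
  using affine_measurable[of 1 b] by simp

lemma times_measurable [measurable]: "(*) a \<in> borel_measurable (borel :: 'k measure)"
  using affine_measurable[of a 0] by simp

text \<open>An affine map with slope \<open>\<pp>\<^sup>j\<close> scales the measure by a constant: both sides agree on balls, whose
  preimages are balls, and these determine a Borel measure.\<close>

lemma distr_affine:
  "distr \<mu> borel (\<lambda>x. \<pp> powi j * x + a) = density \<mu> (\<lambda>_. ennreal (real q powi j))"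
proof (rule measure_eqI_generator_eq_countable)
  show "Int_stable (insert {} balls)" by (rule Int_stable_balls)
  fix X assume X: "X \<in> insert {} balls"
  show "emeasure (distr \<mu> borel (\<lambda>x. \<pp> powi j * x + a)) X
      = emeasure (density \<mu> (\<lambda>_. ennreal (real q powi j))) X"
  proof (cases "X = {}")
    case False
    then obtain b n where B: "X = coset b n" using X by (auto simp: balls_def)
    have "\<pp> powi j * x + a - b = \<pp> powi j * (x - \<pp> powi (- j) * (b - a))" for x
      by (simp add: algebra_simps power_int_minus)
    then have "(\<lambda>x. \<pp> powi j * x + a) -` X = coset (\<pp> powi (- j) * (b - a)) (n + j)"
      by (auto simp: B)
    then show ?thesis
      by (simp add: B emeasure_distr[OF _ coset_sets] emeasure_density_const haar_sets emeasure_coset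
          power_int_add ennreal_mult mult.commute[of "ennreal (real q powi n)"])
  qed simp
next
  show "sets (distr \<mu> borel (\<lambda>x. \<pp> powi j * x + a)) = sigma_sets UNIV (insert {} balls)"
    "sets (density \<mu> (\<lambda>_. ennreal (real q powi j))) = sigma_sets UNIV (insert {} balls)"
    by (simp_all add: sets_borel_eq_balls haar_sets)
  show "range (\<lambda>n::nat. disc (int n)) \<subseteq> insert {} balls"
    using coset_in_balls[of 0] by auto
  show "\<Union> (range (\<lambda>n::nat. disc (int n))) = UNIV"
    using ex_disc by auto
  fix A assume "A \<in> range (\<lambda>n::nat. disc (int n))"
  then obtain n :: nat where A: "A = disc (int n)" by auto
  have "\<pp> powi j * x + a = \<pp> powi j * (x - \<pp> powi (- j) * (- a))" for x
    by (simp add: algebra_simps power_int_minus)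
  then have "(\<lambda>x. \<pp> powi j * x + a) -` A = coset (\<pp> powi (- j) * (- a)) (int n + j)"
    by (auto simp: A)
  then show "emeasure (distr \<mu> borel (\<lambda>x. \<pp> powi j * x + a)) A \<noteq> \<infinity>"
    by (simp add: A emeasure_distr emeasure_coset)
qed auto

lemma nn_integral_affine:
  assumes [measurable]: "f \<in> borel_measurable borel"
  shows "(\<integral>\<^sup>+x. f (\<pp> powi j * x + a) \<partial>\<mu>) = ennreal (real q powi j) * (\<integral>\<^sup>+x. f x \<partial>\<mu>)"
proof -
  have "(\<integral>\<^sup>+x. f (\<pp> powi j * x + a) \<partial>\<mu>) = (\<integral>\<^sup>+x. f x \<partial>distr \<mu> borel (\<lambda>x. \<pp> powi j * x + a))"
    by (subst nn_integral_distr) simp_all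
  also have "\<dots> = ennreal (real q powi j) * (\<integral>\<^sup>+x. f x \<partial>\<mu>)"
    unfolding distr_affine by (subst nn_integral_density) (simp_all add: nn_integral_cmult)
  finally show ?thesis .
qed

lemma integrable_affine_iff:
  fixes f :: "'k \<Rightarrow> complex"
  assumes [measurable]: "f \<in> borel_measurable borel"
  shows "integrable \<mu> (\<lambda>x. f (\<pp> powi j * x + a)) \<longleftrightarrow> integrable \<mu> f"
proof -
  have "integrable \<mu> (\<lambda>x. f (\<pp> powi j * x + a)) \<longleftrightarrow>
      integrable (distr \<mu> borel (\<lambda>x. \<pp> powi j * x + a)) f"
    by (subst integrable_distr_eq) simp_all
  also have "\<dots> \<longleftrightarrow> integrable \<mu> (\<lambda>x. real q powi j *\<^sub>R f x)"
    unfolding distr_affine by (subst integrable_density) simp_all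
  also have "\<dots> \<longleftrightarrow> integrable \<mu> f"
    using integrable_scaleR_right[of "inverse (real q powi j)" \<mu> "\<lambda>x. real q powi j *\<^sub>R f x"]
    by (auto simp del: scaleR_conv_of_real)
  finally show ?thesis .
qed

lemma integral_affine:
  fixes f :: "'k \<Rightarrow> 'b::{banach, second_countable_topology}"
  assumes [measurable]: "f \<in> borel_measurable borel"
  shows "(\<integral>x. f (\<pp> powi j * x + a) \<partial>\<mu>) = real q powi j *\<^sub>R (\<integral>x. f x \<partial>\<mu>)"
proof -
  have "(\<integral>x. f (\<pp> powi j * x + a) \<partial>\<mu>) = (\<integral>x. f x \<partial>distr \<mu> borel (\<lambda>x. \<pp> powi j * x + a))"
    by (subst integral_distr) simp_all
  also have "\<dots> = real q powi j *\<^sub>R (\<integral>x. f x \<partial>\<mu>)"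
    unfolding distr_affine by (subst integral_density) simp_all
  finally show ?thesis .
qed

lemma AE_affine:
  assumes "AE x in \<mu>. P x"
  shows "AE x in \<mu>. P (\<pp> powi j * x + a)"
proof -
  obtain N where N: "N \<in> sets borel" "emeasure \<mu> N = 0" "{x. \<not> P x} \<subseteq> N"
    using assms by (auto elim!: AE_E simp: haar_sets)
  have "emeasure \<mu> ((\<lambda>x. \<pp> powi j * x + a) -` N) = emeasure (distr \<mu> borel (\<lambda>x. \<pp> powi j * x + a)) N"
    using N(1) by (simp add: emeasure_distr)
  also have "\<dots> = 0"
    unfolding distr_affine using N by (simp add: emeasure_density_const haar_sets)
  finally have "(\<lambda>x. \<pp> powi j * x + a) -` N \<in> null_sets \<mu>"
    using measurable_sets[OF affine_measurable N(1)] by (simp add: null_sets_def haar_sets)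
  then show ?thesis
    by (rule AE_I') (use N(3) in auto)
qed

lemma AE_translate: "AE x in \<mu>. P x \<Longrightarrow> AE x in \<mu>. P (x + a)"
  using AE_affine[of P 0 a] by simp

lemma AE_dilate: "AE x in \<mu>. P x \<Longrightarrow> AE x in \<mu>. P (\<pp> * x)"
  using AE_affine[of P 1 0] by simp

lemma nn_integral_translate:
  "f \<in> borel_measurable borel \<Longrightarrow> (\<integral>\<^sup>+x. f (x + a) \<partial>\<mu>) = (\<integral>\<^sup>+x. f x \<partial>\<mu>)"
  using nn_integral_affine[of f 0 a] by simp

lemma integral_translate:
  fixes f :: "'k \<Rightarrow> 'b::{banach, second_countable_topology}"
  shows "f \<in> borel_measurable borel \<Longrightarrow> (\<integral>x. f (x + a) \<partial>\<mu>) = (\<integral>x. f x \<partial>\<mu>)"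
  using integral_affine[of f 0 a] by simp

lemma chi_measurable [measurable]: "chi K \<in> borel_measurable borel"
  by (rule borel_measurable_continuous_onI chi_continuous)+

lemma chi_affine_measurable [measurable]: "(\<lambda>x. chi K (a * x + b)) \<in> borel_measurable borel"
  by measurable

lemma chi_mult_measurable [measurable]: "(\<lambda>x. chi K (a * x)) \<in> borel_measurable borel"
  using chi_affine_measurable[of a 0] by simp

lemma chi_mult_measurable' [measurable]: "(\<lambda>x. chi K (x * a)) \<in> borel_measurable borel"
  using chi_mult_measurable[of a] by (simp add: mult.commute)

lemma integrable_indicator_disc: "integrable \<mu> (indicator (disc n) :: 'k \<Rightarrow> real)"
  by (simp add: haar_sets integrable_indicator_iff)

lemma integral_indicator_disc: "(\<integral>x. indicator (disc n) x \<partial>\<mu>) = (real q powi n :: real)"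
  by (simp add: haar_sets measure_def)

lemma integrable_chi_disc: "integrable \<mu> (\<lambda>x. indicator (disc n) x *\<^sub>R chi K (a * x))"
  by (rule Bochner_Integration.integrable_bound[OF integrable_indicator_disc[of n]])
     (auto simp: chi_norm indicator_def)

text \<open>Translating by an element on which the character is nontrivial multiplies the integral by a
  number other than 1.\<close>

lemma integral_chi_disc:
  "(\<integral>x. indicator (disc n) x *\<^sub>R chi K (a * x) \<partial>\<mu>)
     = (if a \<in> disc (- n) then of_real (real q powi n) else 0)"
proof (cases "a \<in> disc (- n)")
  case True
  have "indicator (disc n) x *\<^sub>R chi K (a * x) = of_real (indicator (disc n) x)" for x
    using disc_mult[OF True, of x n] by (auto simp: indicator_def chi_disc_0)
  then show ?thesis
    using True integral_indicator_disc[of n] by (simp del: integral_indicator)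
next
  case False
  then obtain y where y: "y \<in> disc n" "chi K (a * y) \<noteq> 1"
    by (rule chi_nontrivial)
  let ?f = "\<lambda>x. indicator (disc n) x *\<^sub>R chi K (a * x)"
  have "(\<integral>x. ?f x \<partial>\<mu>) = (\<integral>x. ?f (x + y) \<partial>\<mu>)"
    by (rule integral_translate[symmetric]) measurable
  also have "(\<lambda>x. ?f (x + y)) = (\<lambda>x. chi K (a * y) * ?f x)"
    using disc_add_iff[OF y(1)] by (auto simp: indicator_def distrib_left chi_add)
  finally have "(\<integral>x. ?f x \<partial>\<mu>) = chi K (a * y) * (\<integral>x. ?f x \<partial>\<mu>)"
    by (simp del: mult_scaleR_right)
  then show ?thesis using False y(2) by simp
qed

text \<open>Discs, and eventually the whole field, are tiled by translates of \<open>\<DD>\<close>; the lemmas below fold an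
  integral over such a set into one over \<open>\<DD>\<close>.\<close>

lemma indicator_disc_eq_sum:
  "(indicator (disc (int N)) x :: real) = (\<Sum>k<q ^ N. indicator (disc 0) (x - u k))"
proof -
  have "disc (int N) = (\<Union>k<q ^ N. coset (u k) 0)"
    using disc_eq_UN_coset[of 0 N] by simp
  moreover have "indicator (\<Union>k<q ^ N. coset (u k) 0) x
      = (\<Sum>k<q ^ N. indicator (coset (u k) 0) x :: real)"
    using coset_u_disjoint[of _ 0]
    by (intro indicator_UN_disjoint) (auto simp: disjoint_family_on_def simp del: mem_coset)
  ultimately show ?thesis
    by (simp add: indicator_def)
qed

lemma nn_integral_disc_eq_sum:
  assumes [measurable]: "f \<in> borel_measurable borel"
  shows "(\<integral>\<^sup>+x. indicator (disc (int N)) x * f x \<partial>\<mu>)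
    = (\<Sum>k<q ^ N. \<integral>\<^sup>+x. indicator (disc 0) x * f (x + u k) \<partial>\<mu>)"
proof -
  have ind: "indicator (disc (int N)) x = (\<Sum>k<q ^ N. indicator (disc 0) (x - u k) :: ennreal)" for x
    using arg_cong[OF indicator_disc_eq_sum[of N x], of ennreal]
    by (simp add: sum_ennreal[symmetric] ennreal_indicator)
  have [measurable]: "(\<lambda>x. indicator (disc 0) (x - u k) :: ennreal) \<in> borel_measurable borel" for k
    using measurable_compose[OF affine_measurable[of 1 "- u k"] borel_measurable_indicator[OF disc_sets]]
    by simp
  have "(\<integral>\<^sup>+x. indicator (disc (int N)) x * f x \<partial>\<mu>)
      = (\<Sum>k<q ^ N. \<integral>\<^sup>+x. indicator (disc 0) (x - u k) * f x \<partial>\<mu>)"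
    unfolding ind sum_distrib_right by (rule nn_integral_sum) simp
  also have "\<dots> = (\<Sum>k<q ^ N. \<integral>\<^sup>+x. indicator (disc 0) x * f (x + u k) \<partial>\<mu>)"
  proof (intro sum.cong refl)
    fix k
    show "(\<integral>\<^sup>+x. indicator (disc 0) (x - u k) * f x \<partial>\<mu>)
        = (\<integral>\<^sup>+x. indicator (disc 0) x * f (x + u k) \<partial>\<mu>)"
      using nn_integral_translate[of "\<lambda>x. indicator (disc 0) (x - u k) * f x" "u k"] by simp
  qed
  finally show ?thesis .
qed

lemma nn_integral_eq_suminf_disc:
  assumes [measurable]: "f \<in> borel_measurable borel"
  shows "(\<integral>\<^sup>+x. f x \<partial>\<mu>) = (\<Sum>k. \<integral>\<^sup>+x. indicator (disc 0) x * f (x + u k) \<partial>\<mu>)"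
proof (rule LIMSEQ_unique)
  have "(\<lambda>N. \<integral>\<^sup>+x. indicator (disc (int N)) x * f x \<partial>\<mu>) \<longlonglongrightarrow> (\<integral>\<^sup>+x. f x \<partial>\<mu>)"
  proof (rule nn_integral_LIMSEQ)
    show "incseq (\<lambda>N x. indicator (disc (int N)) x * f x)"
      by (auto simp: incseq_def le_fun_def indicator_def intro: disc_mono')
    fix x
    obtain n :: nat where "x \<in> disc (int n)" using ex_disc by blast
    then have "\<forall>N\<ge>n. indicator (disc (int N)) x * f x = f x"
      by (auto simp: indicator_def intro: disc_mono')
    then show "(\<lambda>N. indicator (disc (int N)) x * f x) \<longlonglongrightarrow> f x"
      by (intro tendsto_eventually) (auto simp: eventually_sequentially)
  qed simp
  then show "(\<lambda>N. \<Sum>k<q ^ N. \<integral>\<^sup>+x. indicator (disc 0) x * f (x + u k) \<partial>\<mu>) \<longlonglongrightarrow> (\<integral>\<^sup>+x. f x \<partial>\<mu>)"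
    by (simp add: nn_integral_disc_eq_sum)
  have "strict_mono (\<lambda>N. q ^ N)"
    using q_ge_2 by (intro strict_monoI power_strict_increasing) auto
  from LIMSEQ_subseq_LIMSEQ[OF summable_LIMSEQ[OF summableI] this]
  show "(\<lambda>N. \<Sum>k<q ^ N. \<integral>\<^sup>+x. indicator (disc 0) x * f (x + u k) \<partial>\<mu>)
      \<longlonglongrightarrow> (\<Sum>k. \<integral>\<^sup>+x. indicator (disc 0) x * f (x + u k) \<partial>\<mu>)"
    by (simp add: o_def)
qed

lemma integral_disc_eq_sum:
  fixes f :: "'k \<Rightarrow> complex"
  assumes [measurable]: "f \<in> borel_measurable borel" and int: "integrable \<mu> f"
    and supp: "\<And>x. x \<notin> disc (int N) \<Longrightarrow> f x = 0"
  shows "(\<integral>x. f x \<partial>\<mu>) = (\<integral>x. indicator (disc 0) x *\<^sub>R (\<Sum>k<q ^ N. f (x + u k)) \<partial>\<mu>)"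
proof -
  have m: "(\<lambda>x. indicator (disc 0) (x - u k) *\<^sub>R f x) \<in> borel_measurable borel" for k
    using measurable_compose[OF affine_measurable[of 1 "- u k"] borel_measurable_indicator[OF disc_sets[of 0]]]
    by (intro borel_measurable_scaleR assms) simp
  have i1: "integrable \<mu> (\<lambda>x. indicator (disc 0) (x - u k) *\<^sub>R f x)" for k
    by (rule Bochner_Integration.integrable_bound[OF int]) (use m in \<open>auto simp: indicator_def\<close>)
  have i2: "integrable \<mu> (\<lambda>x. indicator (disc 0) x *\<^sub>R f (x + u k))" for k
    using integrable_affine_iff[of "\<lambda>x. indicator (disc 0) (x - u k) *\<^sub>R f x" 0 "u k"] i1[of k] m[of k] by simp
  have f: "f x = (\<Sum>k<q ^ N. indicator (disc 0) (x - u k) *\<^sub>R f x)" for x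
    using supp[of x] by (cases "x \<in> disc (int N)") (simp_all flip: scaleR_sum_left indicator_disc_eq_sum)
  have "(\<integral>x. f x \<partial>\<mu>) = (\<Sum>k<q ^ N. \<integral>x. indicator (disc 0) (x - u k) *\<^sub>R f x \<partial>\<mu>)"
    by (subst f, subst Bochner_Integration.integral_sum) (use i1 in auto)
  also have "\<dots> = (\<Sum>k<q ^ N. \<integral>x. indicator (disc 0) x *\<^sub>R f (x + u k) \<partial>\<mu>)"
  proof (intro sum.cong refl)
    fix k
    show "(\<integral>x. indicator (disc 0) (x - u k) *\<^sub>R f x \<partial>\<mu>)
        = (\<integral>x. indicator (disc 0) x *\<^sub>R f (x + u k) \<partial>\<mu>)"
      using integral_translate[of "\<lambda>x. indicator (disc 0) (x - u k) *\<^sub>R f x" "u k"] m[of k] by simp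
  qed
  also have "\<dots> = (\<integral>x. indicator (disc 0) x *\<^sub>R (\<Sum>k<q ^ N. f (x + u k)) \<partial>\<mu>)"
    unfolding scaleR_sum_right by (subst Bochner_Integration.integral_sum) (use i2 in auto)
  finally show ?thesis .
qed

section \<open>Density of locally constant functions\<close>

lemma L2_iff: "L2 K f \<longleftrightarrow> square_integrable \<mu> f"
  by (simp add: L2_def l2sq_def square_integrable_iff_nn_integral)

lemma l2sq_eq: "square_integrable \<mu> f \<Longrightarrow> l2sq K f = ennreal ((l2norm \<mu> f)\<^sup>2)"
  by (simp add: l2sq_def nn_integral_cmod_power2)

lemma l2sq_tendsto_0_iff:
  assumes "\<And>n. square_integrable \<mu> (f n)"
  shows "((\<lambda>n. l2sq K (f n)) \<longlongrightarrow> 0) F \<longleftrightarrow> ((\<lambda>n. l2norm \<mu> (f n)) \<longlongrightarrow> 0) F"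
proof -
  have "((\<lambda>n. l2sq K (f n)) \<longlongrightarrow> 0) F \<longleftrightarrow> ((\<lambda>n. (l2norm \<mu> (f n))\<^sup>2) \<longlongrightarrow> 0) F"
    using tendsto_ennreal_iff[where f = "\<lambda>n. (l2norm \<mu> (f n))\<^sup>2" and x = 0 and F = F]
    by (simp add: l2sq_eq[OF assms] del: tendsto_ennreal_iff)
  also have "\<dots> \<longleftrightarrow> ((\<lambda>n. l2norm \<mu> (f n)) \<longlongrightarrow> 0) F"
    using tendsto_real_sqrt[where f = "\<lambda>n. (l2norm \<mu> (f n))\<^sup>2" and x = 0 and F = F]
      tendsto_power[where f = "\<lambda>n. l2norm \<mu> (f n)" and a = 0 and F = F and n = 2]
    by auto
  finally show ?thesis .
qed

lemma square_integrable_bounded: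
  assumes "f \<in> borel_measurable borel" "\<And>x. cmod (f x) \<le> C" "\<And>x. x \<notin> disc n \<Longrightarrow> f x = 0"
  shows "square_integrable \<mu> f"
proof (rule square_integrable_bound[where c = C])
  have "(\<lambda>x. (cmod (indicator (disc n) x))\<^sup>2) = indicator (disc n)"
    by (auto simp: indicator_def)
  then show "square_integrable \<mu> (indicator (disc n))"
    using integrable_indicator_disc[of n] by (simp add: square_integrable_def)
  show "AE x in \<mu>. cmod (f x) \<le> C * cmod (indicator (disc n) x)"
    using assms by (auto simp: indicator_def)
qed (use assms in simp)

lemma indicator_shift_measurable [measurable]:
  "(\<lambda>x. indicator (disc n) (x - a) :: 'b::real_normed_algebra_1) \<in> borel_measurable borel"
  using measurable_compose[OF affine_measurable[of 1 "- a"] borel_measurable_indicator[OF disc_sets[of n]]]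
  by simp

text \<open>Locally constant functions: \<open>N\<close> bounds the support and \<open>q\<^sup>-\<^sup>n\<close> is the radius of the balls on which
  \<open>v\<close> is constant.\<close>

definition test_function :: "nat \<Rightarrow> nat \<Rightarrow> ('k \<Rightarrow> complex) \<Rightarrow> bool" where
  "test_function N n v \<longleftrightarrow> (\<forall>x. x \<notin> disc (int N) \<longrightarrow> v x = 0) \<and>
     (\<forall>x y. x - y \<in> disc (- int n) \<longrightarrow> v x = v y)"

lemma test_function_zero: "test_function N n v \<Longrightarrow> x \<notin> disc (int N) \<Longrightarrow> v x = 0"
  by (simp add: test_function_def)

lemma test_function_const: "test_function N n v \<Longrightarrow> x - y \<in> disc (- int n) \<Longrightarrow> v x = v y"
  unfolding test_function_def by blast

lemma test_functionI:
  assumes "\<And>x. x \<notin> disc (int N) \<Longrightarrow> v x = 0" "\<And>x y. x - y \<in> disc (- int n) \<Longrightarrow> v x = v y"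
  shows "test_function N n v"
  unfolding test_function_def using assms by blast

lemma test_function_mono: "test_function N n v \<Longrightarrow> n \<le> m \<Longrightarrow> test_function N m v"
proof (rule test_functionI)
  assume v: "test_function N n v" and "n \<le> m"
  show "v x = 0" if "x \<notin> disc (int N)" for x
    by (rule test_function_zero[OF v that])
  fix x y assume "x - y \<in> disc (- int m)"
  then have "x - y \<in> disc (- int n)"
    by (rule disc_mono') (use \<open>n \<le> m\<close> in simp)
  then show "v x = v y"
    by (rule test_function_const[OF v])
qed

lemma test_function_add:
  "test_function N m v \<Longrightarrow> test_function N n w \<Longrightarrow> test_function N (max m n) (\<lambda>x. v x + w x)"
proof -
  assume v: "test_function N m v" and w: "test_function N n w"
  show ?thesis
  proof (rule test_functionI)
    show "v x + w x = 0" if "x \<notin> disc (int N)" for x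
      by (simp only: test_function_zero[OF v that] test_function_zero[OF w that] add_0)
    show "v x + w x = v y + w y" if "x - y \<in> disc (- int (max m n))" for x y
      by (rule arg_cong2[where f = "(+)"] test_function_const[OF test_function_mono[OF v max.cobounded1] that]
          test_function_const[OF test_function_mono[OF w max.cobounded2] that])+
  qed
qed

lemma test_function_scale: "test_function N n v \<Longrightarrow> test_function N n (\<lambda>x. c * v x)"
  by (rule test_functionI) (simp add: test_function_zero, erule test_function_const[THEN arg_cong])

lemma test_function_diff:
  assumes "test_function N m v" "test_function N n w"
  shows "test_function N (max m n) (\<lambda>x. v x - w x)"
  using test_function_add[OF assms(1) test_function_scale[OF assms(2), of "-1"]] by simp

text \<open>For \<open>k < q\<^sup>N\<^sup>+\<^sup>n\<close> these are the centres of the balls of radius \<open>q\<^sup>-\<^sup>n\<close> that make up the disc of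
  radius \<open>q\<^sup>N\<close>.\<close>

abbreviation node :: "nat \<Rightarrow> nat \<Rightarrow> 'k" where
  "node n k \<equiv> \<pp> powi int n * u k"

text \<open>The function \<open>f\<close> is the identity when a test function is expanded into balls, and the squared
  modulus when its norm is computed.\<close>

lemma test_function_eq_sum:
  assumes "test_function N n v"
  shows "f (v x) * of_real (indicator (disc (int N)) x)
    = (\<Sum>k<q ^ (N + n). f (v (node n k)) * indicator (disc (- int n)) (x - node n k))"
proof (cases "x \<in> disc (int N)")
  case True
  then have "x \<in> (\<Union>k<q ^ (N + n). coset (node n k) (- int n))"
    using disc_eq_UN_coset[of "- int n" "N + n"] by simp
  then obtain j where j: "j < q ^ (N + n)" "x \<in> coset (node n j) (- int n)"
    by blast
  have "(\<Sum>k<q ^ (N + n). f (v (node n k)) * indicator (disc (- int n)) (x - node n k))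
      = (\<Sum>k<q ^ (N + n). if k = j then f (v x) else 0)"
  proof (intro sum.cong refl)
    fix k
    have k: "k = j" if "x - node n k \<in> disc (- int n)"
      using coset_u_disjoint[of x "- int n" k j] that j(2) by simp
    have "x - node n j \<in> disc (- int n)"
      using j(2) by simp
    moreover from this have "v x = v (node n j)"
      by (rule test_function_const[OF assms])
    moreover have "x - node n k \<notin> disc (- int n)" if "k \<noteq> j"
      using k that by blast
    ultimately
    show "f (v (node n k)) * indicator (disc (- int n)) (x - node n k) = (if k = j then f (v x) else 0)"
      by (cases "k = j") (simp_all add: indicator_def)
  qed
  then show ?thesis using True j(1) by simp
next
  case False
  have "x - node n k \<notin> disc (- int n)" if "k < q ^ (N + n)" for k
    using False disc_eq_UN_coset[of "- int n" "N + n"] that by auto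
  then show ?thesis using False by simp
qed

lemma test_function_eq_sum':
  assumes "test_function N n v"
  shows "v x = (\<Sum>k<q ^ (N + n). v (node n k) * indicator (disc (- int n)) (x - node n k))"
  using test_function_eq_sum[OF assms, of "\<lambda>z. z" x] assms
  by (cases "x \<in> disc (int N)") (simp_all add: test_function_zero)

lemma test_function_measurable:
  assumes "test_function N n v" shows "v \<in> borel_measurable borel"
proof -
  have "v = (\<lambda>x. \<Sum>k<q ^ (N + n). v (node n k) * indicator (disc (- int n)) (x - node n k))"
    by (rule ext) (rule test_function_eq_sum'[OF assms])
  moreover have "\<dots> \<in> borel_measurable borel" by measurable
  ultimately show ?thesis by simp
qed

lemma integrable_indicator_shift: "integrable \<mu> (\<lambda>x. indicator (disc n) (x - a) :: complex)"
proof -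
  have "integrable \<mu> (\<lambda>x. of_real (indicator (disc n) x) :: complex)"
    using integrable_indicator_disc by (rule integrable_of_real)
  then have "integrable \<mu> (indicator (disc n) :: 'k \<Rightarrow> complex)"
    by (simp add: of_real_indicator)
  then show ?thesis
    using integrable_affine_iff[of "indicator (disc n)" 0 "- a"] by simp
qed

lemma integral_indicator_shift_chi:
  "(\<integral>x. indicator (disc n) (x - a) * chi K (b * x) \<partial>\<mu>)
     = (if b \<in> disc (- n) then of_real (real q powi n) * chi K (b * a) else 0)"
proof -
  have "(\<integral>x. indicator (disc n) (x - a) * chi K (b * x) \<partial>\<mu>)
      = (\<integral>x. indicator (disc n) (x + a - a) * chi K (b * (x + a)) \<partial>\<mu>)"
    by (rule integral_translate[symmetric]) measurable
  also have "\<dots> = (\<integral>x. (indicator (disc n) x *\<^sub>R chi K (b * x)) * chi K (b * a) \<partial>\<mu>)"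
    by (intro Bochner_Integration.integral_cong) (auto simp: distrib_left chi_add indicator_def)
  also have "\<dots> = (\<integral>x. indicator (disc n) x *\<^sub>R chi K (b * x) \<partial>\<mu>) * chi K (b * a)"
    by (rule integral_mult_left_zero)
  finally show ?thesis
    unfolding integral_chi_disc by simp
qed

lemma square_integrable_test_function:
  assumes "test_function N n v" shows "square_integrable \<mu> v"
proof (rule square_integrable_bounded)
  show "v \<in> borel_measurable borel" by (rule test_function_measurable[OF assms])
  show "v x = 0" if "x \<notin> disc (int N)" for x
    by (rule test_function_zero[OF assms that])
  show "cmod (v x) \<le> (\<Sum>k<q ^ (N + n). cmod (v (node n k)))" for x
    by (subst test_function_eq_sum'[OF assms])
       (rule sum_norm_le, auto simp: norm_mult indicator_def)
qed

lemma l2norm_test_function: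
  assumes v: "test_function N n v"
  shows "(l2norm \<mu> v)\<^sup>2 = (\<Sum>k<q ^ (N + n). (cmod (v (node n k)))\<^sup>2) * real q powi (- int n)"
proof -
  have "complex_of_real ((l2norm \<mu> v)\<^sup>2) = (\<integral>x. of_real ((cmod (v x))\<^sup>2) \<partial>\<mu>)"
    by (simp only: l2norm_power2 integral_complex_of_real)
  also have "\<dots> = (\<integral>x. (\<Sum>k<q ^ (N + n). of_real ((cmod (v (node n k)))\<^sup>2) *
      indicator (disc (- int n)) (x - node n k)) \<partial>\<mu>)"
  proof (intro Bochner_Integration.integral_cong refl)
    fix x
    show "of_real ((cmod (v x))\<^sup>2) = (\<Sum>k<q ^ (N + n). of_real ((cmod (v (node n k)))\<^sup>2) *
        indicator (disc (- int n)) (x - node n k) :: complex)"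
      using test_function_eq_sum[OF v, of "\<lambda>z. of_real ((cmod z)\<^sup>2)" x] test_function_zero[OF v, of x]
      by (cases "x \<in> disc (int N)") simp_all
  qed
  also have "\<dots> = (\<Sum>k<q ^ (N + n). of_real ((cmod (v (node n k)))\<^sup>2) *
      (\<integral>x. indicator (disc (- int n)) (x - node n k) * chi K (0 * x) \<partial>\<mu>))"
    using integrable_indicator_shift by (subst Bochner_Integration.integral_sum) auto
  also have "\<dots> = of_real ((\<Sum>k<q ^ (N + n). (cmod (v (node n k)))\<^sup>2) * real q powi (- int n))"
    unfolding integral_indicator_shift_chi by (simp add: sum_distrib_right)
  finally show ?thesis
    unfolding of_real_eq_iff .
qed

text \<open>The \<open>L\<^sup>2\<close> closure of the test functions on a disc. It is closed under linear combinations and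
  limits and contains the indicators of balls; Dynkin's argument adds the indicators of Borel sets, and
  simple functions then give all of \<open>L\<^sup>2\<close> of the disc.\<close>

definition approximable :: "nat \<Rightarrow> ('k \<Rightarrow> complex) \<Rightarrow> bool" where
  "approximable N f \<longleftrightarrow> square_integrable \<mu> f \<and>
     (\<forall>e>0. \<exists>n v. test_function N n v \<and> l2norm \<mu> (\<lambda>x. v x - f x) < e)"

lemma approximable_test_function: "test_function N n v \<Longrightarrow> approximable N v"
  unfolding approximable_def by (auto intro!: exI square_integrable_test_function)

lemma approximable_scale:
  assumes f: "approximable N f" shows "approximable N (\<lambda>x. c * f x)"
  unfolding approximable_def
proof (intro conjI allI impI)
  show "square_integrable \<mu> (\<lambda>x. c * f x)"
    using f by (auto simp: approximable_def intro: square_integrable_scale)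
  fix e :: real assume "e > 0"
  then have "e / (cmod c + 1) > 0" by (simp add: add_nonneg_pos)
  then obtain n v where v: "test_function N n v" "l2norm \<mu> (\<lambda>x. v x - f x) < e / (cmod c + 1)"
    using f unfolding approximable_def by blast
  have "l2norm \<mu> (\<lambda>x. c * v x - c * f x) = cmod c * l2norm \<mu> (\<lambda>x. v x - f x)"
    by (simp flip: l2norm_scale right_diff_distrib)
  also have "\<dots> \<le> (cmod c + 1) * l2norm \<mu> (\<lambda>x. v x - f x)"
    by (intro mult_right_mono) auto
  also have "\<dots> < e"
    using v(2) by (simp add: pos_less_divide_eq add_nonneg_pos mult.commute)
  finally show "\<exists>n w. test_function N n w \<and> l2norm \<mu> (\<lambda>x. w x - c * f x) < e"
    using test_function_scale[OF v(1)] by blast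
qed

lemma approximable_add:
  assumes f: "approximable N f" and g: "approximable N g"
  shows "approximable N (\<lambda>x. f x + g x)"
  unfolding approximable_def
proof (intro conjI allI impI)
  have fg: "square_integrable \<mu> f" "square_integrable \<mu> g"
    using f g by (auto simp: approximable_def)
  then show "square_integrable \<mu> (\<lambda>x. f x + g x)"
    by (rule square_integrable_add)
  fix e :: real assume "e > 0"
  then have e2: "e / 2 > 0" by simp
  obtain m v where v: "test_function N m v" "l2norm \<mu> (\<lambda>x. v x - f x) < e / 2"
    using f e2 unfolding approximable_def by blast
  obtain n w where w: "test_function N n w" "l2norm \<mu> (\<lambda>x. w x - g x) < e / 2"
    using g e2 unfolding approximable_def by blast
  have "l2norm \<mu> (\<lambda>x. (v x + w x) - (f x + g x)) = l2norm \<mu> (\<lambda>x. (v x - f x) + (w x - g x))"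
    by (simp add: algebra_simps)
  also have "\<dots> \<le> l2norm \<mu> (\<lambda>x. v x - f x) + l2norm \<mu> (\<lambda>x. w x - g x)"
    by (intro l2norm_triangle square_integrable_diff fg square_integrable_test_function[OF v(1)]
        square_integrable_test_function[OF w(1)])
  also have "\<dots> < e" using v w by simp
  finally show "\<exists>n z. test_function N n z \<and> l2norm \<mu> (\<lambda>x. z x - (f x + g x)) < e"
    using test_function_add[OF v(1) w(1)] by blast
qed

lemma approximable_diff:
  "approximable N f \<Longrightarrow> approximable N g \<Longrightarrow> approximable N (\<lambda>x. f x - g x)"
  using approximable_add[of N f "\<lambda>x. (-1) * g x"] approximable_scale[of N g "-1"] by simp

lemma approximable_zero: "approximable N (\<lambda>x. 0)"
  by (rule approximable_test_function[of N 0], rule test_functionI) auto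

lemma approximable_sum:
  "(\<And>i. i \<in> I \<Longrightarrow> approximable N (f i)) \<Longrightarrow> approximable N (\<lambda>x. \<Sum>i\<in>I. f i x)"
  by (induction I rule: infinite_finite_induct) (auto intro: approximable_zero approximable_add)

lemma approximable_limit:
  assumes f: "\<And>n. approximable N (f n)" and g: "square_integrable \<mu> g"
    and lim: "(\<lambda>n. l2norm \<mu> (\<lambda>x. f n x - g x)) \<longlonglongrightarrow> 0"
  shows "approximable N g"
  unfolding approximable_def
proof (intro conjI allI impI)
  fix e :: real assume "e > 0"
  then have e2: "e / 2 > 0" by simp
  obtain i where i: "l2norm \<mu> (\<lambda>x. f i x - g x) < e / 2"
    using eventually_happens'[OF sequentially_bot order_tendstoD(2)[OF lim e2]] by blast
  obtain n v where v: "test_function N n v" "l2norm \<mu> (\<lambda>x. v x - f i x) < e / 2"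
    using f[of i] e2 unfolding approximable_def by blast
  have "l2norm \<mu> (\<lambda>x. v x - g x) \<le> l2norm \<mu> (\<lambda>x. v x - f i x) + l2norm \<mu> (\<lambda>x. f i x - g x)"
    using f[of i] by (intro l2norm_triangle_diff square_integrable_test_function[OF v(1)] g)
      (simp add: approximable_def)
  then show "\<exists>n v. test_function N n v \<and> l2norm \<mu> (\<lambda>x. v x - g x) < e"
    using i v by (intro exI[of _ n] exI[of _ v]) auto
qed (rule g)

lemma approximable_indicator:
  assumes "A \<in> sets borel" shows "approximable N (indicator (A \<inter> disc (int N)))"
proof -
  have si: "square_integrable \<mu> (indicator (A \<inter> disc (int N)))" if "A \<in> sets borel" for A
    using that by (intro square_integrable_bounded[where n = "int N" and C = 1]) (auto simp: indicator_def)
  have A: "A \<in> sigma_sets UNIV (insert {} balls)"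
    using assms by (simp add: sets_borel_eq_balls)
  have "insert {} balls \<subseteq> Pow UNIV" by simp
  from Int_stable_balls this A show ?thesis
  proof (induction rule: sigma_sets_induct_disjoint)
    case (basic A)
    show ?case
    proof (cases "A = {}")
      case False
      then obtain a n where A: "A = coset a n" using basic by (auto simp: balls_def)
      \<comment> \<open>The indicator of a ball of radius at least 1 is already constant at scale 0.\<close>
      define m where "m = nat (- n)"
      have "test_function N m (indicator (A \<inter> disc (int N)))"
      proof (rule test_functionI)
        fix x y assume xy: "x - y \<in> disc (- int m)"
        then have d: "x - y \<in> disc n" "x - y \<in> disc (int N)"
          by (auto intro: disc_mono' simp: m_def)
        have "x \<in> A \<longleftrightarrow> y \<in> A"
          using disc_add_iff[OF d(1), of "y - a"] by (simp add: A)
        moreover have "x \<in> disc (int N) \<longleftrightarrow> y \<in> disc (int N)"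
          using disc_add_iff[OF d(2), of y] by simp
        ultimately show "indicator (A \<inter> disc (int N)) x = (indicator (A \<inter> disc (int N)) y :: complex)"
          by (simp add: indicator_def)
      qed simp
      then show ?thesis by (rule approximable_test_function)
    qed (use approximable_zero in simp)
  next
    case empty
    show ?case using approximable_zero by simp
  next
    case (compl A)
    have "test_function N 0 (indicator (disc (int N)))"
    proof (rule test_functionI)
      fix x y assume "x - y \<in> disc (- int 0)"
      then have d: "x - y \<in> disc (int N)" by (auto intro: disc_mono')
      show "indicator (disc (int N)) x = (indicator (disc (int N)) y :: complex)"
        using disc_add_iff[OF d, of y] by (simp add: indicator_def)
    qed simp
    then have "approximable N (\<lambda>x. indicator (disc (int N)) x - indicator (A \<inter> disc (int N)) x)"
      by (intro approximable_diff approximable_test_function[of N 0] compl)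
    moreover have "(\<lambda>x. indicator (disc (int N)) x - indicator (A \<inter> disc (int N)) x)
        = (indicator ((UNIV - A) \<inter> disc (int N)) :: 'k \<Rightarrow> complex)"
      by (auto simp: indicator_def)
    ultimately show ?case by simp
  next
    case (union A)
    have Am [measurable]: "A i \<in> sets borel" for i
      using union.hyps by (auto simp: sets_borel_eq_balls)
    have eq: "(\<Sum>i<n. indicator (A i \<inter> disc (int N)) x) = (indicator ((\<Union>i<n. A i) \<inter> disc (int N)) x :: complex)"
      for n x
    proof -
      have "indicator (\<Union>i<n. A i \<inter> disc (int N)) x = (\<Sum>i<n. indicator (A i \<inter> disc (int N)) x :: complex)"
        using union.hyps(1) by (intro indicator_UN_disjoint) (auto simp: disjoint_family_on_def)
      moreover have "(\<Union>i<n. A i \<inter> disc (int N)) = (\<Union>i<n. A i) \<inter> disc (int N)"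
        by blast
      ultimately show ?thesis by simp
    qed
    show ?case
    proof (rule approximable_limit)
      show "approximable N (\<lambda>x. \<Sum>i<n. indicator (A i \<inter> disc (int N)) x)" for n
        by (intro approximable_sum union.IH)
      show siU: "square_integrable \<mu> (indicator (\<Union> (range A) \<inter> disc (int N)))"
        by (rule si) measurable
      show "(\<lambda>n. l2norm \<mu> (\<lambda>x. (\<Sum>i<n. indicator (A i \<inter> disc (int N)) x)
          - indicator (\<Union> (range A) \<inter> disc (int N)) x)) \<longlonglongrightarrow> 0"
      proof (rule l2_dominated_convergence[OF siU, where c = 1])
        show "(\<lambda>x. \<Sum>i<n. indicator (A i \<inter> disc (int N)) x :: complex) \<in> borel_measurable \<mu>" for n
          unfolding measurable_haar by measurable
        show "AE x in \<mu>. (\<lambda>n. \<Sum>i<n. indicator (A i \<inter> disc (int N)) x)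
            \<longlonglongrightarrow> (indicator (\<Union> (range A) \<inter> disc (int N)) x :: complex)"
        proof (rule AE_I2)
          fix x
          show "(\<lambda>n. \<Sum>i<n. indicator (A i \<inter> disc (int N)) x)
            \<longlonglongrightarrow> (indicator (\<Union> (range A) \<inter> disc (int N)) x :: complex)"
          proof (cases "x \<in> \<Union> (range A)")
            case True
            then obtain j where j: "x \<in> A j" by blast
            have "\<forall>n\<ge>Suc j. (\<Sum>i<n. indicator (A i \<inter> disc (int N)) x)
                = (indicator (\<Union> (range A) \<inter> disc (int N)) x :: complex)"
              unfolding eq using j by (auto simp: indicator_def)
            then show ?thesis
              by (intro tendsto_eventually) (auto simp: eventually_sequentially)
          next
            case False
            then show ?thesis unfolding eq by (auto simp: indicator_def)
          qed
        qed
        show "AE x in \<mu>. cmod (\<Sum>i<n. indicator (A i \<inter> disc (int N)) x)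
            \<le> 1 * cmod (indicator (\<Union> (range A) \<inter> disc (int N)) x)" for n
          unfolding eq by (rule AE_I2) (auto simp: indicator_def)
      qed
    qed
  qed
qed

lemma approximable_square_integrable:
  assumes f: "square_integrable \<mu> f" and supp: "\<And>x. x \<notin> disc (int N) \<Longrightarrow> f x = 0"
  shows "approximable N f"
proof -
  have [measurable]: "f \<in> borel_measurable borel"
    using f by (simp add: square_integrable_def)
  obtain s where s: "\<And>i. simple_function borel (s i)" "\<And>x. (\<lambda>i. s i x) \<longlonglongrightarrow> f x"
    "\<And>i x. cmod (s i x) \<le> 2 * cmod (f x)"
    using borel_measurable_implies_sequence_metric[of f borel 0] by (auto simp: dist_norm)
  have s0: "s i x = 0" if "x \<notin> disc (int N)" for i x
    using s(3)[of i x] supp[OF that] by simp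
  have sm [measurable]: "s i \<in> borel_measurable borel" for i
    by (rule borel_measurable_simple_function[OF s(1)])
  show ?thesis
  proof (rule approximable_limit[OF _ f])
    show "(\<lambda>i. l2norm \<mu> (\<lambda>x. s i x - f x)) \<longlonglongrightarrow> 0"
      by (rule l2_dominated_convergence[OF f, where c = 2]) (use s in auto)
    fix i
    have fin: "finite (range (s i))"
      using s(1)[of i] by (simp add: simple_function_def)
    have "s i = (\<lambda>x. \<Sum>y\<in>range (s i). y * indicator ((s i -` {y}) \<inter> disc (int N)) x)"
    proof
      fix x
      have "(\<Sum>y\<in>range (s i). y * indicator ((s i -` {y}) \<inter> disc (int N)) x)
          = (\<Sum>y\<in>range (s i). if y = s i x then s i x else 0)"
        using s0[of x i] by (intro sum.cong refl) (auto simp: indicator_def)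
      then show "s i x = (\<Sum>y\<in>range (s i). y * indicator ((s i -` {y}) \<inter> disc (int N)) x)"
        using fin by simp
    qed
    moreover have "approximable N (\<lambda>x. \<Sum>y\<in>range (s i). y * indicator ((s i -` {y}) \<inter> disc (int N)) x)"
      using measurable_sets[OF sm[of i], of "{_}"]
      by (intro approximable_sum approximable_scale approximable_indicator) simp
    ultimately show "approximable N (s i)" by simp
  qed
qed

section \<open>The Plancherel theorem\<close>

lemma fourier_int_eq: "fourier_int K f \<xi> = (\<integral>x. f x * chi K (- \<xi> * x) \<partial>\<mu>)"
  by (simp add: fourier_int_def chi_minus)

lemma integrable_mult_chi:
  fixes f :: "'k \<Rightarrow> complex"
  assumes "integrable \<mu> f" shows "integrable \<mu> (\<lambda>x. f x * chi K (\<xi> * x))"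
  by (rule Bochner_Integration.integrable_bound[OF assms])
     (use borel_measurable_integrable[OF assms] in \<open>auto simp: norm_mult chi_norm\<close>)

lemma fourier_int_add:
  "integrable \<mu> f \<Longrightarrow> integrable \<mu> g \<Longrightarrow>
    fourier_int K (\<lambda>x. f x + g x) \<xi> = fourier_int K f \<xi> + fourier_int K g \<xi>"
  unfolding fourier_int_eq distrib_right
  by (intro Bochner_Integration.integral_add integrable_mult_chi)

lemma fourier_int_scale: "fourier_int K (\<lambda>x. c * f x) \<xi> = c * fourier_int K f \<xi>"
  unfolding fourier_int_eq by (simp add: mult.assoc)

lemma fourier_int_diff:
  "integrable \<mu> f \<Longrightarrow> integrable \<mu> g \<Longrightarrow>
    fourier_int K (\<lambda>x. f x - g x) \<xi> = fourier_int K f \<xi> - fourier_int K g \<xi>"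
  using fourier_int_add[of f "\<lambda>x. (-1) * g x" \<xi>] by (simp add: fourier_int_scale del: mult_minus_left)
     (simp add: fourier_int_def)

lemma fourier_int_test_function:
  assumes v: "test_function N n v"
  shows "fourier_int K v \<xi> = of_real (real q powi (- int n)) * indicator (disc (int n)) \<xi> *
    (\<Sum>k<q ^ (N + n). v (node n k) * cnj (chi K (\<xi> * node n k)))"
proof -
  have "fourier_int K v \<xi> = (\<integral>x. (\<Sum>k<q ^ (N + n). v (node n k) *
      (indicator (disc (- int n)) (x - node n k) * chi K (- \<xi> * x))) \<partial>\<mu>)"
    unfolding fourier_int_eq
    by (intro Bochner_Integration.integral_cong refl, subst test_function_eq_sum'[OF v])
       (simp only: sum_distrib_right mult.assoc)
  also have "\<dots> = (\<Sum>k<q ^ (N + n). v (node n k) *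
      (\<integral>x. indicator (disc (- int n)) (x - node n k) * chi K (- \<xi> * x) \<partial>\<mu>))"
    by (subst Bochner_Integration.integral_sum)
       (intro integrable_mult_right integrable_mult_chi integrable_indicator_shift, simp)
  also have "\<dots> = of_real (real q powi (- int n)) * indicator (disc (int n)) \<xi> *
    (\<Sum>k<q ^ (N + n). v (node n k) * cnj (chi K (\<xi> * node n k)))"
    unfolding integral_indicator_shift_chi
    by (simp add: sum_distrib_left indicator_def chi_minus mult_ac)
  finally show ?thesis .
qed

lemma fourier_int_test_function_measurable:
  assumes v: "test_function N n v" shows "fourier_int K v \<in> borel_measurable borel"
  unfolding fourier_int_test_function[OF v, abs_def] by measurable

text \<open>The transform of a ball of radius \<open>q\<^sup>-\<^sup>n\<close> is a character on the disc of radius \<open>q\<^sup>n\<close>, and characters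
  belonging to distinct nodes are orthogonal there, just as distinct balls are disjoint.\<close>

lemma l2norm_fourier_int_test_function:
  assumes v: "test_function N n v"
  shows "square_integrable \<mu> (fourier_int K v)" "l2norm \<mu> (fourier_int K v) = l2norm \<mu> v"
proof -
  let ?M = "q ^ (N + n)" and ?c = "\<lambda>k. v (node n k)"
  let ?Q = "real q powi (- int n)"
  show si: "square_integrable \<mu> (fourier_int K v)"
  proof (rule square_integrable_bounded)
    show "fourier_int K v \<in> borel_measurable borel"
      by (rule fourier_int_test_function_measurable[OF v])
    show "fourier_int K v \<xi> = 0" if "\<xi> \<notin> disc (int n)" for \<xi>
      using that by (simp add: fourier_int_test_function[OF v])
    show "cmod (fourier_int K v \<xi>) \<le> ?Q * (\<Sum>k<?M. cmod (?c k))" for \<xi>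
      unfolding fourier_int_test_function[OF v] norm_mult
      by (intro mult_mono sum_norm_le sum_nonneg)
         (auto simp: norm_mult chi_norm indicator_def norm_power_int intro!: sum_nonneg)
  qed
  have sep: "node n k - node n j \<in> disc (- int n) \<longleftrightarrow> j = k" for j k
    using u_separated[of k j] by (auto simp flip: right_diff_distrib)
  have "complex_of_real ((l2norm \<mu> (fourier_int K v))\<^sup>2) = (\<integral>\<xi>. of_real ((cmod (fourier_int K v \<xi>))\<^sup>2) \<partial>\<mu>)"
    by (simp only: l2norm_power2 integral_complex_of_real)
  also have "\<dots> = (\<integral>\<xi>. (\<Sum>j<?M. \<Sum>k<?M. of_real (?Q\<^sup>2) * ?c j * cnj (?c k) *
      (indicator (disc (int n)) \<xi> *\<^sub>R chi K ((node n k - node n j) * \<xi>))) \<partial>\<mu>)"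
  proof (intro Bochner_Integration.integral_cong refl)
    fix \<xi>
    have "of_real ((cmod (fourier_int K v \<xi>))\<^sup>2) = fourier_int K v \<xi> * cnj (fourier_int K v \<xi>)"
      by (rule complex_norm_square)
    also have "\<dots> = of_real (?Q\<^sup>2) * indicator (disc (int n)) \<xi> *
        ((\<Sum>j<?M. ?c j * cnj (chi K (\<xi> * node n j))) * (\<Sum>k<?M. cnj (?c k) * chi K (\<xi> * node n k)))"
      unfolding fourier_int_test_function[OF v]
      by (cases "\<xi> \<in> disc (int n)") (simp_all add: power2_eq_square)
    also have "\<dots> = (\<Sum>j<?M. \<Sum>k<?M. of_real (?Q\<^sup>2) * indicator (disc (int n)) \<xi> *
        ((?c j * cnj (chi K (\<xi> * node n j))) * (cnj (?c k) * chi K (\<xi> * node n k))))"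
      by (subst sum_product) (simp only: sum_distrib_left)
    also have "\<dots> = (\<Sum>j<?M. \<Sum>k<?M. of_real (?Q\<^sup>2) * ?c j * cnj (?c k) *
      (indicator (disc (int n)) \<xi> *\<^sub>R chi K ((node n k - node n j) * \<xi>)))"
      unfolding left_diff_distrib chi_diff
      by (intro sum.cong refl) (simp add: indicator_def mult_ac)
    finally show "of_real ((cmod (fourier_int K v \<xi>))\<^sup>2) = (\<Sum>j<?M. \<Sum>k<?M. of_real (?Q\<^sup>2) * ?c j * cnj (?c k) *
      (indicator (disc (int n)) \<xi> *\<^sub>R chi K ((node n k - node n j) * \<xi>)))" .
  qed
  also have "\<dots> = (\<Sum>j<?M. \<Sum>k<?M. of_real (?Q\<^sup>2) * ?c j * cnj (?c k) *
      (\<integral>\<xi>. indicator (disc (int n)) \<xi> *\<^sub>R chi K ((node n k - node n j) * \<xi>) \<partial>\<mu>))"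
    by (simp only: Bochner_Integration.integral_sum Bochner_Integration.integrable_sum
        integrable_mult_right integrable_chi_disc integral_mult_right_zero)
  also have "\<dots> = (\<Sum>j<?M. \<Sum>k<?M. if j = k then of_real (?Q * (cmod (?c j))\<^sup>2) else 0)"
    unfolding integral_chi_disc sep
  proof (intro sum.cong refl)
    fix j k
    have "of_real (?Q\<^sup>2) * z * cnj z * of_real (real q powi int n) = of_real (?Q * (cmod z)\<^sup>2)" for z
    proof -
      have "?Q\<^sup>2 * real q powi int n = ?Q"
        by (simp add: power2_eq_square power_int_minus)
      then have "of_real (?Q * (cmod z)\<^sup>2) = complex_of_real (?Q\<^sup>2 * real q powi int n) * of_real ((cmod z)\<^sup>2)"
        by (simp only: of_real_mult)
      then show ?thesis
        unfolding complex_norm_square of_real_mult by (simp only: mult_ac)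
    qed
    from this[of "?c j"]
    show "of_real (?Q\<^sup>2) * ?c j * cnj (?c k) *
        (if j = k then complex_of_real (real q powi int n) else 0)
      = (if j = k then of_real (?Q * (cmod (?c j))\<^sup>2) else 0)"
      by (cases "j = k") simp_all
  qed
  also have "\<dots> = of_real ((l2norm \<mu> v)\<^sup>2)"
    unfolding l2norm_test_function[OF v] by (simp add: sum_distrib_left sum_distrib_right mult.commute)
  finally have "(l2norm \<mu> (fourier_int K v))\<^sup>2 = (l2norm \<mu> v)\<^sup>2"
    unfolding of_real_eq_iff .
  then show "l2norm \<mu> (fourier_int K v) = l2norm \<mu> v"
    by (simp add: power2_eq_iff_nonneg)
qed

lemma square_integrable_indicator_disc: "square_integrable \<mu> (indicator (disc n))"
  by (rule square_integrable_bounded[where n = n and C = 1]) (auto simp: indicator_def)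

lemma truncate_disc:
  assumes "square_integrable \<mu> f"
  shows "square_integrable \<mu> (\<lambda>x. indicator (disc n) x * f x)"
    and "integrable \<mu> (\<lambda>x. indicator (disc n) x * f x)"
    and "(\<integral>x. cmod (indicator (disc n) x * f x) \<partial>\<mu>) \<le> l2norm \<mu> (indicator (disc n)) * l2norm \<mu> f"
proof -
  have [measurable]: "f \<in> borel_measurable borel"
    using assms by (simp add: square_integrable_def)
  show "square_integrable \<mu> (\<lambda>x. indicator (disc n) x * f x)"
    by (rule square_integrable_bound[OF assms, where c = 1]) (auto simp: indicator_def)
  show "integrable \<mu> (\<lambda>x. indicator (disc n) x * f x)"
    using integrable_mult_cnj(1)[OF square_integrable_indicator_disc[of n] square_integrable_cnj[OF assms]]
    by simp
  show "(\<integral>x. cmod (indicator (disc n) x * f x) \<partial>\<mu>) \<le> l2norm \<mu> (indicator (disc n)) * l2norm \<mu> f"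
    using Cauchy_Schwarz_integral_cmod[OF square_integrable_indicator_disc[of n] assms]
    by (simp add: norm_mult)
qed

lemma supported_eq_truncate:
  fixes f :: "'k \<Rightarrow> complex"
  assumes "\<And>x. x \<notin> disc n \<Longrightarrow> f x = 0" shows "(\<lambda>x. indicator (disc n) x * f x) = f"
proof
  show "indicator (disc n) x * f x = f x" for x
    using assms[of x] by (cases "x \<in> disc n") simp_all
qed

lemma cmod_fourier_int_le: "cmod (fourier_int K f \<xi>) \<le> (\<integral>x. cmod (f x) \<partial>\<mu>)"
  unfolding fourier_int_eq
  using integral_norm_bound[of \<mu> "\<lambda>x. f x * chi K (- \<xi> * x)"] by (simp add: norm_mult chi_norm)

text \<open>On a disc \<open>L\<^sup>2\<close> approximation by test functions implies \<open>L\<^sup>1\<close> approximation, hence pointwise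
  convergence of the transforms.\<close>

lemma Plancherel_disc:
  assumes f: "square_integrable \<mu> f" and supp: "\<And>x. x \<notin> disc (int N) \<Longrightarrow> f x = 0"
  shows "square_integrable \<mu> (fourier_int K f)" "l2norm \<mu> (fourier_int K f) = l2norm \<mu> f"
proof -
  have "\<exists>n v. test_function N n v \<and> l2norm \<mu> (\<lambda>x. v x - f x) < 1 / (real i + 1)" for i :: nat
    using approximable_square_integrable[OF f supp] by (simp add: approximable_def)
  then obtain n v where v: "\<And>i :: nat. test_function N (n i) (v i)"
    "\<And>i. l2norm \<mu> (\<lambda>x. v i x - f x) < 1 / (real i + 1)"
    by metis
  have lim: "(\<lambda>i. l2norm \<mu> (\<lambda>x. v i x - f x)) \<longlonglongrightarrow> 0"
  proof (rule Lim_null_comparison)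
    show "(\<lambda>i. 1 / (real i + 1)) \<longlonglongrightarrow> 0"
      using LIMSEQ_inverse_real_of_nat by (simp add: inverse_eq_divide add.commute)
  qed (use v(2) in \<open>auto intro!: always_eventually less_imp_le\<close>)
  have vsi: "square_integrable \<mu> (v i)" for i
    by (rule square_integrable_test_function[OF v(1)])
  have vi: "integrable \<mu> (v i)" for i
    using truncate_disc(2)[OF vsi[of i], of "int N"] supported_eq_truncate[of "int N" "v i"]
      test_function_zero[OF v(1)[of i]] by simp
  have fi: "integrable \<mu> f"
    using truncate_disc(2)[OF f, of "int N"] supported_eq_truncate[OF supp] by simp
  have ptw: "(\<lambda>i. fourier_int K (v i) \<xi>) \<longlonglongrightarrow> fourier_int K f \<xi>" for \<xi>
  proof (rule LIM_zero_cancel, rule Lim_null_comparison)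
    show "(\<lambda>i. l2norm \<mu> (indicator (disc (int N))) * l2norm \<mu> (\<lambda>x. v i x - f x)) \<longlonglongrightarrow> 0"
      using tendsto_mult_right_zero[OF lim] by simp
    have "cmod (fourier_int K (v i) \<xi> - fourier_int K f \<xi>)
        \<le> l2norm \<mu> (indicator (disc (int N))) * l2norm \<mu> (\<lambda>x. v i x - f x)" for i
    proof -
      have "cmod (fourier_int K (v i) \<xi> - fourier_int K f \<xi>) \<le> (\<integral>x. cmod (v i x - f x) \<partial>\<mu>)"
        unfolding fourier_int_diff[OF vi fi, symmetric] by (rule cmod_fourier_int_le)
      also have "(\<lambda>x. v i x - f x) = (\<lambda>x. indicator (disc (int N)) x * (v i x - f x))"
        by (rule supported_eq_truncate[symmetric]) (simp add: test_function_zero[OF v(1)] supp)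
      also have "(\<integral>x. cmod (indicator (disc (int N)) x * (v i x - f x)) \<partial>\<mu>)
          \<le> l2norm \<mu> (indicator (disc (int N))) * l2norm \<mu> (\<lambda>x. v i x - f x)"
        by (rule truncate_disc(3)[OF square_integrable_diff[OF vsi f]])
      finally show ?thesis
        by (simp only: supported_eq_truncate[of "int N" "\<lambda>x. v i x - f x"] test_function_zero[OF v(1)] supp diff_self)
    qed
    then show "\<forall>\<^sub>F i in sequentially. cmod (fourier_int K (v i) \<xi> - fourier_int K f \<xi>)
        \<le> l2norm \<mu> (indicator (disc (int N))) * l2norm \<mu> (\<lambda>x. v i x - f x)"
      by simp
  qed
  have meas: "fourier_int K f \<in> borel_measurable \<mu>"
    unfolding measurable_haar
    by (rule borel_measurable_LIMSEQ_metric[OF fourier_int_test_function_measurable[OF v(1)] ptw])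
  have iso: "l2norm \<mu> (\<lambda>\<xi>. fourier_int K (v j) \<xi> - fourier_int K (v i) \<xi>)
      = l2norm \<mu> (\<lambda>x. v j x - v i x)" for i j
    using l2norm_fourier_int_test_function(2)[OF test_function_diff[OF v(1)[of j] v(1)[of i]]]
    unfolding fourier_int_diff[OF vi vi, abs_def] .
  show "square_integrable \<mu> (fourier_int K f)" "l2norm \<mu> (fourier_int K f) = l2norm \<mu> f"
    using isometry_limit[OF vsi f lim l2norm_fourier_int_test_function(1)[OF v(1)] meas _ iso
        l2norm_fourier_int_test_function(2)[OF v(1)]] ptw by simp_all
qed

lemma truncate_disc_tendsto:
  fixes f :: "'k \<Rightarrow> complex"
  shows "(\<lambda>n. indicator (disc (int n)) x * f x) \<longlonglongrightarrow> f x"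
proof -
  obtain m :: nat where "x \<in> disc (int m)" using ex_disc by blast
  then have "\<forall>n\<ge>m. indicator (disc (int n)) x * f x = f x"
    by (auto simp: indicator_def intro: disc_mono')
  then show ?thesis
    by (intro tendsto_eventually) (auto simp: eventually_sequentially)
qed

lemma truncate_disc_l2_tendsto:
  assumes f: "square_integrable \<mu> f"
  shows "(\<lambda>n. l2norm \<mu> (\<lambda>x. indicator (disc (int n)) x * f x - f x)) \<longlonglongrightarrow> 0"
proof (rule l2_dominated_convergence[OF f, where c = 1])
  have [measurable]: "f \<in> borel_measurable borel"
    using f by (simp add: square_integrable_def)
  show "(\<lambda>x. indicator (disc (int n)) x * f x) \<in> borel_measurable \<mu>" for n
    unfolding measurable_haar by measurable
  show "AE x in \<mu>. cmod (indicator (disc (int n)) x * f x) \<le> 1 * cmod (f x)" for n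
    by (rule AE_I2) (simp add: indicator_def)
  show "AE x in \<mu>. (\<lambda>n. indicator (disc (int n)) x * f x) \<longlonglongrightarrow> f x"
    by (rule AE_I2) (rule truncate_disc_tendsto)
qed

lemma Plancherel_diff:
  assumes "square_integrable \<mu> f"
  shows "l2norm \<mu> (\<lambda>\<xi>. fourier_int K (\<lambda>x. indicator (disc (int m)) x * f x) \<xi>
          - fourier_int K (\<lambda>x. indicator (disc (int n)) x * f x) \<xi>)
    = l2norm \<mu> (\<lambda>x. indicator (disc (int m)) x * f x - indicator (disc (int n)) x * f x)"
proof -
  have "l2norm \<mu> (fourier_int K (\<lambda>x. indicator (disc (int m)) x * f x - indicator (disc (int n)) x * f x))
    = l2norm \<mu> (\<lambda>x. indicator (disc (int m)) x * f x - indicator (disc (int n)) x * f x)"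
  proof (rule Plancherel_disc(2)[of _ "max m n"])
    fix x assume "x \<notin> disc (int (max m n))"
    then have "x \<notin> disc (int m)" "x \<notin> disc (int n)"
      using disc_mono'[of x "int m" "int (max m n)"] disc_mono'[of x "int n" "int (max m n)"] by auto
    then show "indicator (disc (int m)) x * f x - indicator (disc (int n)) x * f x = 0"
      by simp
  qed (intro square_integrable_diff truncate_disc(1) assms)
  then show ?thesis
    unfolding fourier_int_diff[OF truncate_disc(2)[OF assms] truncate_disc(2)[OF assms], abs_def] .
qed

text \<open>The transforms of the truncations to discs converge pointwise because \<open>f\<close> is integrable, and in
  \<open>L\<^sup>2\<close> because \<open>f\<close> is square-integrable.\<close>

theorem Plancherel:
  assumes f: "square_integrable \<mu> f" and fi: "integrable \<mu> f"
  shows "square_integrable \<mu> (fourier_int K f)" "l2norm \<mu> (fourier_int K f) = l2norm \<mu> f"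
proof -
  let ?v = "\<lambda>n x. indicator (disc (int n)) x * f x"
  have [measurable]: "f \<in> borel_measurable borel"
    using f by (simp add: square_integrable_def)
  have V: "square_integrable \<mu> (fourier_int K (?v n))" "l2norm \<mu> (fourier_int K (?v n)) = l2norm \<mu> (?v n)" for n
    by (rule Plancherel_disc[of _ n, OF truncate_disc(1)[OF f]], simp)+
  have ptw: "(\<lambda>n. fourier_int K (?v n) \<xi>) \<longlonglongrightarrow> fourier_int K f \<xi>" for \<xi>
    unfolding fourier_int_eq
  proof (rule integral_dominated_convergence)
    show "integrable \<mu> (\<lambda>x. cmod (f x))" using fi by simp
    show "AE x in \<mu>. (\<lambda>n. ?v n x * chi K (- \<xi> * x)) \<longlonglongrightarrow> f x * chi K (- \<xi> * x)"
      by (rule AE_I2) (intro tendsto_mult truncate_disc_tendsto tendsto_const)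
    show "AE x in \<mu>. norm (?v n x * chi K (- \<xi> * x)) \<le> cmod (f x)" for n
      by (rule AE_I2) (simp add: indicator_def norm_mult chi_norm)
  qed (unfold measurable_haar, measurable)
  have meas: "fourier_int K f \<in> borel_measurable \<mu>"
    by (rule borel_measurable_LIMSEQ_metric[OF _ ptw]) (use V in \<open>simp add: square_integrable_def\<close>)
  show "square_integrable \<mu> (fourier_int K f)" "l2norm \<mu> (fourier_int K f) = l2norm \<mu> f"
    using isometry_limit[OF truncate_disc(1)[OF f] f truncate_disc_l2_tendsto[OF f] V(1) meas _
        Plancherel_diff[OF f] V(2)] ptw by simp_all
qed

section \<open>The Fourier transform on \<open>L\<^sup>2\<close>\<close>

lemma is_L2_fourier_iff:
  assumes f: "square_integrable \<mu> f"
  shows "is_L2_fourier K f g \<longleftrightarrow> square_integrable \<mu> g \<and>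
    (\<exists>F. (\<forall>n. integrable \<mu> (F n) \<and> square_integrable \<mu> (F n)) \<and>
      (\<lambda>n. l2norm \<mu> (\<lambda>x. F n x - f x)) \<longlonglongrightarrow> 0 \<and>
      (\<lambda>n. l2norm \<mu> (\<lambda>\<xi>. fourier_int K (F n) \<xi> - g \<xi>)) \<longlonglongrightarrow> 0)"
proof -
  have eq: "(\<lambda>n. l2sq K (\<lambda>x. F n x - f x)) \<longlonglongrightarrow> 0 \<longleftrightarrow> (\<lambda>n. l2norm \<mu> (\<lambda>x. F n x - f x)) \<longlonglongrightarrow> 0"
    "(\<lambda>n. l2sq K (\<lambda>\<xi>. fourier_int K (F n) \<xi> - g \<xi>)) \<longlonglongrightarrow> 0 \<longleftrightarrow>
      (\<lambda>n. l2norm \<mu> (\<lambda>\<xi>. fourier_int K (F n) \<xi> - g \<xi>)) \<longlonglongrightarrow> 0"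
    if "\<forall>n. integrable \<mu> (F n) \<and> square_integrable \<mu> (F n)" "square_integrable \<mu> g" for F :: "nat \<Rightarrow> _"
    using that by (auto intro!: l2sq_tendsto_0_iff square_integrable_diff f Plancherel(1))
  show ?thesis
    unfolding is_L2_fourier_def L2_iff using eq by blast
qed

text \<open>The transforms of the truncations of \<open>f\<close> to discs form a Cauchy sequence by \<open>Plancherel_diff\<close>.\<close>

lemma is_L2_fourier_exists:
  assumes f: "square_integrable \<mu> f" shows "\<exists>g. is_L2_fourier K f g"
proof -
  let ?v = "\<lambda>n x. indicator (disc (int n)) x * f x"
  note v = truncate_disc(1)[OF f] and lim = truncate_disc_l2_tendsto[OF f]
  have "\<exists>N. \<forall>m\<ge>N. \<forall>n\<ge>N. l2norm \<mu> (\<lambda>\<xi>. fourier_int K (?v m) \<xi> - fourier_int K (?v n) \<xi>) < e"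
    if "e > 0" for e
  proof -
    have "e / 2 > 0" using that by simp
    then obtain N where N: "\<And>n. n \<ge> N \<Longrightarrow> l2norm \<mu> (\<lambda>x. ?v n x - f x) < e / 2"
      using order_tendstoD(2)[OF lim \<open>e / 2 > 0\<close>] unfolding eventually_sequentially by blast
    have "l2norm \<mu> (\<lambda>x. ?v m x - ?v n x) < e" if "m \<ge> N" "n \<ge> N" for m n
      using l2norm_triangle_diff[OF v[of "int m"] f v[of "int n"]] N[OF that(1)] N[OF that(2)]
        l2norm_minus[of \<mu> f "?v n"] by linarith
    then show ?thesis by (auto simp: Plancherel_diff[OF f])
  qed
  then obtain g where "square_integrable \<mu> g"
    "(\<lambda>n. l2norm \<mu> (\<lambda>\<xi>. fourier_int K (?v n) \<xi> - g \<xi>)) \<longlonglongrightarrow> 0"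
    using l2_complete[of \<mu> "\<lambda>n. fourier_int K (?v n)"] Plancherel(1)[OF v truncate_disc(2)[OF f]] by blast
  then show ?thesis
    unfolding is_L2_fourier_iff[OF f] using v truncate_disc(2)[OF f] lim by (intro exI[of _ g] exI[of _ ?v] conjI allI) blast+
qed

text \<open>For integrable \<open>f\<close> the constant sequence \<open>f\<close> witnesses the limit; otherwise a choice exists by
  completeness.\<close>

lemma is_L2_fourier_fourier:
  assumes f: "square_integrable \<mu> f" shows "is_L2_fourier K f (fourier K f)"
proof (cases "integrable \<mu> f")
  case True
  then show ?thesis
    unfolding is_L2_fourier_iff[OF f] using f Plancherel(1)[OF f True]
    by (auto simp: fourier_def intro!: exI[of _ "\<lambda>_. f"])
next
  case False
  then show ?thesis
    using someI_ex[OF is_L2_fourier_exists[OF f]] by (simp add: fourier_def)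
qed

lemma l2norm_is_L2_fourier:
  assumes f: "square_integrable \<mu> f" and g: "is_L2_fourier K f g"
  shows "l2norm \<mu> g = l2norm \<mu> f"
proof -
  obtain F where F: "\<And>n. integrable \<mu> (F n)" "\<And>n. square_integrable \<mu> (F n)"
    "(\<lambda>n. l2norm \<mu> (\<lambda>x. F n x - f x)) \<longlonglongrightarrow> 0"
    "(\<lambda>n. l2norm \<mu> (\<lambda>\<xi>. fourier_int K (F n) \<xi> - g \<xi>)) \<longlonglongrightarrow> 0" and g2: "square_integrable \<mu> g"
    using g unfolding is_L2_fourier_iff[OF f] by blast
  have "(\<lambda>n. l2norm \<mu> (F n)) \<longlonglongrightarrow> l2norm \<mu> g"
    using tendsto_l2norm[OF Plancherel(1)[OF F(2,1)] g2 F(4)] by (simp add: Plancherel(2)[OF F(2,1)])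
  then show ?thesis
    using tendsto_l2norm[OF F(2) f F(3)] LIMSEQ_unique by blast
qed

lemma is_L2_fourier_square_integrable: "is_L2_fourier K f g \<Longrightarrow> square_integrable \<mu> g"
  by (simp add: is_L2_fourier_def L2_iff)

lemma l2norm_combination_tendsto:
  assumes F: "\<And>n. square_integrable \<mu> (F n)" "square_integrable \<mu> f" "(\<lambda>n. l2norm \<mu> (\<lambda>x. F n x - f x)) \<longlonglongrightarrow> 0"
    and G: "\<And>n. square_integrable \<mu> (G n)" "square_integrable \<mu> g" "(\<lambda>n. l2norm \<mu> (\<lambda>x. G n x - g x)) \<longlonglongrightarrow> 0"
  shows "(\<lambda>n. l2norm \<mu> (\<lambda>x. (F n x + c * G n x) - (f x + c * g x))) \<longlonglongrightarrow> 0"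
proof (rule Lim_null_comparison)
  show "(\<lambda>n. l2norm \<mu> (\<lambda>x. F n x - f x) + cmod c * l2norm \<mu> (\<lambda>x. G n x - g x)) \<longlonglongrightarrow> 0"
    using tendsto_add[OF F(3) tendsto_mult_right_zero[OF G(3), of "cmod c"]] by simp
  have "l2norm \<mu> (\<lambda>x. (F n x + c * G n x) - (f x + c * g x))
      \<le> l2norm \<mu> (\<lambda>x. F n x - f x) + cmod c * l2norm \<mu> (\<lambda>x. G n x - g x)" for n
  proof -
    have "l2norm \<mu> (\<lambda>x. (F n x + c * G n x) - (f x + c * g x))
        = l2norm \<mu> (\<lambda>x. (F n x - f x) + c * (G n x - g x))"
      by (simp add: algebra_simps)
    also have "\<dots> \<le> l2norm \<mu> (\<lambda>x. F n x - f x) + l2norm \<mu> (\<lambda>x. c * (G n x - g x))"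
      by (intro l2norm_triangle square_integrable_diff square_integrable_scale F G)
    finally show ?thesis by (simp add: l2norm_scale)
  qed
  then show "\<forall>\<^sub>F n in sequentially. norm (l2norm \<mu> (\<lambda>x. (F n x + c * G n x) - (f x + c * g x)))
      \<le> l2norm \<mu> (\<lambda>x. F n x - f x) + cmod c * l2norm \<mu> (\<lambda>x. G n x - g x)"
    by simp
qed

lemma is_L2_fourier_combination:
  assumes f: "square_integrable \<mu> f" and f': "is_L2_fourier K f f'"
    and g: "square_integrable \<mu> g" and g': "is_L2_fourier K g g'"
  shows "is_L2_fourier K (\<lambda>x. f x + c * g x) (\<lambda>\<xi>. f' \<xi> + c * g' \<xi>)"
proof -
  obtain F where F: "\<And>n. integrable \<mu> (F n)" "\<And>n. square_integrable \<mu> (F n)"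
    "(\<lambda>n. l2norm \<mu> (\<lambda>x. F n x - f x)) \<longlonglongrightarrow> 0"
    "(\<lambda>n. l2norm \<mu> (\<lambda>\<xi>. fourier_int K (F n) \<xi> - f' \<xi>)) \<longlonglongrightarrow> 0" and f2: "square_integrable \<mu> f'"
    using f' unfolding is_L2_fourier_iff[OF f] by blast
  obtain G where G: "\<And>n. integrable \<mu> (G n)" "\<And>n. square_integrable \<mu> (G n)"
    "(\<lambda>n. l2norm \<mu> (\<lambda>x. G n x - g x)) \<longlonglongrightarrow> 0"
    "(\<lambda>n. l2norm \<mu> (\<lambda>\<xi>. fourier_int K (G n) \<xi> - g' \<xi>)) \<longlonglongrightarrow> 0" and g2: "square_integrable \<mu> g'"
    using g' unfolding is_L2_fourier_iff[OF g] by blast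
  have fi: "fourier_int K (\<lambda>x. F n x + c * G n x) = (\<lambda>\<xi>. fourier_int K (F n) \<xi> + c * fourier_int K (G n) \<xi>)" for n
    by (rule ext) (subst fourier_int_add, auto intro: F G simp: fourier_int_scale)
  have "square_integrable \<mu> (\<lambda>x. f x + c * g x)" "square_integrable \<mu> (\<lambda>\<xi>. f' \<xi> + c * g' \<xi>)"
    by (intro square_integrable_add square_integrable_scale f g f2 g2)+
  then show ?thesis
    using l2norm_combination_tendsto[OF F(2) f F(3) G(2) g G(3), of c]
      l2norm_combination_tendsto[OF Plancherel(1)[OF F(2,1)] f2 F(4) Plancherel(1)[OF G(2,1)] g2 G(4), of c] F G
    by (subst is_L2_fourier_iff)
       (auto intro!: exI[of _ "\<lambda>n x. F n x + c * G n x"] square_integrable_add square_integrable_scale simp: fi)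
qed

text \<open>By linearity the transform preserves the norms of \<open>f + c g\<close>, and these determine the inner product.\<close>

theorem Parseval:
  assumes f: "square_integrable \<mu> f" and f': "is_L2_fourier K f f'"
    and g: "square_integrable \<mu> g" and g': "is_L2_fourier K g g'"
  shows "l2_inner K f g = l2_inner K f' g'"
proof -
  have "l2norm \<mu> (\<lambda>\<xi>. f' \<xi> + c * g' \<xi>) = l2norm \<mu> (\<lambda>x. f x + c * g x)" for c
    using is_L2_fourier_combination[OF f f' g g', of c]
    by (intro l2norm_is_L2_fourier square_integrable_add square_integrable_scale f g)
  from this[of 1] this[of "-1"] this[of \<i>] this[of "- \<i>"]
  have "4 * (\<integral>x. f' x * cnj (g' x) \<partial>\<mu>) = 4 * (\<integral>x. f x * cnj (g x) \<partial>\<mu>)"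
    unfolding polarization_integral[OF f g]
      polarization_integral[OF is_L2_fourier_square_integrable[OF f'] is_L2_fourier_square_integrable[OF g']]
    by simp
  then show ?thesis by (simp add: l2_inner_def)
qed

section \<open>Dilations and wavelets\<close>

lemma q_powr_half_power2: "(real q powr (of_int j / 2))\<^sup>2 = real q powi j"
  by (simp add: powr_power powr_real_of_int')

text \<open>The factor \<open>q\<^sup>-\<^sup>j\<^sup>/\<^sup>2\<close> compensates for the change of measure. With trivial \<open>w\<close> this covers the
  wavelets themselves, and with a character as \<open>w\<close> their Fourier transforms.\<close>

lemma dilation_isometry:
  fixes j :: int and a :: 'k
  assumes f: "square_integrable \<mu> f" and w: "w \<in> borel_measurable borel" "\<And>x. cmod (w x) = 1"
  defines "g \<equiv> \<lambda>x. of_real (real q powr (of_int (- j) / 2)) * (w x * f (\<pp> powi j * x + a))"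
  shows "square_integrable \<mu> g" "l2norm \<mu> g = l2norm \<mu> f"
proof -
  have [measurable]: "f \<in> borel_measurable borel" "w \<in> borel_measurable borel"
    using f w by (auto simp: square_integrable_def)
  have [measurable]: "g \<in> borel_measurable borel"
    unfolding g_def by measurable
  have eq: "(cmod (g x))\<^sup>2 = real q powi (- j) * (cmod (f (\<pp> powi j * x + a)))\<^sup>2" for x
    unfolding g_def norm_mult norm_of_real w power_mult_distrib power2_abs q_powr_half_power2 by simp
  have "(\<integral>\<^sup>+x. ennreal ((cmod (g x))\<^sup>2) \<partial>\<mu>)
      = ennreal (real q powi (- j)) * (\<integral>\<^sup>+x. ennreal ((cmod (f (\<pp> powi j * x + a)))\<^sup>2) \<partial>\<mu>)"
    unfolding eq by (simp add: ennreal_mult nn_integral_cmult)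
  also have "\<dots> = ennreal (real q powi (- j)) * (ennreal (real q powi j) * (\<integral>\<^sup>+x. ennreal ((cmod (f x))\<^sup>2) \<partial>\<mu>))"
    by (subst nn_integral_affine) simp_all
  also have "ennreal (real q powi (- j)) * (ennreal (real q powi j) * c) = c" for c
    by (simp add: mult.assoc[symmetric] ennreal_mult[symmetric] power_int_minus)
  finally have nn: "(\<integral>\<^sup>+x. ennreal ((cmod (g x))\<^sup>2) \<partial>\<mu>) = (\<integral>\<^sup>+x. ennreal ((cmod (f x))\<^sup>2) \<partial>\<mu>)" .
  show gi: "square_integrable \<mu> g"
    using f unfolding square_integrable_iff_nn_integral nn by simp
  have "ennreal ((l2norm \<mu> g)\<^sup>2) = ennreal ((l2norm \<mu> f)\<^sup>2)"
    using nn unfolding nn_integral_cmod_power2[OF gi] nn_integral_cmod_power2[OF f] .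
  then show "l2norm \<mu> g = l2norm \<mu> f"
    by (simp add: power2_eq_iff_nonneg)
qed

definition dilate :: "int \<Rightarrow> ('k \<Rightarrow> complex) \<Rightarrow> 'k \<Rightarrow> complex" where
  "dilate j f x = of_real (real q powr (of_int j / 2)) * f (\<pp> powi (- j) * x)"

lemma dilate_isometry:
  assumes "square_integrable \<mu> f"
  shows "square_integrable \<mu> (dilate j f)" "l2norm \<mu> (dilate j f) = l2norm \<mu> f"
  using dilation_isometry[OF assms, of "\<lambda>_. 1" "- j" 0]
  by (simp_all add: dilate_def[abs_def])

text \<open>The Fourier transform of \<open>wavelet K g j k\<close> in terms of the transform \<open>f\<close> of \<open>g\<close>.\<close>

definition wavelet_hat :: "('k \<Rightarrow> complex) \<Rightarrow> int \<Rightarrow> nat \<Rightarrow> 'k \<Rightarrow> complex" where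
  "wavelet_hat f j k \<xi> = of_real (real q powr (- of_int j / 2)) *
     (cnj (chi_n K k (\<pp> powi j * \<xi>)) * f (\<pp> powi j * \<xi>))"

lemma square_integrable_wavelet:
  assumes "square_integrable \<mu> f"
  shows "square_integrable \<mu> (wavelet K f j k)" "l2norm \<mu> (wavelet K f j k) = l2norm \<mu> f"
  using dilation_isometry[OF assms, of "\<lambda>_. 1" "- j" "- u k"]
  by (simp_all add: wavelet_def[abs_def])

lemma chi_n_measurable [measurable]: "chi_n K k \<in> borel_measurable borel"
  unfolding chi_n_def[abs_def] by measurable

lemma square_integrable_wavelet_hat:
  assumes "square_integrable \<mu> f"
  shows "square_integrable \<mu> (wavelet_hat f j k)" "l2norm \<mu> (wavelet_hat f j k) = l2norm \<mu> f"
proof -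
  have m: "(\<lambda>\<xi>. cnj (chi_n K k (\<pp> powi j * \<xi>))) \<in> borel_measurable borel"
    unfolding chi_n_def mult.assoc[symmetric] by measurable
  show "square_integrable \<mu> (wavelet_hat f j k)" "l2norm \<mu> (wavelet_hat f j k) = l2norm \<mu> f"
    using dilation_isometry[OF assms m, of j 0]
    by (simp_all add: wavelet_hat_def[abs_def] chi_n_def chi_norm)
qed

lemma fourier_int_wavelet:
  assumes F: "integrable \<mu> F"
  shows "fourier_int K (wavelet K F j k) \<xi> = wavelet_hat (fourier_int K F) j k \<xi>"
proof -
  have [measurable]: "F \<in> borel_measurable borel"
    using borel_measurable_integrable[OF F] by simp
  let ?s = "complex_of_real (real q powr (of_int j / 2))"
  define G where "G y = ?s * cnj (chi K (u k * (\<pp> powi j * \<xi>))) * (F y * chi K (- (\<pp> powi j * \<xi>) * y))" for y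
  have [measurable]: "G \<in> borel_measurable borel"
    unfolding G_def by measurable
  have "wavelet K F j k x * chi K (- \<xi> * x) = G (\<pp> powi (- j) * x + - u k)" for x
  proof -
    have "- \<xi> * x = - (\<pp> powi j * \<xi>) * (\<pp> powi (- j) * x + - u k) - u k * (\<pp> powi j * \<xi>)"
      by (simp add: algebra_simps power_int_minus)
    then have "chi K (- \<xi> * x) = chi K (- (\<pp> powi j * \<xi>) * (\<pp> powi (- j) * x + - u k)) *
        cnj (chi K (u k * (\<pp> powi j * \<xi>)))"
      by (simp only: chi_diff)
    then show ?thesis
      by (simp only: wavelet_def G_def diff_conv_add_uminus mult_ac)
  qed
  then have "fourier_int K (wavelet K F j k) \<xi> = (\<integral>x. G (\<pp> powi (- j) * x + - u k) \<partial>\<mu>)"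
    unfolding fourier_int_eq by simp
  also have "\<dots> = real q powi (- j) *\<^sub>R (\<integral>x. G x \<partial>\<mu>)"
    by (rule integral_affine) measurable
  also have "(\<integral>x. G x \<partial>\<mu>) = ?s * cnj (chi K (u k * (\<pp> powi j * \<xi>))) * fourier_int K F (\<pp> powi j * \<xi>)"
    unfolding G_def fourier_int_eq by simp
  also have "real q powi (- j) *\<^sub>R (?s * cnj (chi K (u k * (\<pp> powi j * \<xi>))) * fourier_int K F (\<pp> powi j * \<xi>))
      = of_real (real q powi (- j) * real q powr (of_int j / 2)) *
        (cnj (chi K (u k * (\<pp> powi j * \<xi>))) * fourier_int K F (\<pp> powi j * \<xi>))"
    by (simp only: scaleR_conv_of_real of_real_mult mult.assoc)
  also have "real q powi (- j) * real q powr (of_int j / 2) = real q powr (- of_int j / 2)"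
  proof -
    have "real q powi (- j) = real q powr (- of_int j)"
      using powr_real_of_int'[of "real q" "- j"] by simp
    then show ?thesis
      by (simp flip: powr_add)
  qed
  finally show ?thesis
    by (simp add: wavelet_hat_def chi_n_def)
qed

lemma wavelet_diff: "wavelet K (\<lambda>x. f x - g x) j k = (\<lambda>x. wavelet K f j k x - wavelet K g j k x)"
  by (simp add: wavelet_def[abs_def] right_diff_distrib)

lemma wavelet_hat_diff:
  "wavelet_hat (\<lambda>x. f x - g x) j k = (\<lambda>x. wavelet_hat f j k x - wavelet_hat g j k x)"
  by (simp add: wavelet_hat_def[abs_def] right_diff_distrib)

lemma is_L2_fourier_wavelet:
  assumes f: "square_integrable \<mu> f" and f': "is_L2_fourier K f f'"
  shows "is_L2_fourier K (wavelet K f j k) (wavelet_hat f' j k)"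
proof -
  obtain F where F: "\<And>n. integrable \<mu> (F n)" "\<And>n. square_integrable \<mu> (F n)"
    "(\<lambda>n. l2norm \<mu> (\<lambda>x. F n x - f x)) \<longlonglongrightarrow> 0"
    "(\<lambda>n. l2norm \<mu> (\<lambda>\<xi>. fourier_int K (F n) \<xi> - f' \<xi>)) \<longlonglongrightarrow> 0" and f2: "square_integrable \<mu> f'"
    using f' unfolding is_L2_fourier_iff[OF f] by blast
  have int: "integrable \<mu> (wavelet K (F n) j k)" for n
    unfolding wavelet_def[abs_def] diff_conv_add_uminus
    using borel_measurable_integrable[OF F(1)[of n]] F(1)[of n]
    by (intro integrable_mult_right) (simp add: integrable_affine_iff del: add_uminus_conv_diff)
  have "l2norm \<mu> (\<lambda>x. wavelet K (F n) j k x - wavelet K f j k x) = l2norm \<mu> (\<lambda>x. F n x - f x)" for n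
    unfolding wavelet_diff[symmetric]
    by (intro square_integrable_wavelet(2) square_integrable_diff F f)
  moreover have "l2norm \<mu> (\<lambda>\<xi>. fourier_int K (wavelet K (F n) j k) \<xi> - wavelet_hat f' j k \<xi>)
      = l2norm \<mu> (\<lambda>\<xi>. fourier_int K (F n) \<xi> - f' \<xi>)" for n
    unfolding fourier_int_wavelet[OF F(1), abs_def] wavelet_hat_diff[symmetric]
    by (intro square_integrable_wavelet_hat(2) square_integrable_diff Plancherel(1) F f2)
  ultimately show ?thesis
    unfolding is_L2_fourier_iff[OF square_integrable_wavelet(1)[OF f]]
    using F int square_integrable_wavelet(1)[OF F(2)] square_integrable_wavelet_hat(1)[OF f2]
    by (intro conjI exI[of _ "\<lambda>n. wavelet K (F n) j k"] allI) simp_all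
qed

lemma l2_inner_wavelet:
  assumes "square_integrable \<mu> f" "square_integrable \<mu> g"
  shows "l2_inner K f (wavelet K g j k) = l2_inner K (fourier K f) (wavelet_hat (fourier K g) j k)"
  by (intro Parseval is_L2_fourier_fourier is_L2_fourier_wavelet square_integrable_wavelet(1) assms)

lemma square_integrable_fourier:
  assumes "square_integrable \<mu> f"
  shows "square_integrable \<mu> (fourier K f)" "l2norm \<mu> (fourier K f) = l2norm \<mu> f"
  using is_L2_fourier_square_integrable[OF is_L2_fourier_fourier[OF assms]]
    l2norm_is_L2_fourier[OF assms is_L2_fourier_fourier[OF assms]] by auto

text \<open>Moving the dilation to the other side of the inner product leaves a coefficient at scale 0.\<close>

lemma l2_inner_wavelet_hat:
  assumes [measurable]: "h \<in> borel_measurable borel" "f \<in> borel_measurable borel"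
  shows "l2_inner K h (wavelet_hat f j k) = (\<integral>\<xi>. dilate j h \<xi> * cnj (f \<xi>) * chi_n K k \<xi> \<partial>\<mu>)"
proof -
  define t where "t = complex_of_real (real q powr (- of_int j / 2))"
  define G where "G y = t * (h (\<pp> powi (- j) * y) * cnj (f y) * chi_n K k y)" for y
  have [measurable]: "G \<in> borel_measurable borel"
    unfolding G_def by measurable
  have "h \<xi> * cnj (wavelet_hat f j k \<xi>) = G (\<pp> powi j * \<xi> + 0)" for \<xi>
    by (simp add: wavelet_hat_def G_def t_def power_int_minus mult_ac)
  then have "l2_inner K h (wavelet_hat f j k) = (\<integral>\<xi>. G (\<pp> powi j * \<xi> + 0) \<partial>\<mu>)"
    by (simp only: l2_inner_def)
  also have "\<dots> = real q powi j *\<^sub>R (\<integral>\<xi>. G \<xi> \<partial>\<mu>)"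
    by (rule integral_affine) measurable
  also have "\<dots> = (\<integral>\<xi>. real q powi j *\<^sub>R G \<xi> \<partial>\<mu>)"
    by simp
  also have "\<dots> = (\<integral>\<xi>. dilate j h \<xi> * cnj (f \<xi>) * chi_n K k \<xi> \<partial>\<mu>)"
  proof (intro Bochner_Integration.integral_cong refl)
    fix y
    have "real q powi j * real q powr (- of_int j / 2) = real q powr (of_int j / 2)"
    proof -
      have "real q powi j = real q powr of_int j"
        using powr_real_of_int'[of "real q" j] by simp
      then show ?thesis by (simp flip: powr_add)
    qed
    then have "of_real (real q powi j) * t = of_real (real q powr (of_int j / 2))"
      unfolding t_def of_real_mult[symmetric] by (rule arg_cong)
    then show "real q powi j *\<^sub>R G y = dilate j h y * cnj (f y) * chi_n K k y"
      unfolding G_def dilate_def scaleR_conv_of_real by (simp only: mult.assoc[symmetric])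
  qed
  finally show ?thesis .
qed

section \<open>Fourier series on the ring of integers\<close>

text \<open>The transform of a function supported in \<open>\<DD>\<close> is constant on the cosets of \<open>\<DD>\<close>, and its values at
  the \<open>u(k)\<close> are the Fourier coefficients; so the Plancherel theorem becomes a sum over cosets. The
  conjugate of \<open>P\<close> is transformed because the coefficients here carry \<open>\<chi>\<^sub>k\<close> rather than its conjugate.\<close>

theorem Parseval_series:
  assumes P: "square_integrable \<mu> P" and supp: "\<And>x. x \<notin> disc 0 \<Longrightarrow> P x = 0"
  shows "(\<Sum>k. ennreal ((cmod (\<integral>x. P x * chi_n K k x \<partial>\<mu>))\<^sup>2)) = ennreal ((l2norm \<mu> P)\<^sup>2)"
proof -
  define Q where "Q x = cnj (P x)" for x
  have Q: "square_integrable \<mu> Q" and l2Q: "l2norm \<mu> Q = l2norm \<mu> P" and suppQ: "\<And>x. x \<notin> disc (int 0) \<Longrightarrow> Q x = 0"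
    using square_integrable_cnj[OF P] supp by (auto simp: Q_def[abs_def] l2norm_def)
  have Pl: "square_integrable \<mu> (fourier_int K Q)" "l2norm \<mu> (fourier_int K Q) = l2norm \<mu> P"
    using Plancherel_disc[of Q 0] Q suppQ l2Q by simp_all
  have [measurable]: "fourier_int K Q \<in> borel_measurable borel"
    using square_integrable_measurable[OF Pl(1)] by simp
  have const: "fourier_int K Q (\<xi> + u k) = fourier_int K Q (u k)" if "\<xi> \<in> disc 0" for \<xi> k
    unfolding fourier_int_eq
  proof (intro Bochner_Integration.integral_cong refl)
    fix x
    show "Q x * chi K (- (\<xi> + u k) * x) = Q x * chi K (- u k * x)"
    proof (cases "x \<in> disc 0")
      case True
      have "chi K (\<xi> * x) = 1"
        using disc_mult[OF that True] by (simp add: chi_disc_0)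
      then show ?thesis
        by (simp add: left_diff_distrib chi_minus chi_diff)
    qed (use suppQ in simp)
  qed
  have coeff: "fourier_int K Q (u k) = cnj (\<integral>x. P x * chi_n K k x \<partial>\<mu>)" for k
  proof -
    have "fourier_int K Q (u k) = (\<integral>x. cnj (P x * chi_n K k x) \<partial>\<mu>)"
      unfolding fourier_int_eq by (simp add: Q_def chi_n_def chi_minus)
    also have "\<dots> = cnj (\<integral>x. P x * chi_n K k x \<partial>\<mu>)"
      by (rule integral_bounded_linear'[OF bounded_linear_cnj bounded_linear_cnj]) simp
    finally show ?thesis .
  qed
  have "ennreal ((l2norm \<mu> P)\<^sup>2) = (\<integral>\<^sup>+\<xi>. ennreal ((cmod (fourier_int K Q \<xi>))\<^sup>2) \<partial>\<mu>)"
    using nn_integral_cmod_power2[OF Pl(1)] Pl(2) by simp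
  also have "\<dots> = (\<Sum>k. \<integral>\<^sup>+\<xi>. indicator (disc 0) \<xi> * ennreal ((cmod (fourier_int K Q (\<xi> + u k)))\<^sup>2) \<partial>\<mu>)"
    by (rule nn_integral_eq_suminf_disc) measurable
  also have "\<dots> = (\<Sum>k. ennreal ((cmod (fourier_int K Q (u k)))\<^sup>2))"
  proof (intro suminf_cong)
    fix k
    have "(\<integral>\<^sup>+\<xi>. indicator (disc 0) \<xi> * ennreal ((cmod (fourier_int K Q (\<xi> + u k)))\<^sup>2) \<partial>\<mu>)
        = (\<integral>\<^sup>+\<xi>. ennreal ((cmod (fourier_int K Q (u k)))\<^sup>2) * indicator (disc 0) \<xi> \<partial>\<mu>)"
      by (intro nn_integral_cong) (simp add: indicator_def const)
    also have "\<dots> = ennreal ((cmod (fourier_int K Q (u k)))\<^sup>2)"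
      by (subst nn_integral_cmult_indicator) (simp_all add: haar_sets)
    finally show "(\<integral>\<^sup>+\<xi>. indicator (disc 0) \<xi> * ennreal ((cmod (fourier_int K Q (\<xi> + u k)))\<^sup>2) \<partial>\<mu>)
        = ennreal ((cmod (fourier_int K Q (u k)))\<^sup>2)" .
  qed
  finally show ?thesis by (simp add: coeff)
qed

section \<open>Brackets and energies\<close>

text \<open>For such \<open>h\<close> the brackets below are finite sums, and they are square-integrable for every
  square-integrable second argument.\<close>

definition tame :: "nat \<Rightarrow> ('k \<Rightarrow> complex) \<Rightarrow> bool" where
  "tame N h \<longleftrightarrow> h \<in> borel_measurable borel \<and> (\<exists>C. \<forall>\<xi>. cmod (h \<xi>) \<le> C) \<and>
     (\<forall>\<xi>. \<xi> \<notin> disc (int N) \<longrightarrow> h \<xi> = 0)"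

lemma tame_measurable [measurable_dest]: "tame N h \<Longrightarrow> h \<in> borel_measurable borel"
  by (simp add: tame_def)

lemma tame_mono: "tame N h \<Longrightarrow> N \<le> N' \<Longrightarrow> tame N' h"
  using disc_mono'[of _ "int N" "int N'"] by (auto simp: tame_def)

lemma tame_square_integrable: "tame N h \<Longrightarrow> square_integrable \<mu> h"
  unfolding tame_def using square_integrable_bounded by blast

text \<open>The bracket product of \<open>h\<close> and \<open>w\<close>, cut off to \<open>\<DD>\<close>. If \<open>h\<close> vanishes outside the disc of radius
  \<open>q\<^sup>N\<close>, translates by \<open>u(n)\<close> with \<open>n \<ge> q\<^sup>N\<close> do not contribute.\<close>

definition bracket :: "nat \<Rightarrow> ('k \<Rightarrow> complex) \<Rightarrow> ('k \<Rightarrow> complex) \<Rightarrow> 'k \<Rightarrow> complex" where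
  "bracket N h w \<xi> = indicator (disc 0) \<xi> * (\<Sum>n<q ^ N. h (\<xi> + u n) * cnj (w (\<xi> + u n)))"

definition energy :: "('k \<Rightarrow> complex) \<Rightarrow> ('k \<Rightarrow> complex) \<Rightarrow> ennreal" where
  "energy h w = (\<Sum>k. ennreal ((cmod (\<integral>\<xi>. h \<xi> * cnj (w \<xi>) * chi_n K k \<xi> \<partial>\<mu>))\<^sup>2))"

lemma square_integrable_translate:
  assumes "square_integrable \<mu> f" shows "square_integrable \<mu> (\<lambda>x. f (x + a))"
  using dilation_isometry(1)[OF assms, of "\<lambda>_. 1" 0 a] by simp

text \<open>Folding the integral over \<open>K\<close> into \<open>\<DD>\<close> identifies the coefficients with Fourier coefficients of the
  bracket, because \<open>\<chi>\<^sub>k\<close> is invariant under translation by \<open>u(n)\<close>.\<close>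

lemma energy_eq_bracket:
  assumes h: "tame N h" and w: "square_integrable \<mu> w"
  shows "energy h w = (\<integral>\<^sup>+\<xi>. ennreal ((cmod (bracket N h w \<xi>))\<^sup>2) \<partial>\<mu>)"
proof -
  have [measurable]: "w \<in> borel_measurable borel" "h \<in> borel_measurable borel"
    using w h by (auto simp: square_integrable_def tame_def)
  obtain C where C: "\<And>\<xi>. cmod (h \<xi>) \<le> C"
    using h by (auto simp: tame_def)
  have si: "square_integrable \<mu> (\<lambda>\<xi>. indicator (disc 0) \<xi> * (h (\<xi> + u n) * cnj (w (\<xi> + u n))))" for n
  proof (rule square_integrable_bound[OF square_integrable_translate[OF w], where c = C])
    show "AE x in \<mu>. cmod (indicator (disc 0) x * (h (x + u n) * cnj (w (x + u n)))) \<le> C * cmod (w (x + u n))"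
      using C order_trans[OF norm_ge_zero C]
      by (intro AE_I2) (auto simp: norm_mult indicator_def intro!: mult_right_mono)
    show "(\<lambda>x. indicator (disc 0) x * (h (x + u n) * cnj (w (x + u n)))) \<in> borel_measurable \<mu>"
      unfolding measurable_haar by measurable
  qed
  have P: "square_integrable \<mu> (bracket N h w)"
    unfolding bracket_def[abs_def] sum_distrib_left by (intro square_integrable_sum si)
  have coeff: "(\<integral>\<xi>. h \<xi> * cnj (w \<xi>) * chi_n K k \<xi> \<partial>\<mu>) = (\<integral>\<xi>. bracket N h w \<xi> * chi_n K k \<xi> \<partial>\<mu>)" for k
  proof -
    have "integrable \<mu> (\<lambda>\<xi>. (h \<xi> * cnj (w \<xi>)) * chi K (u k * \<xi>))"
      by (intro integrable_mult_chi integrable_mult_cnj(1) tame_square_integrable[OF h] w)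
    then have "(\<integral>\<xi>. h \<xi> * cnj (w \<xi>) * chi_n K k \<xi> \<partial>\<mu>)
        = (\<integral>\<xi>. indicator (disc 0) \<xi> *\<^sub>R (\<Sum>n<q ^ N. h (\<xi> + u n) * cnj (w (\<xi> + u n)) * chi_n K k (\<xi> + u n)) \<partial>\<mu>)"
      using h by (intro integral_disc_eq_sum) (auto simp: tame_def chi_n_def)
    also have "\<dots> = (\<integral>\<xi>. bracket N h w \<xi> * chi_n K k \<xi> \<partial>\<mu>)"
      by (intro Bochner_Integration.integral_cong refl)
         (simp add: bracket_def indicator_def flip: sum_distrib_right)
    finally show ?thesis .
  qed
  show ?thesis
    unfolding energy_def coeff nn_integral_cmod_power2[OF P]
    by (rule Parseval_series[OF P]) (simp add: bracket_def)
qed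

lemma dilate_dilate: "dilate i (dilate j h) = dilate (i + j) h"
proof
  fix x
  have "\<pp> powi (- (i + j)) * x = \<pp> powi (- j) * (\<pp> powi (- i) * x)"
    by (simp only: minus_add_distrib power_int_add prm_neq_0 simp_thms mult_ac)
  moreover have "real q powr (of_int (i + j) / 2) = real q powr (of_int i / 2) * real q powr (of_int j / 2)"
    by (simp add: add_divide_distrib powr_add)
  ultimately show "dilate i (dilate j h) x = dilate (i + j) h x"
    by (simp only: dilate_def of_real_mult mult.assoc)
qed

lemma dilate_0 [simp]: "dilate 0 h = h"
  by (simp add: dilate_def[abs_def])

lemma dilate_measurable [measurable]:
  assumes [measurable]: "h \<in> borel_measurable borel" shows "dilate j h \<in> borel_measurable borel"
  unfolding dilate_def[abs_def] by measurable

lemma tame_dilate: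
  assumes h: "tame N h" and "int N - j \<le> int N'"
  shows "tame N' (dilate j h)"
proof -
  have [measurable]: "h \<in> borel_measurable borel" using h by (simp add: tame_def)
  obtain C where C: "\<And>\<xi>. cmod (h \<xi>) \<le> C"
    using h by (auto simp: tame_def)
  have "cmod (dilate j h \<xi>) \<le> real q powr (of_int j / 2) * C" for \<xi>
    unfolding dilate_def norm_mult by (intro mult_mono C) auto
  moreover have "dilate j h \<xi> = 0" if "\<xi> \<notin> disc (int N')" for \<xi>
  proof -
    have "\<xi> \<notin> disc (int N - j)" using that disc_mono'[OF _ assms(2)] by blast
    then show ?thesis using h by (simp add: dilate_def tame_def)
  qed
  moreover have "dilate j h \<in> borel_measurable borel" by measurable
  ultimately show ?thesis unfolding tame_def by blast
qed

text \<open>The differences of the first \<open>q\<close> representatives are again among them, since the span of the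
  \<open>\<zeta>\<^sub>i\<close> is a field.\<close>

lemma u_diff:
  assumes "b < q" "b' < q"
  obtains c where "c < q" "u b' - u b = u c" "c = 0 \<longleftrightarrow> b = b'"
proof -
  have "digit_value b \<in> zeta_span K" "digit_value b' \<in> zeta_span K"
    using assms digit_value_image by blast+
  then have "digit_value b' - digit_value b \<in> zeta_span K"
    using zeta_span_subfield by (simp add: is_subfield_def)
  then obtain c where c: "c < q" "digit_value b' - digit_value b = digit_value c"
    by (auto simp flip: digit_value_image)
  have eq: "u b' - u b = u c"
    using assms c by (simp add: u_less_q flip: right_diff_distrib)
  moreover have "c = 0 \<longleftrightarrow> b = b'"
    using eq u_separated[of b' b] u_separated[of c 0] by auto
  ultimately show ?thesis using that c(1) by blast
qed

lemma AE_neq_0: "AE x in \<mu>. x \<noteq> 0"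
proof -
  have "emeasure \<mu> {0} \<le> 0"
  proof (rule LIMSEQ_le_const)
    have "(\<lambda>n. (1 / real q) ^ n) \<longlonglongrightarrow> 0"
      using q_ge_2 by (intro LIMSEQ_power_zero) simp
    then have "(\<lambda>n. ennreal ((1 / real q) ^ n)) \<longlonglongrightarrow> ennreal 0"
      by (rule tendsto_ennrealI)
    then show "(\<lambda>n. emeasure \<mu> (disc (- int n))) \<longlonglongrightarrow> 0"
      by (simp add: power_int_minus power_one_over inverse_eq_divide)
    have "emeasure \<mu> {0} \<le> emeasure \<mu> (disc (- int n))" for n
      by (rule emeasure_mono) (auto simp: haar_sets)
    then show "\<exists>N. \<forall>n\<ge>N. emeasure \<mu> {0} \<le> emeasure \<mu> (disc (- int n))" by blast
  qed
  then have "{0} \<in> null_sets \<mu>" by (auto simp: null_sets_def haar_sets)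
  then show ?thesis by (rule AE_I') auto
qed

lemma l2_inner_diff_left:
  assumes "square_integrable \<mu> f" "square_integrable \<mu> g" "square_integrable \<mu> w"
  shows "l2_inner K (\<lambda>x. f x - g x) w = l2_inner K f w - l2_inner K g w"
  unfolding l2_inner_def left_diff_distrib
  by (intro Bochner_Integration.integral_diff integrable_mult_cnj(1) assms)

text \<open>Truncation to an annulus and to bounded values converges almost everywhere, the origin being a
  null set.\<close>

lemma tame_approximation:
  assumes h: "square_integrable \<mu> h"
  obtains v where "\<And>n. tame n (v n)" "\<And>n \<xi>. \<xi> \<in> disc (- int n) \<Longrightarrow> v n \<xi> = 0"
    "(\<lambda>n. l2norm \<mu> (\<lambda>x. v n x - h x)) \<longlonglongrightarrow> 0"
proof
  have [measurable]: "h \<in> borel_measurable borel" using h by (simp add: square_integrable_def)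
  let ?S = "\<lambda>n::nat. {x. cmod (h x) \<le> real n} \<inter> (disc (int n) - disc (- int n))"
  let ?v = "\<lambda>n x. indicator (?S n) x * h x"
  have vm: "?v n \<in> borel_measurable borel" for n
    by measurable
  show "tame n (?v n)" for n
    unfolding tame_def using vm by (auto simp: indicator_def intro!: exI[of _ "real n"])
  show "\<xi> \<in> disc (- int n) \<Longrightarrow> ?v n \<xi> = 0" for n \<xi>
    by (simp add: indicator_def)
  show "(\<lambda>n. l2norm \<mu> (\<lambda>x. ?v n x - h x)) \<longlonglongrightarrow> 0"
  proof (rule l2_dominated_convergence[OF h, where c = 1])
    show "?v n \<in> borel_measurable \<mu>" for n using vm by simp
    show "AE x in \<mu>. cmod (?v n x) \<le> 1 * cmod (h x)" for n
      by (rule AE_I2) (simp add: indicator_def)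
    show "AE x in \<mu>. (\<lambda>n. ?v n x) \<longlonglongrightarrow> h x"
      using AE_neq_0
    proof eventually_elim
      case (elim x)
      obtain n1 :: nat where n1: "x \<in> disc (int n1)" using ex_disc by blast
      obtain n2 :: nat where n2: "x \<notin> disc (- int n2)" using ex_not_disc[OF elim] by blast
      obtain n3 :: nat where n3: "cmod (h x) \<le> real n3" using real_arch_simple by blast
      have "?v n x = h x" if "n \<ge> n1 + n2 + n3" for n
      proof -
        have "x \<in> disc (int n)" by (rule disc_mono'[OF n1]) (use that in simp)
        moreover have "x \<notin> disc (- int n)"
          using n2 disc_mono'[of x "- int n" "- int n2"] that by auto
        ultimately show ?thesis using n3 that by (simp add: indicator_def)
      qed
      then show ?case
        by (intro tendsto_eventually) (auto simp: eventually_sequentially)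
    qed
  qed
qed

section \<open>Masks and refinable functions\<close>

text \<open>The partial sums of the series are exactly periodic, and on every coset of \<open>\<DD>\<close> the mask is their
  \<open>L\<^sup>2\<close> limit.\<close>

lemma mask_periodic_AE:
  assumes "is_mask K m"
  shows "AE \<xi> in \<mu>. \<forall>j. m (\<xi> + u j) = m \<xi>"
proof -
  have [measurable]: "m \<in> borel_measurable borel"
    using assms by (simp add: is_mask_def)
  obtain d where d: "\<And>a. (\<lambda>n. \<integral>\<^sup>+\<xi>\<in>{\<xi>. \<xi> - a \<in> int_ring}.
       ennreal ((cmod (m \<xi> - 1 / of_real (sqrt (real q)) * (\<Sum>k<n. d k * cnj (chi_n K k \<xi>))))\<^sup>2) \<partial>\<mu>) \<longlonglongrightarrow> 0"
    using assms unfolding is_mask_def by blast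
  define S where "S n \<xi> = 1 / of_real (sqrt (real q)) * (\<Sum>k<n. d k * cnj (chi_n K k \<xi>))" for n \<xi>
  have [measurable]: "S n \<in> borel_measurable borel" for n
    unfolding S_def[abs_def] by measurable
  have S_per: "S n (\<xi> + u j) = S n \<xi>" for n \<xi> j
    by (simp add: S_def)
  define E where "E n a = (\<integral>\<^sup>+\<xi>. ennreal ((cmod (m \<xi> - S n \<xi>))\<^sup>2) * indicator (coset a 0) \<xi> \<partial>\<mu>)" for n a
  have E: "(\<lambda>n. E n a) \<longlonglongrightarrow> 0" for a
  proof -
    have "{\<xi>. \<xi> - a \<in> int_ring} = coset a 0" by (auto simp: coset_def disc_0_eq)
    then show ?thesis using d[of a] by (simp add: E_def S_def)
  qed
  have zero: "AE \<xi> in \<mu>. \<xi> \<in> coset a 0 \<longrightarrow> m (\<xi> + u j) = m \<xi>" for a j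
  proof -
    let ?D = "\<integral>\<^sup>+\<xi>. ennreal ((cmod (m (\<xi> + u j) - m \<xi>))\<^sup>2) * indicator (coset a 0) \<xi> \<partial>\<mu>"
    have le: "?D \<le> 2 * E n (a + u j) + 2 * E n a" for n
    proof -
      have "(\<integral>\<^sup>+\<xi>. ennreal ((cmod (m \<xi> - S n \<xi>))\<^sup>2) * indicator (coset (a + u j) 0) \<xi> \<partial>\<mu>)
          = (\<integral>\<^sup>+\<xi>. ennreal ((cmod (m (\<xi> + u j) - S n (\<xi> + u j)))\<^sup>2) * indicator (coset (a + u j) 0) (\<xi> + u j) \<partial>\<mu>)"
        by (rule nn_integral_translate[symmetric]) measurable
      also have "\<dots> = (\<integral>\<^sup>+\<xi>. ennreal ((cmod (m (\<xi> + u j) - S n \<xi>))\<^sup>2) * indicator (coset a 0) \<xi> \<partial>\<mu>)"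
        by (intro nn_integral_cong) (simp add: S_per indicator_def)
      finally have E1: "E n (a + u j) = (\<integral>\<^sup>+\<xi>. ennreal ((cmod (m (\<xi> + u j) - S n \<xi>))\<^sup>2) * indicator (coset a 0) \<xi> \<partial>\<mu>)"
        by (simp add: E_def)
      have sq: "(cmod (x - y))\<^sup>2 \<le> 2 * (cmod (x - z))\<^sup>2 + 2 * (cmod (y - z))\<^sup>2" for x y z :: complex
      proof -
        have "cmod (x - y) \<le> cmod (x - z) + cmod (y - z)"
          using norm_triangle_ineq4[of "x - z" "y - z"] by simp
        then have "(cmod (x - y))\<^sup>2 \<le> (cmod (x - z) + cmod (y - z))\<^sup>2"
          by (intro power_mono) auto
        also have "\<dots> \<le> 2 * (cmod (x - z))\<^sup>2 + 2 * (cmod (y - z))\<^sup>2"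
          using sum_squares_bound[of "cmod (x - z)" "cmod (y - z)"] by (simp add: power2_sum)
        finally show ?thesis .
      qed
      have "?D \<le> (\<integral>\<^sup>+\<xi>. 2 * (ennreal ((cmod (m (\<xi> + u j) - S n \<xi>))\<^sup>2) * indicator (coset a 0) \<xi>)
          + 2 * (ennreal ((cmod (m \<xi> - S n \<xi>))\<^sup>2) * indicator (coset a 0) \<xi>) \<partial>\<mu>)"
      proof (intro nn_integral_mono)
        fix \<xi>
        have "ennreal ((cmod (m (\<xi> + u j) - m \<xi>))\<^sup>2)
            \<le> ennreal (2 * (cmod (m (\<xi> + u j) - S n \<xi>))\<^sup>2 + 2 * (cmod (m \<xi> - S n \<xi>))\<^sup>2)"
          by (intro ennreal_leI sq)
        also have "\<dots> = 2 * ennreal ((cmod (m (\<xi> + u j) - S n \<xi>))\<^sup>2) + 2 * ennreal ((cmod (m \<xi> - S n \<xi>))\<^sup>2)"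
          by (simp add: ennreal_plus ennreal_mult)
        finally show "ennreal ((cmod (m (\<xi> + u j) - m \<xi>))\<^sup>2) * indicator (coset a 0) \<xi>
            \<le> 2 * (ennreal ((cmod (m (\<xi> + u j) - S n \<xi>))\<^sup>2) * indicator (coset a 0) \<xi>)
          + 2 * (ennreal ((cmod (m \<xi> - S n \<xi>))\<^sup>2) * indicator (coset a 0) \<xi>)"
          by (simp add: indicator_def)
      qed
      also have "\<dots> = 2 * E n (a + u j) + 2 * E n a"
        unfolding E1 unfolding E_def
        by (subst nn_integral_add) (simp_all add: nn_integral_cmult)
      finally show ?thesis .
    qed
    have "(\<lambda>n. 2 * E n (a + u j) + 2 * E n a) \<longlonglongrightarrow> 2 * 0 + 2 * 0"
      by (intro tendsto_add ennreal_tendsto_cmult E) auto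
    then have "?D \<le> 0"
      using le by (intro LIMSEQ_le_const) auto
    then have "?D = 0" by simp
    then have "AE \<xi> in \<mu>. ennreal ((cmod (m (\<xi> + u j) - m \<xi>))\<^sup>2) * indicator (coset a 0) \<xi> = 0"
      by (subst (asm) nn_integral_0_iff_AE) simp_all
    then show ?thesis
      by eventually_elim (auto simp: indicator_def split: if_splits)
  qed
  have "AE \<xi> in \<mu>. \<forall>i. \<forall>j. \<xi> \<in> coset (u i) 0 \<longrightarrow> m (\<xi> + u j) = m \<xi>"
    unfolding AE_all_countable using zero by blast
  then show ?thesis
  proof eventually_elim
    case (elim \<xi>)
    obtain N :: nat where "\<xi> \<in> disc (int N)" using ex_disc by blast
    then obtain i where "\<xi> - u i \<in> disc 0" using u_cover by blast
    then show ?case using elim[rule_format, of i] by simp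
  qed
qed

lemma compactly_supported_disc:
  assumes "compactly_supported K f"
  obtains n :: nat where "AE x in \<mu>. x \<notin> disc (int n) \<longrightarrow> f x = 0"
proof -
  obtain C where C: "compact C" "AE x in \<mu>. x \<notin> C \<longrightarrow> f x = 0"
    using assms by (auto simp: compactly_supported_def)
  obtain e where e: "\<And>x. x \<in> C \<Longrightarrow> dist 0 x \<le> e"
    using compact_imp_bounded[OF C(1)] by (auto simp: bounded_any_center[where a = 0])
  obtain n :: nat where "e < real q powi int n"
    using q_powi_unbounded by blast
  then have "C \<subseteq> disc (int n)"
    using e by (auto simp: disc_def dist_eq_absv dest!: e)
  then have "AE x in \<mu>. x \<notin> disc (int n) \<longrightarrow> f x = 0"
    using C(2) by (auto elim!: eventually_mono)
  then show ?thesis by (rule that)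
qed

text \<open>If \<open>f\<close> lives in the disc of radius \<open>q\<^sup>n\<close>, then \<open>\<chi>(\<xi>x) = 1\<close> on its support for \<open>|\<xi>| \<le> q\<^sup>-\<^sup>n\<close>. Thus the
  value of the transform at 0 is taken on a neighbourhood of 0.\<close>

lemma fourier_compactly_supported:
  assumes f: "square_integrable \<mu> f" and supp: "compactly_supported K f"
  shows "\<exists>n::nat. \<forall>\<xi>\<in>disc (- int n). fourier K f \<xi> = fourier K f 0"
proof -
  obtain n :: nat where n: "AE x in \<mu>. x \<notin> disc (int n) \<longrightarrow> f x = 0"
    by (rule compactly_supported_disc[OF supp])
  have [measurable]: "f \<in> borel_measurable borel" using f by (simp add: square_integrable_def)
  have "AE x in \<mu>. indicator (disc (int n)) x * f x = f x"
    using n by eventually_elim (auto simp: indicator_def)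
  then have "integrable \<mu> f"
    using integrable_cong_AE[of "\<lambda>x. indicator (disc (int n)) x * f x" \<mu> f] truncate_disc(2)[OF f, of "int n"]
    by simp
  then have eq: "fourier K f = fourier_int K f"
    by (simp add: fourier_def)
  have "fourier_int K f \<xi> = fourier_int K f 0" if "\<xi> \<in> disc (- int n)" for \<xi>
    unfolding fourier_int_eq
  proof (rule integral_cong_AE)
    show "AE x in \<mu>. f x * chi K (- \<xi> * x) = f x * chi K (- 0 * x)"
      using n
    proof eventually_elim
      case (elim x)
      show ?case
      proof (cases "x \<in> disc (int n)")
        case True
        have "chi K (\<xi> * x) = 1"
          using disc_mult[OF that True] by (simp add: chi_disc_0)
        then show ?thesis by (simp add: chi_minus)
      qed (use elim in simp)
    qed
  qed (unfold measurable_haar, measurable)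
  then show ?thesis unfolding eq by blast
qed

lemma char_poly_fun_periodic: "char_poly_fun K a \<Longrightarrow> a (\<xi> + u n) = a \<xi>"
  by (auto simp: char_poly_fun_def)

section \<open>Frame expansions\<close>

text \<open>Translates \<open>L\<^sup>2\<close> norms for counting measure into unordered sums.\<close>

lemma infsum_cmod_power2:
  assumes "square_integrable (count_space I) c"
  shows "((\<lambda>i. (cmod (c i))\<^sup>2) has_sum (l2norm (count_space I) c)\<^sup>2) I"
    and "(\<Sum>\<^sub>\<infinity>i\<in>I. ennreal ((cmod (c i))\<^sup>2)) = ennreal ((l2norm (count_space I) c)\<^sup>2)"
proof -
  let ?f = "\<lambda>i. (cmod (c i))\<^sup>2"
  have abs: "Infinite_Set_Sum.abs_summable_on ?f I"
    using square_integrable_integrable[OF assms] by (simp add: abs_summable_on_def)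
  then have summ: "?f summable_on I"
    using abs_summable_equivalent abs_summable_summable by blast
  have eq: "infsum ?f I = (l2norm (count_space I) c)\<^sup>2"
    using infsetsum_infsum[OF abs] by (simp add: infsetsum_def l2norm_power2)
  show "(?f has_sum (l2norm (count_space I) c)\<^sup>2) I"
    using summ unfolding eq[symmetric] by (rule has_sum_infsum)
  have "(\<Sum>\<^sub>\<infinity>i\<in>I. ennreal (?f i)) = (SUP F\<in>{F. finite F \<and> F \<subseteq> I}. \<Sum>i\<in>F. ennreal (?f i))"
    by (rule nonneg_infsum_complete) simp
  also have "\<dots> = (SUP F\<in>{F. finite F \<and> F \<subseteq> I}. ennreal (sum ?f F))"
    by (intro SUP_cong refl sum_ennreal) simp
  also have "\<dots> = ennreal (infsum ?f I)"
    by (rule infsum_nonneg_is_SUPREMUM_ennreal[OF summ, symmetric]) simp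
  finally show "(\<Sum>\<^sub>\<infinity>i\<in>I. ennreal (?f i)) = ennreal ((l2norm (count_space I) c)\<^sup>2)"
    unfolding eq .
qed

definition analysis :: "(nat \<Rightarrow> 'k \<Rightarrow> complex) \<Rightarrow> ('k \<Rightarrow> complex) \<Rightarrow> nat \<times> int \<times> nat \<Rightarrow> complex" where
  "analysis \<Psi> f = (\<lambda>(l, j, k). l2_inner K f (wavelet K (\<Psi> l) j k))"

lemma tight_wavelet_frame:
  assumes \<Psi>: "\<And>l. l \<in> {1..M} \<Longrightarrow> square_integrable \<mu> (\<Psi> l)"
    and tight: "\<And>f. square_integrable \<mu> f \<Longrightarrow> square_integrable (count_space (wavelet_index M)) (analysis \<Psi> f) \<and>
      l2norm (count_space (wavelet_index M)) (analysis \<Psi> f) = l2norm \<mu> f"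
  shows "wavelet_frame K M \<Psi>"
proof -
  have "(\<Sum>\<^sub>\<infinity>(l, j, k)\<in>wavelet_index M. ennreal ((cmod (l2_inner K f (wavelet K (\<Psi> l) j k)))\<^sup>2)) = l2sq K f"
    if f: "square_integrable \<mu> f" for f
    using infsum_cmod_power2(2)[of "wavelet_index M" "analysis \<Psi> f"] tight[OF f]
    by (simp add: analysis_def l2sq_eq[OF f] case_prod_unfold)
  then show ?thesis
    unfolding wavelet_frame_def L2_iff Let_def using \<Psi>
    by (intro conjI ballI exI[of _ "1::real"]) auto
qed

lemma l2_inner_combination_left:
  assumes "square_integrable \<mu> f" "square_integrable \<mu> g" "square_integrable \<mu> w"
  shows "l2_inner K (\<lambda>x. f x + c * g x) w = l2_inner K f w + c * l2_inner K g w"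
proof -
  have "l2_inner K (\<lambda>x. f x + c * g x) w = (\<integral>x. f x * cnj (w x) + c * (g x * cnj (w x)) \<partial>\<mu>)"
    unfolding l2_inner_def by (simp only: distrib_right mult.assoc)
  then show ?thesis
    unfolding l2_inner_def using integrable_mult_cnj(1)[OF assms(1,3)] integrable_mult_cnj(1)[OF assms(2,3)] by simp
qed

lemma l2_inner_cnj: "cnj (l2_inner K f g) = l2_inner K g f"
proof -
  have "l2_inner K g f = (\<integral>x. cnj (f x * cnj (g x)) \<partial>\<mu>)"
    by (simp add: l2_inner_def mult.commute)
  also have "\<dots> = cnj (l2_inner K f g)"
    unfolding l2_inner_def by (rule integral_bounded_linear'[OF bounded_linear_cnj bounded_linear_cnj]) simp
  finally show ?thesis by simp
qed

text \<open>The pairing of the two coefficient families is sesquilinear, so if it vanishes for equal arguments,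
  it vanishes for all. For a partial sum \<open>g\<close> of the expansion, \<open>\<parallel>g\<parallel>\<^sup>2\<close> is the partial sum over the same indices of a series
  with sum 0, so it is the negative of a tail, which is bounded by \<open>\<parallel>g\<parallel>\<close> times the tail of the
  coefficients of \<open>f\<close>.\<close>

lemma mixed_expansion_tendsto_0:
  fixes M :: nat and \<Psi> \<Theta> :: "nat \<Rightarrow> 'k \<Rightarrow> complex"
  defines "I \<equiv> wavelet_index M"
  assumes \<Psi>: "\<And>l. l \<in> {1..M} \<Longrightarrow> square_integrable \<mu> (\<Psi> l)"
    and \<Theta>: "\<And>l. l \<in> {1..M} \<Longrightarrow> square_integrable \<mu> (\<Theta> l)"
    and t1: "\<And>f. square_integrable \<mu> f \<Longrightarrow> square_integrable (count_space I) (analysis \<Psi> f)"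
    and t2: "\<And>f. square_integrable \<mu> f \<Longrightarrow> square_integrable (count_space I) (analysis \<Theta> f) \<and>
      l2norm (count_space I) (analysis \<Theta> f) = l2norm \<mu> f"
    and diag: "\<And>f. square_integrable \<mu> f \<Longrightarrow> (\<integral>i. analysis \<Psi> f i * cnj (analysis \<Theta> f i) \<partial>count_space I) = 0"
    and f: "square_integrable \<mu> f"
  shows "((\<lambda>F. l2sq K (\<lambda>x. \<Sum>(l, j, k)\<in>F.
      l2_inner K f (wavelet K (\<Psi> l) j k) * wavelet K (\<Theta> l) j k x)) \<longlongrightarrow> 0) (finite_subsets_at_top I)"
proof -
  let ?C = "count_space I"
  have lin: "analysis \<Xi> (\<lambda>x. f x + c * g x) i = analysis \<Xi> f i + c * analysis \<Xi> g i"
    if "\<And>l. l \<in> {1..M} \<Longrightarrow> square_integrable \<mu> (\<Xi> l)" "square_integrable \<mu> f" "square_integrable \<mu> g" "i \<in> I"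
    for \<Xi> f g c i
    using that by (auto simp: analysis_def I_def wavelet_index_def
        intro!: l2_inner_combination_left square_integrable_wavelet)
  have B0: "(\<integral>i. analysis \<Psi> f i * cnj (analysis \<Theta> g i) \<partial>?C) = 0"
    if f: "square_integrable \<mu> f" and g: "square_integrable \<mu> g" for f g
  proof -
    define B where "B f g = (\<integral>i. analysis \<Psi> f i * cnj (analysis \<Theta> g i) \<partial>?C)" for f g
    have int: "integrable ?C (\<lambda>i. analysis \<Psi> f i * cnj (analysis \<Theta> g i))"
      if "square_integrable \<mu> f" "square_integrable \<mu> g" for f g
      using t1[OF that(1)] t2[OF that(2)] by (intro integrable_mult_cnj(1)) auto
    have "B f f + cnj w * B f g + w * B g f + w * cnj w * B g g = 0" for w
    proof -
      have fg: "square_integrable \<mu> (\<lambda>x. f x + w * g x)"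
        by (intro square_integrable_add square_integrable_scale f g)
      have "0 = (\<integral>i. analysis \<Psi> (\<lambda>x. f x + w * g x) i * cnj (analysis \<Theta> (\<lambda>x. f x + w * g x) i) \<partial>?C)"
        by (rule diag[OF fg, symmetric])
      also have "\<dots> = (\<integral>i. analysis \<Psi> f i * cnj (analysis \<Theta> f i) + cnj w * (analysis \<Psi> f i * cnj (analysis \<Theta> g i))
          + w * (analysis \<Psi> g i * cnj (analysis \<Theta> f i)) + w * cnj w * (analysis \<Psi> g i * cnj (analysis \<Theta> g i)) \<partial>?C)"
      proof (intro Bochner_Integration.integral_cong refl)
        fix i assume "i \<in> space ?C"
        then have i: "i \<in> I" by simp
        have e: "analysis \<Psi> (\<lambda>x. f x + w * g x) i = analysis \<Psi> f i + w * analysis \<Psi> g i"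
          "analysis \<Theta> (\<lambda>x. f x + w * g x) i = analysis \<Theta> f i + w * analysis \<Theta> g i"
          by (rule lin; fact \<Psi> \<Theta> f g i)+
        show "analysis \<Psi> (\<lambda>x. f x + w * g x) i * cnj (analysis \<Theta> (\<lambda>x. f x + w * g x) i)
          = analysis \<Psi> f i * cnj (analysis \<Theta> f i) + cnj w * (analysis \<Psi> f i * cnj (analysis \<Theta> g i))
          + w * (analysis \<Psi> g i * cnj (analysis \<Theta> f i)) + w * cnj w * (analysis \<Psi> g i * cnj (analysis \<Theta> g i))"
          unfolding e by (simp add: algebra_simps)
      qed
      also have "\<dots> = B f f + cnj w * B f g + w * B g f + w * cnj w * B g g"
        unfolding B_def using int f g by simp
      finally show ?thesis by simp
    qed
    from this[of 1] this[of \<i>] have "B f g + B g f = 0" "- \<i> * B f g + \<i> * B g f = 0"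
      using diag[OF f] diag[OF g] by (simp_all add: B_def)
    then have "\<i> * (B g f - B f g) = 0" by (simp add: algebra_simps)
    then have "B g f = B f g" by simp
    with \<open>B f g + B g f = 0\<close> show ?thesis by (simp add: B_def)
  qed
  define c where "c = analysis \<Psi> f"
  have c2: "square_integrable ?C c" unfolding c_def by (rule t1[OF f])
  have bound: "l2sq K (\<lambda>x. \<Sum>(l, j, k)\<in>F. l2_inner K f (wavelet K (\<Psi> l) j k) * wavelet K (\<Theta> l) j k x)
      \<le> ennreal ((l2norm ?C c)\<^sup>2 - (\<Sum>i\<in>F. (cmod (c i))\<^sup>2))" if F: "finite F" "F \<subseteq> I" for F
  proof -
    let ?w = "\<lambda>(l, j, k). wavelet K (\<Theta> l) j k"
    define g where "g x = (\<Sum>i\<in>F. c i * ?w i x)" for x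
    have w2: "square_integrable \<mu> (?w i)" if "i \<in> F" for i
      using that F(2) \<Theta> by (auto simp: I_def wavelet_index_def intro!: square_integrable_wavelet)
    have g2: "square_integrable \<mu> g"
      unfolding g_def[abs_def] by (intro square_integrable_sum square_integrable_scale w2)
    define d where "d = analysis \<Theta> g"
    have d2: "square_integrable ?C d" "l2norm ?C d = l2norm \<mu> g"
      using t2[OF g2] by (auto simp: d_def)
    have d_eq: "cnj (d i) = (\<integral>x. ?w i x * cnj (g x) \<partial>\<mu>)" for i
      by (cases i) (simp add: d_def analysis_def l2_inner_cnj, simp add: l2_inner_def)
    have "complex_of_real ((l2norm \<mu> g)\<^sup>2) = (\<integral>x. of_real ((cmod (g x))\<^sup>2) \<partial>\<mu>)"
      by (simp only: l2norm_power2 integral_complex_of_real)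
    also have "\<dots> = (\<integral>x. (\<Sum>i\<in>F. c i * (?w i x * cnj (g x))) \<partial>\<mu>)"
      by (intro Bochner_Integration.integral_cong refl)
         (simp only: complex_norm_square, subst (1) g_def, simp only: sum_distrib_right mult.assoc)
    also have "\<dots> = (\<Sum>i\<in>F. c i * cnj (d i))"
      unfolding d_eq using integrable_mult_cnj(1)[OF w2 g2]
      by (subst Bochner_Integration.integral_sum) simp_all
    finally have norm_g: "complex_of_real ((l2norm \<mu> g)\<^sup>2) = (\<Sum>i\<in>F. c i * cnj (d i))" .
    define c' where "c' i = (if i \<in> F then 0 else c i)" for i
    have c'2: "square_integrable ?C c'"
      by (rule square_integrable_bound[OF c2, where c = 1]) (auto simp: c'_def)
    have finsum: "(\<integral>i. (if i \<in> F then x i else 0) \<partial>?C) = (\<Sum>i\<in>F. x i)" for x :: "_ \<Rightarrow> 'b::{banach,second_countable_topology}"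
    proof -
      have "finite {i \<in> I. (if i \<in> F then x i else 0) \<noteq> 0}"
        by (rule finite_subset[OF _ F(1)]) auto
      then have "(\<integral>i. (if i \<in> F then x i else 0) \<partial>?C)
          = (\<Sum>i | i \<in> I \<and> (if i \<in> F then x i else 0) \<noteq> 0. if i \<in> F then x i else 0)"
        by (rule lebesgue_integral_count_space_finite_support)
      also have "\<dots> = (\<Sum>i\<in>F. x i)"
        using F by (intro sum.mono_neutral_cong_left) (auto split: if_splits)
      finally show ?thesis .
    qed
    have split: "(\<integral>i. x i \<partial>?C) = (\<integral>i. (if i \<in> F then 0 else x i) \<partial>?C) + (\<Sum>i\<in>F. x i)"
      if x: "integrable ?C x" for x :: "_ \<Rightarrow> 'b::{banach,second_countable_topology}"
    proof -
      have "integrable ?C (\<lambda>i. if i \<in> F then 0 else x i)" "integrable ?C (\<lambda>i. if i \<in> F then x i else 0)"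
        by (rule Bochner_Integration.integrable_bound[OF x]; simp)+
      then have "(\<integral>i. (if i \<in> F then 0 else x i) + (if i \<in> F then x i else 0) \<partial>?C)
          = (\<integral>i. (if i \<in> F then 0 else x i) \<partial>?C) + (\<Sum>i\<in>F. x i)"
        by (subst Bochner_Integration.integral_add) (simp_all add: finsum)
      moreover have "(if i \<in> F then 0 else x i) + (if i \<in> F then x i else 0) = x i" for i
        by simp
      ultimately show ?thesis by simp
    qed
    have "(\<integral>i. c' i * cnj (d i) \<partial>?C) = - (\<Sum>i\<in>F. c i * cnj (d i))"
    proof -
      have "(\<integral>i. (if i \<in> F then 0 else c i * cnj (d i)) \<partial>?C) = (\<integral>i. c' i * cnj (d i) \<partial>?C)"
        by (intro Bochner_Integration.integral_cong) (auto simp: c'_def)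
      then show ?thesis
        using split[OF integrable_mult_cnj(1)[OF c2 d2(1)]] B0[OF f g2]
        by (simp add: c_def d_def add_eq_0_iff)
    qed
    then have "cmod (\<Sum>i\<in>F. c i * cnj (d i)) \<le> l2norm ?C c' * l2norm \<mu> g"
      using Cauchy_Schwarz_integral[OF c'2 d2(1)] d2(2) by simp
    then have "(l2norm \<mu> g)\<^sup>2 \<le> l2norm ?C c' * l2norm \<mu> g"
      unfolding norm_g[symmetric] norm_of_real by simp
    then have "l2norm \<mu> g \<le> l2norm ?C c'"
      by (cases "l2norm \<mu> g = 0") (auto simp: power2_eq_square mult_le_cancel_right less_le)
    then have "(l2norm \<mu> g)\<^sup>2 \<le> (l2norm ?C c')\<^sup>2"
      by (intro power_mono) auto
    also have "(l2norm ?C c')\<^sup>2 = (l2norm ?C c)\<^sup>2 - (\<Sum>i\<in>F. (cmod (c i))\<^sup>2)"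
    proof -
      have "(\<integral>i. (if i \<in> F then 0 else (cmod (c i))\<^sup>2) \<partial>?C) = (l2norm ?C c')\<^sup>2"
        unfolding l2norm_power2 by (intro Bochner_Integration.integral_cong) (auto simp: c'_def)
      then show ?thesis
        using split[OF square_integrable_integrable[OF c2]] by (simp add: l2norm_power2)
    qed
    finally have "ennreal ((l2norm \<mu> g)\<^sup>2) \<le> ennreal ((l2norm ?C c)\<^sup>2 - (\<Sum>i\<in>F. (cmod (c i))\<^sup>2))"
      by (rule ennreal_leI)
    moreover have "g = (\<lambda>x. \<Sum>(l, j, k)\<in>F. l2_inner K f (wavelet K (\<Psi> l) j k) * wavelet K (\<Theta> l) j k x)"
      by (auto simp: g_def c_def analysis_def case_prod_unfold)
    ultimately show ?thesis
      using l2sq_eq[OF g2] by simp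
  qed
  have "((\<lambda>F. (l2norm ?C c)\<^sup>2 - (\<Sum>i\<in>F. (cmod (c i))\<^sup>2)) \<longlongrightarrow> (l2norm ?C c)\<^sup>2 - (l2norm ?C c)\<^sup>2) (finite_subsets_at_top I)"
    using infsum_cmod_power2(1)[OF c2] unfolding has_sum_def by (intro tendsto_diff tendsto_const)
  then have lim: "((\<lambda>F. ennreal ((l2norm ?C c)\<^sup>2 - (\<Sum>i\<in>F. (cmod (c i))\<^sup>2))) \<longlongrightarrow> 0) (finite_subsets_at_top I)"
    using tendsto_ennrealI by fastforce
  show ?thesis
    by (rule tendsto_sandwich[OF _ eventually_finite_subsets_at_top_weakI[OF bound] tendsto_const lim])
       (auto intro: always_eventually)
qed

end

section \<open>One step of the unitary extension principle\<close>

text \<open>The data of the unitary extension principle on the Fourier side: \<open>\<Phi>\<close> is the Fourier transform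
  of the refinable function.\<close>

locale uep_setting = local_field_setting K
  for K :: "('k::local_field) lf_data" +
  fixes \<Phi> :: "'k \<Rightarrow> complex" and m :: "nat \<Rightarrow> 'k \<Rightarrow> complex" and L :: nat
  assumes Phi: "square_integrable \<mu> \<Phi>"
    and Phi_near_0: "\<exists>n::nat. \<forall>\<xi>\<in>disc (- int n). \<Phi> \<xi> = 1"
    and mask_periodic: "AE \<xi> in \<mu>. \<forall>l\<le>L. \<forall>n. m l (\<xi> + u n) = m l \<xi>"
    and refinement: "AE \<xi> in \<mu>. \<Phi> \<xi> = m 0 (\<pp> * \<xi>) * \<Phi> (\<pp> * \<xi>)"
    and uep: "unitary_extension_principle K L m"
begin

text \<open>The unitary extension principle at the translate \<open>\<eta> + \<pp>u(b)\<close> involves the differences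
  \<open>u(b') - u(b)\<close>, which are again representatives.\<close>

lemma uep_columns:
  "AE \<eta> in \<mu>. \<forall>b<q. \<forall>b'<q. (\<Sum>l=0..L. cnj (m l (\<eta> + \<pp> * u b)) * m l (\<eta> + \<pp> * u b'))
     = (if b = b' then 1 else 0)"
proof -
  have "AE \<eta> in \<mu>. \<forall>k<q. (\<Sum>l=0..L. cnj (m l (\<eta> + \<pp> * u b)) * m l (\<eta> + \<pp> * u b + \<pp> * u k))
     = (if k = 0 then 1 else 0)" for b
    using AE_translate[OF uep[unfolded unitary_extension_principle_def], of "\<pp> * u b"] .
  then have "AE \<eta> in \<mu>. \<forall>b. \<forall>k<q. (\<Sum>l=0..L. cnj (m l (\<eta> + \<pp> * u b)) * m l (\<eta> + \<pp> * u b + \<pp> * u k))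
     = (if k = 0 then 1 else 0)"
    by (subst AE_all_countable) blast
  then show ?thesis
  proof eventually_elim
    case (elim \<eta>)
    show ?case
    proof (intro allI impI)
      fix b b' assume "b < q" "b' < q"
      then obtain c where c: "c < q" "u b' - u b = u c" "c = 0 \<longleftrightarrow> b = b'"
        by (rule u_diff)
      have "\<eta> + \<pp> * u b' = \<eta> + \<pp> * u b + \<pp> * u c"
        by (simp flip: c(2) add: algebra_simps)
      then show "(\<Sum>l=0..L. cnj (m l (\<eta> + \<pp> * u b)) * m l (\<eta> + \<pp> * u b')) = (if b = b' then 1 else 0)"
        using elim[rule_format, OF c(1), of b] c(3) by (simp only:)
    qed
  qed
qed

text \<open>The index set \<open>J\<close> of the masks is a parameter because the refinable function itself fits
  the same scheme: adding it as a further generator corresponds to enlarging \<open>{1..L}\<close> to \<open>{0..L}\<close>.\<close>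

definition generated :: "nat set \<Rightarrow> nat set \<Rightarrow> (nat \<Rightarrow> nat \<Rightarrow> 'k \<Rightarrow> complex) \<Rightarrow> (nat \<Rightarrow> 'k \<Rightarrow> complex) \<Rightarrow> bool" where
  "generated R J b W \<longleftrightarrow> (\<forall>r\<in>R. square_integrable \<mu> (W r)) \<and>
     (\<forall>r\<in>R. \<forall>l\<in>J. \<forall>n \<xi>. b r l (\<xi> + u n) = b r l \<xi>) \<and>
     (AE \<xi> in \<mu>. \<forall>l\<in>J. \<forall>l'\<in>J. (\<Sum>r\<in>R. cnj (b r l \<xi>) * b r l' \<xi>) = (if l = l' then 1 else 0)) \<and>
     (\<forall>r\<in>R. AE \<xi> in \<mu>. W r \<xi> = (\<Sum>l\<in>J. b r l \<xi> * (m l (\<pp> * \<xi>) * \<Phi> (\<pp> * \<xi>))))"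

text \<open>By \<open>u_rec'\<close> the sum over \<open>n = c + q k\<close> splits so that the entries of \<open>b\<close> and the masks, being
  periodic, come out of the sum over \<open>k\<close>. What remains is \<open>b\<close> applied to \<open>X\<close>, and \<open>X\<close> is the matrix of
  masks applied to the vector \<open>Q\<close> of inner sums; both matrices are isometric.\<close>

lemma bracket_generated:
  assumes gen: "generated R {0..L} b W" and R: "finite R"
  shows "AE \<xi> in \<mu>. (\<Sum>r\<in>R. (cmod (bracket (Suc N) h (W r) \<xi>))\<^sup>2) =
     indicator (disc 0) \<xi> * (\<Sum>c<q. (cmod (\<Sum>k<q ^ N.
       h (\<xi> + u c + inverse \<pp> * u k) * cnj (\<Phi> (\<pp> * (\<xi> + u c) + u k))))\<^sup>2)"
proof -
  have W: "AE \<xi> in \<mu>. \<forall>n. \<forall>r\<in>R. W r (\<xi> + u n) =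
      (\<Sum>l\<in>{0..L}. b r l (\<xi> + u n) * (m l (\<pp> * (\<xi> + u n)) * \<Phi> (\<pp> * (\<xi> + u n))))"
    using gen R unfolding generated_def
    by (subst AE_all_countable, intro allI AE_translate) (subst AE_finite_all, auto)
  have P: "AE \<xi> in \<mu>. \<forall>c. \<forall>l\<le>L. \<forall>n. m l (\<pp> * (\<xi> + u c) + u n) = m l (\<pp> * (\<xi> + u c))"
    by (subst AE_all_countable) (intro allI AE_translate[OF AE_dilate[OF mask_periodic]])
  have U: "AE \<xi> in \<mu>. \<forall>c<q. \<forall>c'<q. (\<Sum>l=0..L. cnj (m l (\<pp> * \<xi> + \<pp> * u c)) * m l (\<pp> * \<xi> + \<pp> * u c'))
     = (if c = c' then 1 else 0)"
    by (rule AE_dilate[OF uep_columns])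
  have B: "AE \<xi> in \<mu>. \<forall>l\<in>{0..L}. \<forall>l'\<in>{0..L}. (\<Sum>r\<in>R. cnj (b r l \<xi>) * b r l' \<xi>) = (if l = l' then 1 else 0)"
    using gen by (simp add: generated_def)
  show ?thesis
    using W P U B
  proof eventually_elim
    case (elim \<xi>)
    define Q where "Q c = (\<Sum>k<q ^ N. h (\<xi> + u c + inverse \<pp> * u k) * cnj (\<Phi> (\<pp> * (\<xi> + u c) + u k)))" for c
    define X where "X l = (\<Sum>c<q. cnj (m l (\<pp> * \<xi> + \<pp> * u c)) * Q c)" for l
    have br: "(\<Sum>n<q ^ Suc N. h (\<xi> + u n) * cnj (W r (\<xi> + u n))) = (\<Sum>l\<in>{0..L}. cnj (b r l \<xi>) * X l)"
      if r: "r \<in> R" for r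
    proof -
      have "(\<Sum>n<q ^ Suc N. h (\<xi> + u n) * cnj (W r (\<xi> + u n)))
          = (\<Sum>c<q. \<Sum>k<q ^ N. h (\<xi> + u (c + q * k)) * cnj (W r (\<xi> + u (c + q * k))))"
        by (simp add: sum_lessThan_mult_nat)
      also have "\<dots> = (\<Sum>c<q. \<Sum>k<q ^ N. \<Sum>l\<in>{0..L}. cnj (b r l \<xi>) * (cnj (m l (\<pp> * \<xi> + \<pp> * u c)) *
          (h (\<xi> + u c + inverse \<pp> * u k) * cnj (\<Phi> (\<pp> * (\<xi> + u c) + u k)))))"
      proof (intro sum.cong refl)
        fix c k assume "c \<in> {..<q}"
        then have ueq: "u (c + q * k) = u c + inverse \<pp> * u k"
          by (intro u_rec') simp
        have peq: "\<pp> * (\<xi> + u (c + q * k)) = \<pp> * (\<xi> + u c) + u k"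
          unfolding ueq by (simp add: algebra_simps)
        have "W r (\<xi> + u (c + q * k)) = (\<Sum>l\<in>{0..L}. b r l \<xi> * (m l (\<pp> * (\<xi> + u c)) * \<Phi> (\<pp> * (\<xi> + u c) + u k)))"
          unfolding elim(1)[rule_format, OF r] peq
          using gen r elim(2) by (intro sum.cong refl) (simp add: generated_def)
        then have "h (\<xi> + u (c + q * k)) * cnj (W r (\<xi> + u (c + q * k)))
           = h (\<xi> + u (c + q * k)) * (\<Sum>l\<in>{0..L}. cnj (b r l \<xi>) * (cnj (m l (\<pp> * (\<xi> + u c))) * cnj (\<Phi> (\<pp> * (\<xi> + u c) + u k))))"
          by (simp add: cnj_sum)
        also have "\<dots> = (\<Sum>l\<in>{0..L}. cnj (b r l \<xi>) * (cnj (m l (\<pp> * \<xi> + \<pp> * u c)) *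
          (h (\<xi> + u c + inverse \<pp> * u k) * cnj (\<Phi> (\<pp> * (\<xi> + u c) + u k)))))"
          unfolding sum_distrib_left ueq
          by (intro sum.cong refl) (simp add: distrib_left add.assoc mult_ac)
        finally show "h (\<xi> + u (c + q * k)) * cnj (W r (\<xi> + u (c + q * k)))
           = (\<Sum>l\<in>{0..L}. cnj (b r l \<xi>) * (cnj (m l (\<pp> * \<xi> + \<pp> * u c)) *
          (h (\<xi> + u c + inverse \<pp> * u k) * cnj (\<Phi> (\<pp> * (\<xi> + u c) + u k)))))" .
      qed
      also have "\<dots> = (\<Sum>c<q. \<Sum>l\<in>{0..L}. \<Sum>k<q ^ N. cnj (b r l \<xi>) * (cnj (m l (\<pp> * \<xi> + \<pp> * u c)) *
          (h (\<xi> + u c + inverse \<pp> * u k) * cnj (\<Phi> (\<pp> * (\<xi> + u c) + u k)))))"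
        by (rule sum.cong[OF refl], rule sum.swap)
      also have "\<dots> = (\<Sum>l\<in>{0..L}. \<Sum>c<q. \<Sum>k<q ^ N. cnj (b r l \<xi>) * (cnj (m l (\<pp> * \<xi> + \<pp> * u c)) *
          (h (\<xi> + u c + inverse \<pp> * u k) * cnj (\<Phi> (\<pp> * (\<xi> + u c) + u k)))))"
        by (rule sum.swap)
      also have "\<dots> = (\<Sum>l\<in>{0..L}. cnj (b r l \<xi>) * X l)"
        unfolding X_def Q_def sum_distrib_left ..
      finally show ?thesis .
    qed
    have "(\<Sum>r\<in>R. (cmod (bracket (Suc N) h (W r) \<xi>))\<^sup>2)
        = indicator (disc 0) \<xi> * (\<Sum>r\<in>R. (cmod (\<Sum>l\<in>{0..L}. cnj (b r l \<xi>) * X l))\<^sup>2)"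
    proof -
      have "(cmod (bracket (Suc N) h (W r) \<xi>))\<^sup>2
          = indicator (disc 0) \<xi> * (cmod (\<Sum>l\<in>{0..L}. cnj (b r l \<xi>) * X l))\<^sup>2" if "r \<in> R" for r
        unfolding bracket_def br[OF that] norm_mult power_mult_distrib by (simp add: indicator_def)
      then show ?thesis
        unfolding sum_distrib_left[where A = R] by (intro sum.cong refl)
    qed
    also have "(\<Sum>r\<in>R. (cmod (\<Sum>l\<in>{0..L}. cnj (b r l \<xi>) * X l))\<^sup>2) = (\<Sum>l\<in>{0..L}. (cmod (X l))\<^sup>2)"
      using elim(4) by (intro orthonormal_columns_isometry) auto
    also have "\<dots> = (\<Sum>c<q. (cmod (Q c))\<^sup>2)"
      unfolding X_def using elim(3)
      by (intro orthonormal_columns_isometry[where b = "\<lambda>l c. m l (\<pp> * \<xi> + \<pp> * u c)"]) auto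
    finally show ?case unfolding Q_def .
  qed
qed

text \<open>Integrating the preceding identity over \<open>\<DD>\<close>, the sum over \<open>c\<close> tiles \<open>\<pp>\<^sup>-\<^sup>1\<DD>\<close>, and the dilation by
  \<open>\<pp>\<close> carries this set back to \<open>\<DD>\<close>.\<close>

lemma energy_generated:
  assumes gen: "generated R {0..L} b W" and R: "finite R" and h: "tame (Suc N) h"
  shows "(\<Sum>r\<in>R. energy h (W r)) = energy (dilate 1 h) \<Phi>"
proof -
  have [measurable]: "h \<in> borel_measurable borel" "\<Phi> \<in> borel_measurable borel"
    using h Phi by (auto simp: tame_def square_integrable_def)
  have Wm [measurable]: "W r \<in> borel_measurable borel" if "r \<in> R" for r
    using gen that by (auto simp: generated_def square_integrable_def)
  have br: "bracket N h w \<in> borel_measurable borel" if [measurable]: "w \<in> borel_measurable borel" "h \<in> borel_measurable borel" for w h N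
    unfolding bracket_def[abs_def] by measurable
  define Q where "Q \<eta> = (\<Sum>k<q ^ N. h (inverse \<pp> * (\<eta> + u k)) * cnj (\<Phi> (\<eta> + u k)))" for \<eta>
  have [measurable]: "Q \<in> borel_measurable borel"
    unfolding Q_def[abs_def] distrib_left by measurable
  have Q: "(\<Sum>k<q ^ N. h (\<xi> + inverse \<pp> * u k) * cnj (\<Phi> (\<pp> * \<xi> + u k))) = Q (\<pp> * \<xi>)" for \<xi>
    unfolding Q_def by (intro sum.cong refl) (simp add: distrib_left flip: mult.assoc)
  have "(\<Sum>r\<in>R. energy h (W r)) = (\<Sum>r\<in>R. \<integral>\<^sup>+\<xi>. ennreal ((cmod (bracket (Suc N) h (W r) \<xi>))\<^sup>2) \<partial>\<mu>)"
    using gen by (intro sum.cong refl energy_eq_bracket[OF h]) (auto simp: generated_def)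
  also have "\<dots> = (\<integral>\<^sup>+\<xi>. (\<Sum>r\<in>R. ennreal ((cmod (bracket (Suc N) h (W r) \<xi>))\<^sup>2)) \<partial>\<mu>)"
    using br[OF Wm] by (intro nn_integral_sum[symmetric]) simp
  also have "\<dots> = (\<integral>\<^sup>+\<xi>. indicator (disc 0) \<xi> * (\<Sum>c<q. ennreal ((cmod (Q (\<pp> * (\<xi> + u c))))\<^sup>2)) \<partial>\<mu>)"
    using bracket_generated[OF gen R, of N h] unfolding Q
    by (intro nn_integral_cong_AE, eventually_elim) (simp add: sum_ennreal indicator_def)
  also have "\<dots> = (\<Sum>c<q ^ 1. \<integral>\<^sup>+\<xi>. indicator (disc 0) \<xi> * ennreal ((cmod (Q (\<pp> * (\<xi> + u c))))\<^sup>2) \<partial>\<mu>)"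
  proof -
    have "(\<lambda>x. Q (\<pp> * x + \<pp> * u c)) \<in> borel_measurable borel" for c by measurable
    then show ?thesis
      unfolding sum_distrib_left by (subst nn_integral_sum) (simp_all add: distrib_left)
  qed
  also have "\<dots> = (\<integral>\<^sup>+\<xi>. indicator (disc (int 1)) \<xi> * ennreal ((cmod (Q (\<pp> * \<xi>)))\<^sup>2) \<partial>\<mu>)"
    by (rule nn_integral_disc_eq_sum[symmetric]) measurable
  also have "\<dots> = (\<integral>\<^sup>+\<xi>. (\<lambda>\<eta>. indicator (disc 0) \<eta> * ennreal ((cmod (Q \<eta>))\<^sup>2)) (\<pp> powi 1 * \<xi> + 0) \<partial>\<mu>)"
    by (intro nn_integral_cong) (simp add: indicator_def)
  also have "\<dots> = ennreal (real q powi 1) * (\<integral>\<^sup>+\<eta>. indicator (disc 0) \<eta> * ennreal ((cmod (Q \<eta>))\<^sup>2) \<partial>\<mu>)"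
    by (rule nn_integral_affine) measurable
  also have "\<dots> = (\<integral>\<^sup>+\<eta>. ennreal (real q) * (indicator (disc 0) \<eta> * ennreal ((cmod (Q \<eta>))\<^sup>2)) \<partial>\<mu>)"
    by (subst nn_integral_cmult) simp_all
  also have "\<dots> = (\<integral>\<^sup>+\<eta>. ennreal ((cmod (bracket N (dilate 1 h) \<Phi> \<eta>))\<^sup>2) \<partial>\<mu>)"
  proof (intro nn_integral_cong)
    fix \<eta>
    have "bracket N (dilate 1 h) \<Phi> \<eta> = of_real (real q powr (1 / 2)) * (indicator (disc 0) \<eta> * Q \<eta>)"
      by (simp add: bracket_def Q_def dilate_def sum_distrib_left power_int_minus mult_ac)
    then have "(cmod (bracket N (dilate 1 h) \<Phi> \<eta>))\<^sup>2 = real q * (indicator (disc 0) \<eta> * (cmod (Q \<eta>))\<^sup>2)"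
      using q_powr_half_power2[of 1] by (simp add: norm_mult power_mult_distrib indicator_def)
    then show "ennreal (real q) * (indicator (disc 0) \<eta> * ennreal ((cmod (Q \<eta>))\<^sup>2))
        = ennreal ((cmod (bracket N (dilate 1 h) \<Phi> \<eta>))\<^sup>2)"
      by (simp add: ennreal_mult indicator_def)
  qed
  also have "\<dots> = energy (dilate 1 h) \<Phi>"
    using tame_dilate[OF h, of 1 N] by (intro energy_eq_bracket[symmetric] Phi) simp
  finally show ?thesis .
qed

text \<open>With \<open>\<Phi>\<close> as generator number 0 the refinement equation supplies the missing column for \<open>m\<^sub>0\<close>.\<close>

lemma generated_augment:
  assumes gen: "generated {1..M} {1..L} b W"
  shows "generated {0..M} {0..L}
    (\<lambda>r l \<xi>. if r = 0 then (if l = 0 then 1 else 0) else (if l = 0 then 0 else b r l \<xi>))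
    (\<lambda>r. if r = 0 then \<Phi> else W r)"
    (is "generated _ _ ?b ?W")
proof -
  have per: "b r l (\<xi> + u n) = b r l \<xi>" if "r \<in> {1..M}" "l \<in> {1..L}" for r l n \<xi>
    using gen that by (simp add: generated_def)
  have col: "(\<Sum>r\<in>{0..M}. f r) = f 0 + (\<Sum>r\<in>{1..M}. f r)" for f :: "nat \<Rightarrow> complex" and M
    by (simp add: sum.atLeast_Suc_atMost)
  have orth: "AE \<xi> in \<mu>. \<forall>l\<in>{0..L}. \<forall>l'\<in>{0..L}.
      (\<Sum>r\<in>{0..M}. cnj (?b r l \<xi>) * ?b r l' \<xi>) = (if l = l' then 1 else 0)"
  proof -
    have "AE \<xi> in \<mu>. \<forall>l\<in>{1..L}. \<forall>l'\<in>{1..L}. (\<Sum>r\<in>{1..M}. cnj (b r l \<xi>) * b r l' \<xi>) = (if l = l' then 1 else 0)"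
      using gen by (simp add: generated_def)
    then show ?thesis
    proof eventually_elim
      case (elim \<xi>)
      have "(\<Sum>r\<in>{1..M}. cnj (?b r l \<xi>) * ?b r l' \<xi>)
          = (if l = 0 \<or> l' = 0 then 0 else (\<Sum>r\<in>{1..M}. cnj (b r l \<xi>) * b r l' \<xi>))" for l l'
        by (cases "l = 0 \<or> l' = 0") (auto intro!: sum.neutral sum.cong)
      then show ?case
        unfolding col using elim by auto
    qed
  qed
  have rel: "AE \<xi> in \<mu>. ?W r \<xi> = (\<Sum>l\<in>{0..L}. ?b r l \<xi> * (m l (\<pp> * \<xi>) * \<Phi> (\<pp> * \<xi>)))"
    if "r \<in> {0..M}" for r
  proof (cases "r = 0")
    case True
    then show ?thesis
      using refinement unfolding col by simp
  next
    case False
    then have "AE \<xi> in \<mu>. W r \<xi> = (\<Sum>l\<in>{1..L}. b r l \<xi> * (m l (\<pp> * \<xi>) * \<Phi> (\<pp> * \<xi>)))"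
      using gen that by (simp add: generated_def)
    then show ?thesis
    proof eventually_elim
      case (elim \<xi>)
      show ?case
        unfolding col using False elim by simp
    qed
  qed
  show ?thesis
    unfolding generated_def using gen Phi per rel orth
    by (intro conjI ballI allI) (auto simp: generated_def)
qed

text \<open>The energy of \<open>\<Phi>\<close> at one scale splits into its energy at the next coarser scale and the energies of
  the generators there.\<close>

lemma energy_step:
  assumes gen: "generated {1..M} {1..L} b W" and h: "tame N h"
  shows "energy h \<Phi> + (\<Sum>r\<in>{1..M}. energy h (W r)) = energy (dilate 1 h) \<Phi>"
proof -
  have "tame (Suc N) h" by (rule tame_mono[OF h]) simp
  from energy_generated[OF generated_augment[OF gen] _ this] show ?thesis
    by (simp add: sum.atLeast_Suc_atMost)
qed

section \<open>Telescoping over the scales\<close>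

lemma tame_dilate_ex:
  assumes "tame N h" shows "\<exists>N'. tame N' (dilate j h)"
proof
  show "tame (nat (int N - j)) (dilate j h)"
    by (rule tame_dilate[OF assms]) simp
qed

lemma energy_telescope:
  assumes gen: "generated {1..M} {1..L} b W" and h: "tame N h"
  shows "energy (dilate (- int J) h) \<Phi> + (\<Sum>j\<in>{- int J..<int J}. \<Sum>r\<in>{1..M}. energy (dilate j h) (W r))
    = energy (dilate (int J) h) \<Phi>"
proof -
  have step: "energy (dilate j h) \<Phi> + (\<Sum>r\<in>{1..M}. energy (dilate j h) (W r)) = energy (dilate (j + 1) h) \<Phi>" for j
  proof -
    obtain N' where "tame N' (dilate j h)" using tame_dilate_ex[OF h] by blast
    from energy_step[OF gen this] show ?thesis by (simp add: dilate_dilate add.commute)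
  qed
  have "energy (dilate (- int J) h) \<Phi> + (\<Sum>j\<in>{- int J..<- int J + int n}. \<Sum>r\<in>{1..M}. energy (dilate j h) (W r))
    = energy (dilate (- int J + int n) h) \<Phi>" for n
  proof (induction n)
    case (Suc n)
    have "{- int J..<- int J + int (Suc n)} = insert (- int J + int n) {- int J..<- int J + int n}"
      by auto
    then have "(\<Sum>j\<in>{- int J..<- int J + int (Suc n)}. \<Sum>r\<in>{1..M}. energy (dilate j h) (W r))
        = (\<Sum>j\<in>{- int J..<- int J + int n}. \<Sum>r\<in>{1..M}. energy (dilate j h) (W r))
          + (\<Sum>r\<in>{1..M}. energy (dilate (- int J + int n) h) (W r))"
      by (simp add: add.commute)
    then have "energy (dilate (- int J) h) \<Phi>
        + (\<Sum>j\<in>{- int J..<- int J + int (Suc n)}. \<Sum>r\<in>{1..M}. energy (dilate j h) (W r))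
      = energy (dilate (- int J + int n + 1) h) \<Phi>"
      unfolding step[symmetric] Suc[symmetric] by (simp only: add.assoc)
    then show ?case by (simp add: add_ac)
  qed simp
  from this[of "2 * J"] show ?thesis by simp
qed

text \<open>At fine scales the dilate of \<open>h\<close> is supported where \<open>\<Phi> = 1\<close>, and the bracket with \<open>\<Phi>\<close> is the dilate
  itself.\<close>

lemma energy_eq_norm:
  assumes h: "tame N h"
  shows "\<exists>J0. \<forall>J\<ge>J0. energy (dilate (int J) h) \<Phi> = ennreal ((l2norm \<mu> h)\<^sup>2)"
proof -
  obtain n :: nat where n: "\<And>\<xi>. \<xi> \<in> disc (- int n) \<Longrightarrow> \<Phi> \<xi> = 1"
    using Phi_near_0 by blast
  have "energy (dilate (int J) h) \<Phi> = ennreal ((l2norm \<mu> h)\<^sup>2)" if J: "J \<ge> N + n" for J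
  proof -
    let ?h = "dilate (int J) h"
    have t: "tame 0 ?h" by (rule tame_dilate[OF h]) (use J in simp)
    have supp: "?h \<xi> = 0" if "\<xi> \<notin> disc (- int n)" for \<xi>
    proof -
      have "\<xi> \<notin> disc (int N - int J)"
        using that disc_mono'[of \<xi> "int N - int J" "- int n"] J by auto
      then show ?thesis using h by (simp add: dilate_def tame_def)
    qed
    have "bracket 0 ?h \<Phi> \<xi> = ?h \<xi>" for \<xi>
      using supp[of \<xi>] n[of \<xi>] disc_mono'[of \<xi> "- int n" 0]
      by (cases "\<xi> \<in> disc (- int n)") (auto simp: bracket_def)
    then have "energy ?h \<Phi> = (\<integral>\<^sup>+\<xi>. ennreal ((cmod (?h \<xi>))\<^sup>2) \<partial>\<mu>)"
      by (simp add: energy_eq_bracket[OF t Phi])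
    then show ?thesis
      using dilate_isometry[OF tame_square_integrable[OF h], of "int J"]
      by (simp add: nn_integral_cmod_power2)
  qed
  then show ?thesis by blast
qed

text \<open>For a function vanishing near 0 the dilate by \<open>\<pp>\<^sup>-\<^sup>J\<close> lives far out; there it overlaps only
  with the tail of \<open>\<Phi>\<close>, while the number of summands in the bracket compensates for its size.\<close>

lemma energy_bound_tail:
  assumes h: "tame N h" and C: "\<And>\<xi>. cmod (h \<xi>) \<le> C" and h0: "\<And>\<xi>. \<xi> \<in> disc (- int N) \<Longrightarrow> h \<xi> = 0"
  shows "energy (dilate (- int J) h) \<Phi> \<le> ennreal (real q ^ N * C\<^sup>2 *
     (l2norm \<mu> (\<lambda>x. indicator (disc (int J - int N)) x * \<Phi> x - \<Phi> x))\<^sup>2)"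
proof -
  let ?H = "dilate (- int J) h" and ?D = "real q ^ N * C\<^sup>2"
  define t where "t x = indicator (disc (int J - int N)) x * \<Phi> x - \<Phi> x" for x
  have t2: "square_integrable \<mu> t"
    unfolding t_def[abs_def] by (intro square_integrable_diff truncate_disc(1) Phi)
  have [measurable]: "t \<in> borel_measurable borel"
    using t2 by (simp add: square_integrable_def)
  have tame: "tame (N + J) ?H" by (rule tame_dilate[OF h]) simp
  have H2: "(cmod (?H x))\<^sup>2 \<le> real q powi (- int J) * C\<^sup>2" for x
    unfolding dilate_def norm_mult power_mult_distrib norm_of_real power2_abs q_powr_half_power2
    by (intro mult_left_mono power_mono C) auto
  have H0: "cmod (?H x) * cmod (\<Phi> x) = cmod (?H x) * cmod (t x)" for x
  proof (cases "x \<in> disc (int J - int N)")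
    case True
    then have "\<pp> powi (int J) * x \<in> disc (- int N)"
      by (simp only: prm_powi_mult_disc) simp
    then have "?H x = 0" by (simp add: dilate_def h0 del: power_int_of_nat)
    then show ?thesis by simp
  qed (simp add: t_def)
  have ptw: "(cmod (bracket (N + J) ?H \<Phi> \<xi>))\<^sup>2
      \<le> ?D * (indicator (disc 0) \<xi> * (\<Sum>n<q ^ (N + J). (cmod (t (\<xi> + u n)))\<^sup>2))" for \<xi>
  proof (cases "\<xi> \<in> disc 0")
    case True
    have "cmod (bracket (N + J) ?H \<Phi> \<xi>) \<le> (\<Sum>n<q ^ (N + J). cmod (?H (\<xi> + u n)) * cmod (t (\<xi> + u n)))"
      unfolding bracket_def using True
      by (simp, intro sum_norm_le) (simp add: norm_mult H0)
    then have "(cmod (bracket (N + J) ?H \<Phi> \<xi>))\<^sup>2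
        \<le> (\<Sum>n<q ^ (N + J). cmod (?H (\<xi> + u n)) * cmod (t (\<xi> + u n)))\<^sup>2"
      by (intro power_mono) auto
    also have "\<dots> \<le> (\<Sum>n<q ^ (N + J). (cmod (?H (\<xi> + u n)))\<^sup>2) * (\<Sum>n<q ^ (N + J). (cmod (t (\<xi> + u n)))\<^sup>2)"
      by (rule Cauchy_Schwarz_ineq_sum)
    also have "\<dots> \<le> ?D * (\<Sum>n<q ^ (N + J). (cmod (t (\<xi> + u n)))\<^sup>2)"
    proof (intro mult_right_mono sum_nonneg)
      have "(\<Sum>n<q ^ (N + J). (cmod (?H (\<xi> + u n)))\<^sup>2) \<le> (\<Sum>n<q ^ (N + J). real q powi (- int J) * C\<^sup>2)"
        by (intro sum_mono H2)
      also have "\<dots> = ?D"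
        by (simp add: power_add power_int_minus)
      finally show "(\<Sum>n<q ^ (N + J). (cmod (?H (\<xi> + u n)))\<^sup>2) \<le> ?D" .
    qed auto
    finally show ?thesis using True by simp
  qed (simp add: bracket_def)
  have "energy ?H \<Phi> = (\<integral>\<^sup>+\<xi>. ennreal ((cmod (bracket (N + J) ?H \<Phi> \<xi>))\<^sup>2) \<partial>\<mu>)"
    by (rule energy_eq_bracket[OF tame Phi])
  also have "\<dots> \<le> (\<integral>\<^sup>+\<xi>. ennreal ?D * (\<Sum>n<q ^ (N + J). indicator (disc 0) \<xi> * ennreal ((cmod (t (\<xi> + u n)))\<^sup>2)) \<partial>\<mu>)"
  proof (intro nn_integral_mono)
    fix \<xi>
    have "ennreal ((cmod (bracket (N + J) ?H \<Phi> \<xi>))\<^sup>2)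
        \<le> ennreal (?D * (indicator (disc 0) \<xi> * (\<Sum>n<q ^ (N + J). (cmod (t (\<xi> + u n)))\<^sup>2)))"
      by (rule ennreal_leI[OF ptw])
    also have "\<dots> = ennreal ?D * (\<Sum>n<q ^ (N + J). indicator (disc 0) \<xi> * ennreal ((cmod (t (\<xi> + u n)))\<^sup>2))"
      by (subst ennreal_mult) (auto simp: indicator_def sum_ennreal intro!: sum_nonneg)
    finally show "ennreal ((cmod (bracket (N + J) ?H \<Phi> \<xi>))\<^sup>2)
        \<le> ennreal ?D * (\<Sum>n<q ^ (N + J). indicator (disc 0) \<xi> * ennreal ((cmod (t (\<xi> + u n)))\<^sup>2))" .
  qed
  also have "\<dots> = ennreal ?D * (\<Sum>n<q ^ (N + J). \<integral>\<^sup>+\<xi>. indicator (disc 0) \<xi> * ennreal ((cmod (t (\<xi> + u n)))\<^sup>2) \<partial>\<mu>)"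
  proof -
    have "(\<integral>\<^sup>+\<xi>. (\<Sum>n<q ^ (N + J). indicator (disc 0) \<xi> * ennreal ((cmod (t (\<xi> + u n)))\<^sup>2)) \<partial>\<mu>)
        = (\<Sum>n<q ^ (N + J). \<integral>\<^sup>+\<xi>. indicator (disc 0) \<xi> * ennreal ((cmod (t (\<xi> + u n)))\<^sup>2) \<partial>\<mu>)"
      by (rule nn_integral_sum) simp
    moreover have "(\<lambda>\<xi>. \<Sum>n<q ^ (N + J). indicator (disc 0) \<xi> * ennreal ((cmod (t (\<xi> + u n)))\<^sup>2)) \<in> borel_measurable \<mu>"
      unfolding measurable_haar by measurable
    ultimately show ?thesis by (subst nn_integral_cmult) simp_all
  qed
  also have "\<dots> = ennreal ?D * (\<integral>\<^sup>+\<xi>. indicator (disc (int (N + J))) \<xi> * ennreal ((cmod (t \<xi>))\<^sup>2) \<partial>\<mu>)"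
    by (subst nn_integral_disc_eq_sum) simp_all
  also have "\<dots> \<le> ennreal ?D * (\<integral>\<^sup>+\<xi>. ennreal ((cmod (t \<xi>))\<^sup>2) \<partial>\<mu>)"
    by (intro mult_left_mono nn_integral_mono) (auto simp: indicator_def)
  also have "\<dots> = ennreal (?D * (l2norm \<mu> t)\<^sup>2)"
    unfolding nn_integral_cmod_power2[OF t2] by (simp add: ennreal_mult)
  finally show ?thesis unfolding t_def[abs_def] .
qed

lemma energy_tendsto_0:
  assumes h: "tame N h" and h0: "\<And>\<xi>. \<xi> \<in> disc (- int N) \<Longrightarrow> h \<xi> = 0"
  shows "(\<lambda>J. energy (dilate (- int J) h) \<Phi>) \<longlonglongrightarrow> 0"
proof -
  obtain C where C: "\<And>\<xi>. cmod (h \<xi>) \<le> C"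
    using h by (auto simp: tame_def)
  have "(\<lambda>J. real q ^ N * C\<^sup>2 * (l2norm \<mu> (\<lambda>x. indicator (disc (int J)) x * \<Phi> x - \<Phi> x))\<^sup>2) \<longlonglongrightarrow> real q ^ N * C\<^sup>2 * 0\<^sup>2"
    by (intro tendsto_intros truncate_disc_l2_tendsto Phi)
  then have "(\<lambda>J. ennreal (real q ^ N * C\<^sup>2 * (l2norm \<mu> (\<lambda>x. indicator (disc (int J)) x * \<Phi> x - \<Phi> x))\<^sup>2)) \<longlonglongrightarrow> ennreal 0"
    by (intro tendsto_ennrealI) simp
  then have lim: "(\<lambda>J. ennreal (real q ^ N * C\<^sup>2 * (l2norm \<mu> (\<lambda>x. indicator (disc (int J)) x * \<Phi> x - \<Phi> x))\<^sup>2)) \<longlonglongrightarrow> 0"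
    by simp
  have "energy (dilate (- int (J + N)) h) \<Phi> \<le> ennreal (real q ^ N * C\<^sup>2 *
      (l2norm \<mu> (\<lambda>x. indicator (disc (int J)) x * \<Phi> x - \<Phi> x))\<^sup>2)" for J
    using energy_bound_tail[OF h C h0, of "J + N"] by simp
  then have "(\<lambda>J. energy (dilate (- int (J + N)) h) \<Phi>) \<longlonglongrightarrow> 0"
    by (intro tendsto_sandwich[OF _ _ tendsto_const lim]) auto
  then show ?thesis
    by (rule LIMSEQ_offset)
qed

text \<open>The frame coefficients in terms of Fourier transforms; \<open>analysis\<close> gives them for the functions
  themselves.\<close>

definition frame_coeff :: "(nat \<Rightarrow> 'k \<Rightarrow> complex) \<Rightarrow> ('k \<Rightarrow> complex) \<Rightarrow> nat \<times> int \<times> nat \<Rightarrow> complex" where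
  "frame_coeff W h = (\<lambda>(r, j, k). l2_inner K h (wavelet_hat (W r) j k))"

lemma nn_integral_wavelet_index:
  "(\<integral>\<^sup>+i. f i \<partial>count_space (wavelet_index M))
    = (\<integral>\<^sup>+j. (\<Sum>r\<in>{1..M}. \<Sum>k. f (r, j, k)) \<partial>count_space UNIV)"
  for f :: "nat \<times> int \<times> nat \<Rightarrow> ennreal"
proof -
  have "(\<integral>\<^sup>+i. f i \<partial>count_space (wavelet_index M))
      = (\<integral>\<^sup>+i. f i * indicator (wavelet_index M) i \<partial>count_space UNIV)"
    by (simp add: nn_integral_count_space_indicator)
  also have "\<dots> = (\<integral>\<^sup>+r. \<integral>\<^sup>+jk. f (r, jk) * indicator (wavelet_index M) (r, jk) \<partial>count_space UNIV \<partial>count_space UNIV)"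
    by (rule nn_integral_fst_count_space[symmetric])
  also have "\<dots> = (\<integral>\<^sup>+r. indicator {1..M} r * (\<integral>\<^sup>+jk. f (r, jk) \<partial>count_space UNIV) \<partial>count_space UNIV)"
    by (intro nn_integral_cong) (auto simp: wavelet_index_def indicator_def)
  also have "\<dots> = (\<Sum>r\<in>{1..M}. indicator {1..M} r * (\<integral>\<^sup>+jk. f (r, jk) \<partial>count_space UNIV))"
    by (intro nn_integral_count_space') auto
  also have "\<dots> = (\<Sum>r\<in>{1..M}. \<integral>\<^sup>+jk. f (r, jk) \<partial>count_space UNIV)"
    by (intro sum.cong) auto
  also have "\<dots> = (\<Sum>r\<in>{1..M}. \<integral>\<^sup>+j. (\<Sum>k. f (r, j, k)) \<partial>count_space UNIV)"
    by (simp only: nn_integral_fst_count_space[symmetric] nn_integral_count_space_nat)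
  also have "\<dots> = (\<integral>\<^sup>+j. (\<Sum>r\<in>{1..M}. \<Sum>k. f (r, j, k)) \<partial>count_space UNIV)"
    by (rule nn_integral_sum[symmetric]) simp
  finally show ?thesis .
qed

lemma nn_integral_int_LIMSEQ:
  fixes f :: "int \<Rightarrow> ennreal"
  shows "(\<lambda>J. \<Sum>j\<in>{- int J..<int J}. f j) \<longlonglongrightarrow> (\<integral>\<^sup>+j. f j \<partial>count_space UNIV)"
proof -
  have "(\<lambda>J. \<integral>\<^sup>+j. f j * indicator {- int J..<int J} j \<partial>count_space UNIV) \<longlonglongrightarrow> (\<integral>\<^sup>+j. f j \<partial>count_space UNIV)"
  proof (rule nn_integral_LIMSEQ)
    show "incseq (\<lambda>J j. f j * indicator {- int J..<int J} j)"
      by (auto simp: incseq_def le_fun_def indicator_def)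
    show "(\<lambda>J. f j * indicator {- int J..<int J} j) \<longlonglongrightarrow> f j" for j
      by (rule tendsto_eventually)
         (auto simp: eventually_sequentially indicator_def intro!: exI[of _ "Suc (nat \<bar>j\<bar>)"])
  qed simp
  moreover have "(\<integral>\<^sup>+j. f j * indicator {- int J..<int J} j \<partial>count_space UNIV) = (\<Sum>j\<in>{- int J..<int J}. f j)" for J
    by (subst nn_integral_count_space'[of "{- int J..<int J}"]) auto
  ultimately show ?thesis by simp
qed

text \<open>The coefficients at scale \<open>j\<close> contribute the difference of two consecutive energies of \<open>\<Phi>\<close>, which
  tend to \<open>\<parallel>h\<parallel>\<^sup>2\<close> and to 0 at the two ends.\<close>

lemma tight_frame_tame:
  assumes gen: "generated {1..M} {1..L} b W" and h: "tame N h"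
    and h0: "\<And>\<xi>. \<xi> \<in> disc (- int N) \<Longrightarrow> h \<xi> = 0"
  shows "(\<integral>\<^sup>+i. ennreal ((cmod (frame_coeff W h i))\<^sup>2) \<partial>count_space (wavelet_index M)) = ennreal ((l2norm \<mu> h)\<^sup>2)"
proof -
  have Wm: "W r \<in> borel_measurable borel" if "r \<in> {1..M}" for r
    using gen that by (auto simp: generated_def square_integrable_def)
  have hm: "h \<in> borel_measurable borel" using h by (simp add: tame_def)
  let ?E = "\<lambda>j. \<Sum>r\<in>{1..M}. energy (dilate j h) (W r)"
  have "(\<integral>\<^sup>+i. ennreal ((cmod (frame_coeff W h i))\<^sup>2) \<partial>count_space (wavelet_index M))
      = (\<integral>\<^sup>+j. ?E j \<partial>count_space UNIV)"
  proof -
    have "(\<Sum>k. ennreal ((cmod (frame_coeff W h (r, j, k)))\<^sup>2)) = energy (dilate j h) (W r)"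
      if "r \<in> {1..M}" for r j
      unfolding energy_def frame_coeff_def case_prod_conv l2_inner_wavelet_hat[OF hm Wm[OF that]] ..
    then show ?thesis
      unfolding nn_integral_wavelet_index by simp
  qed
  moreover have "(\<integral>\<^sup>+j. ?E j \<partial>count_space UNIV) = ennreal ((l2norm \<mu> h)\<^sup>2)"
  proof (rule LIMSEQ_unique)
    have "(\<lambda>J. energy (dilate (- int J) h) \<Phi> + (\<Sum>j\<in>{- int J..<int J}. ?E j))
        \<longlonglongrightarrow> 0 + (\<integral>\<^sup>+j. ?E j \<partial>count_space UNIV)"
      by (intro tendsto_add energy_tendsto_0[OF h h0] nn_integral_int_LIMSEQ)
    then show "(\<lambda>J. energy (dilate (int J) h) \<Phi>) \<longlonglongrightarrow> (\<integral>\<^sup>+j. ?E j \<partial>count_space UNIV)"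
      unfolding energy_telescope[OF gen h] by simp
    show "(\<lambda>J. energy (dilate (int J) h) \<Phi>) \<longlonglongrightarrow> ennreal ((l2norm \<mu> h)\<^sup>2)"
      using energy_eq_norm[OF h] by (intro tendsto_eventually) (simp add: eventually_sequentially)
  qed
  ultimately show ?thesis by simp
qed

section \<open>The tight frame theorem\<close>

text \<open>Each single coefficient is continuous in \<open>h\<close>, and differences of the approximating functions again
  belong to the class treated by \<open>tight_frame_tame\<close>, so \<open>isometry_limit\<close> applies.\<close>

theorem tight_frame:
  assumes gen: "generated {1..M} {1..L} b W" and h: "square_integrable \<mu> h"
  shows "square_integrable (count_space (wavelet_index M)) (frame_coeff W h)"
    and "l2norm (count_space (wavelet_index M)) (frame_coeff W h) = l2norm \<mu> h"
proof -
  let ?I = "count_space (wavelet_index M)"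
  obtain v where v: "\<And>n. tame n (v n)" "\<And>n \<xi>. \<xi> \<in> disc (- int n) \<Longrightarrow> v n \<xi> = 0"
    and lim: "(\<lambda>n. l2norm \<mu> (\<lambda>x. v n x - h x)) \<longlonglongrightarrow> 0"
    using tame_approximation[OF h] by blast
  note v2 = tame_square_integrable[OF v(1)]
  have W2: "square_integrable \<mu> (W r)" if "r \<in> {1..M}" for r
    using gen that by (simp add: generated_def)
  have tight: "square_integrable ?I (frame_coeff W g)" "l2norm ?I (frame_coeff W g) = l2norm \<mu> g"
    if g: "tame N g" "\<And>\<xi>. \<xi> \<in> disc (- int N) \<Longrightarrow> g \<xi> = 0" for N g
  proof -
    have nn: "(\<integral>\<^sup>+i. ennreal ((cmod (frame_coeff W g i))\<^sup>2) \<partial>?I) = ennreal ((l2norm \<mu> g)\<^sup>2)"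
      by (rule tight_frame_tame[OF gen g])
    show si: "square_integrable ?I (frame_coeff W g)"
      unfolding square_integrable_iff_nn_integral nn by simp
    show "l2norm ?I (frame_coeff W g) = l2norm \<mu> g"
      using nn unfolding nn_integral_cmod_power2[OF si] by (simp add: power2_eq_iff_nonneg)
  qed
  have diff: "frame_coeff W (\<lambda>x. f x - g x) i = frame_coeff W f i - frame_coeff W g i"
    if "i \<in> wavelet_index M" "square_integrable \<mu> f" "square_integrable \<mu> g" for i f g
    using that W2
    by (auto simp: frame_coeff_def wavelet_index_def intro!: l2_inner_diff_left square_integrable_wavelet_hat)
  have ptw: "(\<lambda>n. frame_coeff W (v n) i) \<longlonglongrightarrow> frame_coeff W h i" if i: "i \<in> wavelet_index M" for i
  proof -
    obtain r j k where rjk: "i = (r, j, k)" "r \<in> {1..M}"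
      using i by (auto simp: wavelet_index_def)
    have bd: "cmod (frame_coeff W (v n) i - frame_coeff W h i) \<le> l2norm \<mu> (\<lambda>x. v n x - h x) * l2norm \<mu> (W r)" for n
      using Cauchy_Schwarz_integral[OF square_integrable_diff[OF v2 h] square_integrable_wavelet_hat(1)[OF W2[OF rjk(2)]], of n j k]
        square_integrable_wavelet_hat(2)[OF W2[OF rjk(2)]]
      unfolding diff[OF i v2 h, symmetric] by (simp add: frame_coeff_def l2_inner_def rjk)
    have "(\<lambda>n. frame_coeff W (v n) i - frame_coeff W h i) \<longlonglongrightarrow> 0"
      by (rule Lim_null_comparison[OF always_eventually[OF allI[OF bd]] tendsto_mult_left_zero[OF lim]])
    then show ?thesis by (rule LIM_zero_cancel)
  qed
  have iso: "l2norm ?I (\<lambda>i. frame_coeff W (v n) i - frame_coeff W (v k) i) = l2norm \<mu> (\<lambda>x. v n x - v k x)" for n k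
  proof -
    have t: "tame (max n k) (\<lambda>x. v n x - v k x)"
    proof -
      have a: "tame (max n k) (v n)" "tame (max n k) (v k)"
        by (auto intro: tame_mono[OF v(1)])
      obtain C D where "\<And>x. cmod (v n x) \<le> C" "\<And>x. cmod (v k x) \<le> D"
        using a by (auto simp: tame_def)
      then have "cmod (v n x - v k x) \<le> C + D" for x
        using norm_triangle_ineq4[of "v n x" "v k x"] by (meson add_mono order_trans)
      then show ?thesis using a by (auto simp: tame_def intro!: borel_measurable_diff)
    qed
    have z: "v n x - v k x = 0" if "x \<in> disc (- int (max n k))" for x
      using v(2)[of x n] v(2)[of x k] disc_mono'[OF that, of "- int n"] disc_mono'[OF that, of "- int k"] by simp
    have "l2norm ?I (\<lambda>i. frame_coeff W (v n) i - frame_coeff W (v k) i) = l2norm ?I (frame_coeff W (\<lambda>x. v n x - v k x))"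
      unfolding l2norm_def using diff[OF _ v2 v2]
      by (intro arg_cong[where f = sqrt] Bochner_Integration.integral_cong refl) simp
    also have "\<dots> = l2norm \<mu> (\<lambda>x. v n x - v k x)"
      by (rule tight(2)[OF t z])
    finally show ?thesis .
  qed
  show "square_integrable ?I (frame_coeff W h)" "l2norm ?I (frame_coeff W h) = l2norm \<mu> h"
    using isometry_limit[OF v2 h lim tight(1)[OF v] _ _ iso tight(2)[OF v], of "frame_coeff W h"] ptw
    by (simp_all add: AE_count_space)
qed

lemma analysis_eq_frame_coeff:
  assumes "\<And>l. l \<in> {1..M} \<Longrightarrow> square_integrable \<mu> (\<Psi> l)" "square_integrable \<mu> f" "i \<in> wavelet_index M"
  shows "analysis \<Psi> f i = frame_coeff (\<lambda>l. fourier K (\<Psi> l)) (fourier K f) i"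
  using assms by (auto simp: analysis_def frame_coeff_def wavelet_index_def l2_inner_wavelet)

lemma frame_coeff_combination:
  assumes \<Psi>: "\<And>l. l \<in> {1..M} \<Longrightarrow> square_integrable \<mu> (\<Psi> l)" and \<Theta>: "\<And>l. l \<in> {1..M} \<Longrightarrow> square_integrable \<mu> (\<Theta> l)"
    and h: "square_integrable \<mu> h" and i: "i \<in> wavelet_index M"
  shows "frame_coeff (\<lambda>r \<xi>. c * \<Psi> r \<xi> + d * \<Theta> r \<xi>) h i = cnj c * frame_coeff \<Psi> h i + cnj d * frame_coeff \<Theta> h i"
proof -
  obtain r j k where rjk: "i = (r, j, k)" "r \<in> {1..M}"
    using i by (auto simp: wavelet_index_def)
  have a: "square_integrable \<mu> (wavelet_hat (\<Psi> r) j k)" "square_integrable \<mu> (wavelet_hat (\<Theta> r) j k)"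
    by (intro square_integrable_wavelet_hat \<Psi> \<Theta> rjk(2))+
  have hat: "wavelet_hat (\<lambda>\<xi>. c * \<Psi> r \<xi> + d * \<Theta> r \<xi>) j k
      = (\<lambda>\<xi>. c * wavelet_hat (\<Psi> r) j k \<xi> + d * wavelet_hat (\<Theta> r) j k \<xi>)"
    by (rule ext) (simp add: wavelet_hat_def algebra_simps)
  have "frame_coeff (\<lambda>r \<xi>. c * \<Psi> r \<xi> + d * \<Theta> r \<xi>) h i
      = cnj (l2_inner K (\<lambda>\<xi>. c * wavelet_hat (\<Psi> r) j k \<xi> + d * wavelet_hat (\<Theta> r) j k \<xi>) h)"
    by (simp add: frame_coeff_def rjk hat l2_inner_cnj)
  also have "l2_inner K (\<lambda>\<xi>. c * wavelet_hat (\<Psi> r) j k \<xi> + d * wavelet_hat (\<Theta> r) j k \<xi>) h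
      = l2_inner K (\<lambda>\<xi>. c * wavelet_hat (\<Psi> r) j k \<xi>) h + d * l2_inner K (wavelet_hat (\<Theta> r) j k) h"
    by (intro l2_inner_combination_left square_integrable_scale a h)
  also have "l2_inner K (\<lambda>\<xi>. c * wavelet_hat (\<Psi> r) j k \<xi>) h = c * l2_inner K (wavelet_hat (\<Psi> r) j k) h"
    by (simp add: l2_inner_def mult.assoc)
  finally show ?thesis
    by (simp add: frame_coeff_def rjk l2_inner_cnj)
qed

section \<open>Pairs of frames from a paraunitary matrix\<close>

text \<open>The columns of \<open>c A\<^sub>1 + d A\<^sub>2\<close>, where \<open>A = (A\<^sub>1 A\<^sub>2)\<close> has orthonormal columns and
  \<open>|c|\<^sup>2 + |d|\<^sup>2 = 1\<close>, are again orthonormal. The pairs \<open>(1, 0)\<close> and \<open>(0, 1)\<close> give the two frames of the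
  theorem, and the pairs \<open>(1, \<omega>)/\<surd>2\<close> their orthogonality.\<close>

lemma generated_combination:
  assumes a: "paraunitary K (2 * L) a" and cd: "(cmod c)\<^sup>2 + (cmod d)\<^sup>2 = 1"
    and \<Psi>: "\<And>r. r \<in> {1..2 * L} \<Longrightarrow> square_integrable \<mu> (\<Psi> r)"
    and \<Theta>: "\<And>r. r \<in> {1..2 * L} \<Longrightarrow> square_integrable \<mu> (\<Theta> r)"
    and psi: "\<And>r. r \<in> {1..2 * L} \<Longrightarrow>
      AE \<xi> in \<mu>. \<Psi> r \<xi> = (\<Sum>l=1..L. a r l \<xi> * m l (\<pp> * \<xi>)) * \<Phi> (\<pp> * \<xi>)"
    and theta: "\<And>r. r \<in> {1..2 * L} \<Longrightarrow>
      AE \<xi> in \<mu>. \<Theta> r \<xi> = (\<Sum>l=1..L. a r (L + l) \<xi> * m l (\<pp> * \<xi>)) * \<Phi> (\<pp> * \<xi>)"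
  shows "generated {1..2 * L} {1..L} (\<lambda>r l \<xi>. c * a r l \<xi> + d * a r (L + l) \<xi>)
    (\<lambda>r \<xi>. c * \<Psi> r \<xi> + d * \<Theta> r \<xi>)"
  unfolding generated_def
proof (intro conjI ballI allI)
  fix r assume r: "r \<in> {1..2 * L}"
  show "square_integrable \<mu> (\<lambda>\<xi>. c * \<Psi> r \<xi> + d * \<Theta> r \<xi>)"
    by (intro square_integrable_add square_integrable_scale \<Psi> \<Theta> r)
  show "AE \<xi> in \<mu>. c * \<Psi> r \<xi> + d * \<Theta> r \<xi>
      = (\<Sum>l\<in>{1..L}. (c * a r l \<xi> + d * a r (L + l) \<xi>) * (m l (\<pp> * \<xi>) * \<Phi> (\<pp> * \<xi>)))"
    using psi[OF r] theta[OF r]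
  proof eventually_elim
    case (elim \<xi>)
    then show ?case
      by (simp add: sum_distrib_left sum_distrib_right distrib_right sum.distrib mult.assoc)
  qed
  fix l n \<xi> assume l: "l \<in> {1..L}"
  have "char_poly_fun K (a r l)" "char_poly_fun K (a r (L + l))"
    using a r l by (auto simp: paraunitary_def)
  then show "c * a r l (\<xi> + u n) + d * a r (L + l) (\<xi> + u n) = c * a r l \<xi> + d * a r (L + l) \<xi>"
    by (simp add: char_poly_fun_periodic)
next
  have "AE \<xi> in \<mu>. \<forall>i\<in>{1..2 * L}. \<forall>j\<in>{1..2 * L}. (\<Sum>r=1..2 * L. cnj (a r i \<xi>) * a r j \<xi>) = (if i = j then 1 else 0)"
    using a by (simp add: paraunitary_def)
  then show "AE \<xi> in \<mu>. \<forall>l\<in>{1..L}. \<forall>l'\<in>{1..L}.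
      (\<Sum>r\<in>{1..2 * L}. cnj (c * a r l \<xi> + d * a r (L + l) \<xi>) * (c * a r l' \<xi> + d * a r (L + l') \<xi>))
        = (if l = l' then 1 else 0)"
  proof eventually_elim
    case (elim \<xi>)
    show ?case
    proof (intro ballI)
      fix l l' assume l: "l \<in> {1..L}" "l' \<in> {1..L}"
      let ?S = "\<lambda>i j. \<Sum>r=1..2 * L. cnj (a r i \<xi>) * a r j \<xi>"
      have "(\<Sum>r\<in>{1..2 * L}. cnj (c * a r l \<xi> + d * a r (L + l) \<xi>) * (c * a r l' \<xi> + d * a r (L + l') \<xi>))
          = (\<Sum>r\<in>{1..2 * L}. cnj c * c * (cnj (a r l \<xi>) * a r l' \<xi>) + cnj c * d * (cnj (a r l \<xi>) * a r (L + l') \<xi>)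
            + cnj d * c * (cnj (a r (L + l) \<xi>) * a r l' \<xi>) + cnj d * d * (cnj (a r (L + l) \<xi>) * a r (L + l') \<xi>))"
        by (intro sum.cong refl) (simp add: algebra_simps)
      also have "\<dots> = cnj c * c * ?S l l' + cnj c * d * ?S l (L + l')
          + cnj d * c * ?S (L + l) l' + cnj d * d * ?S (L + l) (L + l')"
        by (simp only: sum.distrib sum_distrib_left)
      also have "?S l l' = (if l = l' then 1 else 0)"
        using elim l by simp
      also have "?S l (L + l') = 0"
        using elim[rule_format, of l "L + l'"] l by simp
      also have "?S (L + l) l' = 0"
        using elim[rule_format, of "L + l" l'] l by simp
      also have "?S (L + l) (L + l') = (if l = l' then 1 else 0)"
        using elim[rule_format, of "L + l" "L + l'"] l by simp
      also have "cnj c * c * (if l = l' then 1 else 0) + cnj c * d * 0 + cnj d * c * 0 + cnj d * d * (if l = l' then 1 else 0)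
          = (if l = l' then 1 else 0)"
      proof -
        have "cnj c * c + cnj d * d = of_real ((cmod c)\<^sup>2 + (cmod d)\<^sup>2)"
          unfolding of_real_add complex_norm_square by (simp only: mult.commute)
        then show ?thesis by (simp add: cd)
      qed
      finally show "(\<Sum>r\<in>{1..2 * L}. cnj (c * a r l \<xi> + d * a r (L + l) \<xi>) * (c * a r l' \<xi> + d * a r (L + l') \<xi>))
        = (if l = l' then 1 else 0)" .
    qed
  qed
qed

text \<open>All combinations \<open>(\<Psi> + \<omega>\<Theta>)/\<surd>2\<close> with \<open>|\<omega>| = 1\<close> generate tight frames with bound 1, so the norm of
  \<open>c + \<omega>d\<close> does not depend on \<open>\<omega>\<close>, where \<open>c\<close> and \<open>d\<close> are the coefficient families of \<open>f\<close>. By polarization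
  \<open>c\<close> and \<open>d\<close> are orthogonal.\<close>

theorem orthogonal_frames:
  assumes a: "paraunitary K (2 * L) a"
    and \<Psi>: "\<And>r. r \<in> {1..2 * L} \<Longrightarrow> square_integrable \<mu> (\<Psi> r)"
    and \<Theta>: "\<And>r. r \<in> {1..2 * L} \<Longrightarrow> square_integrable \<mu> (\<Theta> r)"
    and psi: "\<And>r. r \<in> {1..2 * L} \<Longrightarrow>
      AE \<xi> in \<mu>. fourier K (\<Psi> r) \<xi> = (\<Sum>l=1..L. a r l \<xi> * m l (\<pp> * \<xi>)) * \<Phi> (\<pp> * \<xi>)"
    and theta: "\<And>r. r \<in> {1..2 * L} \<Longrightarrow>
      AE \<xi> in \<mu>. fourier K (\<Theta> r) \<xi> = (\<Sum>l=1..L. a r (L + l) \<xi> * m l (\<pp> * \<xi>)) * \<Phi> (\<pp> * \<xi>)"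
  shows "orthogonal_wavelet_frames K (2 * L) \<Psi> \<Theta>"
proof -
  let ?C = "count_space (wavelet_index (2 * L))"
  let ?P = "\<lambda>r. fourier K (\<Psi> r)" and ?T = "\<lambda>r. fourier K (\<Theta> r)"
  have P2: "square_integrable \<mu> (?P r)" "square_integrable \<mu> (?T r)" if "r \<in> {1..2 * L}" for r
    using square_integrable_fourier(1)[OF \<Psi>[OF that]] square_integrable_fourier(1)[OF \<Theta>[OF that]] .
  have comb: "square_integrable ?C (\<lambda>i. cnj c * analysis \<Psi> f i + cnj d * analysis \<Theta> f i) \<and>
      l2norm ?C (\<lambda>i. cnj c * analysis \<Psi> f i + cnj d * analysis \<Theta> f i) = l2norm \<mu> f"
    if f: "square_integrable \<mu> f" and cd: "(cmod c)\<^sup>2 + (cmod d)\<^sup>2 = 1" for f c d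
  proof -
    have eq: "frame_coeff (\<lambda>r \<xi>. c * ?P r \<xi> + d * ?T r \<xi>) (fourier K f) i
        = cnj c * analysis \<Psi> f i + cnj d * analysis \<Theta> f i" if i: "i \<in> wavelet_index (2 * L)" for i
    proof -
      have "analysis \<Psi> f i = frame_coeff ?P (fourier K f) i"
        by (rule analysis_eq_frame_coeff[where M = "2 * L"]) (fact \<Psi> f i)+
      moreover have "analysis \<Theta> f i = frame_coeff ?T (fourier K f) i"
        by (rule analysis_eq_frame_coeff[where M = "2 * L"]) (fact \<Theta> f i)+
      moreover have "frame_coeff (\<lambda>r \<xi>. c * ?P r \<xi> + d * ?T r \<xi>) (fourier K f) i
          = cnj c * frame_coeff ?P (fourier K f) i + cnj d * frame_coeff ?T (fourier K f) i"
        by (rule frame_coeff_combination[where M = "2 * L"]) (fact P2 square_integrable_fourier(1)[OF f] i)+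
      ultimately show ?thesis by simp
    qed
    have ae: "AE i in ?C. frame_coeff (\<lambda>r \<xi>. c * ?P r \<xi> + d * ?T r \<xi>) (fourier K f) i
        = cnj c * analysis \<Psi> f i + cnj d * analysis \<Theta> f i"
      using eq by (simp add: AE_count_space)
    note tf = tight_frame[OF generated_combination[OF a cd P2 psi theta] square_integrable_fourier(1)[OF f]]
    show ?thesis
      using square_integrable_cong_AE[OF tf(1) _ ae] tf(2) square_integrable_fourier(2)[OF f] by simp
  qed
  have tP: "square_integrable ?C (analysis \<Psi> f) \<and> l2norm ?C (analysis \<Psi> f) = l2norm \<mu> f"
    if "square_integrable \<mu> f" for f
    using comb[OF that, of 1 0] by simp
  have tT: "square_integrable ?C (analysis \<Theta> f) \<and> l2norm ?C (analysis \<Theta> f) = l2norm \<mu> f"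
    if "square_integrable \<mu> f" for f
    using comb[OF that, of 0 1] by simp
  have diag: "(\<integral>i. analysis \<Psi> f i * cnj (analysis \<Theta> f i) \<partial>?C) = 0" if f: "square_integrable \<mu> f" for f
  proof -
    have norm: "(l2norm ?C (\<lambda>i. analysis \<Psi> f i + w * analysis \<Theta> f i))\<^sup>2 = 2 * (l2norm \<mu> f)\<^sup>2"
      if w: "cmod w = 1" for w
    proof -
      \<comment> \<open>Coefficients are conjugate linear in the generators, hence the weight \<open>s * cnj w\<close> below.\<close>
      define s where "s = complex_of_real (1 / sqrt 2)"
      have s: "(cmod s)\<^sup>2 = 1 / 2" "cnj s = s"
        unfolding s_def norm_of_real by (simp_all add: power_divide)
      have "l2norm ?C (\<lambda>i. s * (analysis \<Psi> f i + w * analysis \<Theta> f i)) = l2norm \<mu> f"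
        using comb[OF f, of s "s * cnj w"] w s by (simp add: norm_mult power_mult_distrib distrib_left mult.assoc)
      then have "(cmod s)\<^sup>2 * (l2norm ?C (\<lambda>i. analysis \<Psi> f i + w * analysis \<Theta> f i))\<^sup>2 = (l2norm \<mu> f)\<^sup>2"
        unfolding l2norm_scale power_mult_distrib[symmetric] by simp
      then show ?thesis using s by simp
    qed
    have "4 * (\<integral>i. analysis \<Psi> f i * cnj (analysis \<Theta> f i) \<partial>?C) = 0"
      using norm[of 1] norm[of "-1"] norm[of \<i>] norm[of "- \<i>"] tP[OF f] tT[OF f]
      by (subst polarization_integral) simp_all
    then show ?thesis by simp
  qed
  show ?thesis
    unfolding orthogonal_wavelet_frames_def L2_iff
    using tight_wavelet_frame[OF \<Psi> tP] tight_wavelet_frame[OF \<Theta> tT]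
      mixed_expansion_tendsto_0[OF \<Psi> \<Theta> conjunct1[OF tP] tT diag] by blast
qed

end

theorem theorem3p4:
  fixes K :: "('k::local_field) lf_data"
    and \<phi> :: "'k \<Rightarrow> complex"
    and L :: nat
    and m :: "nat \<Rightarrow> 'k \<Rightarrow> complex"
    and a :: "nat \<Rightarrow> nat \<Rightarrow> 'k \<Rightarrow> complex"
    and G G' \<psi>s \<phi>s :: "nat \<Rightarrow> 'k \<Rightarrow> complex"
  assumes setting: "local_field_setting K"
    and phi_L2: "L2 K \<phi>"
    and phi_supp: "compactly_supported K \<phi>"
    and phi_hat_0: "fourier K \<phi> 0 = 1"
    and masks: "\<And>l. l \<le> L \<Longrightarrow> is_mask K (m l)"
    and refinable: "AE \<xi> in haar K. fourier K \<phi> \<xi> = m 0 (prm K * \<xi>) * fourier K \<phi> (prm K * \<xi>)"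
    and UEP: "unitary_extension_principle K L m"
    and A_paraunitary: "paraunitary K (2 * L) a"
    and G_def: "\<And>k \<xi>. k \<in> {1..2 * L} \<Longrightarrow>
          G k \<xi> = (\<Sum>l=1..L. a k l (inverse (prm K) * \<xi>) * m l \<xi>)"
    and G'_def: "\<And>k \<xi>. k \<in> {1..2 * L} \<Longrightarrow>
          G' k \<xi> = (\<Sum>l=L+1..2 * L. a k l (inverse (prm K) * \<xi>) * m (l - L) \<xi>)"
    and psis_L2: "\<And>k. k \<in> {1..2 * L} \<Longrightarrow> L2 K (\<psi>s k)"
    and psis: "\<And>k. k \<in> {1..2 * L} \<Longrightarrow>
          AE \<xi> in haar K. fourier K (\<psi>s k) (inverse (prm K) * \<xi>) = G k \<xi> * fourier K \<phi> \<xi>"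
    and phis_L2: "\<And>k. k \<in> {1..2 * L} \<Longrightarrow> L2 K (\<phi>s k)"
    and phis: "\<And>k. k \<in> {1..2 * L} \<Longrightarrow>
          AE \<xi> in haar K. fourier K (\<phi>s k) (inverse (prm K) * \<xi>) = G' k \<xi> * fourier K \<phi> \<xi>"
  shows "orthogonal_wavelet_frames K (2 * L) \<psi>s \<phi>s"
proof -
  interpret local_field_setting K by (rule setting)
  note phi2 = phi_L2[unfolded L2_iff]
  interpret uep_setting K "fourier K \<phi>" m L
  proof
    show "square_integrable \<mu> (fourier K \<phi>)"
      by (rule square_integrable_fourier(1)[OF phi2])
    show "\<exists>n::nat. \<forall>\<xi>\<in>disc (- int n). fourier K \<phi> \<xi> = 1"
      using fourier_compactly_supported[OF phi2 phi_supp] by (simp add: phi_hat_0)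
    have "AE \<xi> in \<mu>. \<forall>l\<in>{..L}. \<forall>n. m l (\<xi> + u n) = m l \<xi>"
      using masks by (intro AE_finite_allI mask_periodic_AE) auto
    then show "AE \<xi> in \<mu>. \<forall>l\<le>L. \<forall>n. m l (\<xi> + u n) = m l \<xi>"
      by eventually_elim simp
  qed (rule refinable UEP)+
  \<comment> \<open>The relations are given at \<open>\<pp>\<^sup>-\<^sup>1\<xi>\<close>; dilating them by \<open>\<pp>\<close> puts the generator itself on the left.\<close>
  have cancel: "inverse \<pp> * (\<pp> * \<xi>) = \<xi>" for \<xi>
    by (simp flip: mult.assoc)
  show ?thesis
  proof (rule orthogonal_frames[OF A_paraunitary])
    fix r assume r: "r \<in> {1..2 * L}"
    show "square_integrable \<mu> (\<psi>s r)" "square_integrable \<mu> (\<phi>s r)"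
      using psis_L2[OF r] phis_L2[OF r] by (simp_all add: L2_iff)
    show "AE \<xi> in \<mu>. fourier K (\<psi>s r) \<xi> = (\<Sum>l=1..L. a r l \<xi> * m l (\<pp> * \<xi>)) * fourier K \<phi> (\<pp> * \<xi>)"
      using AE_dilate[OF psis[OF r]] unfolding G_def[OF r] cancel .
    have "(\<Sum>l=L+1..2 * L. a r l \<xi> * m (l - L) \<eta>) = (\<Sum>l=1..L. a r (L + l) \<xi> * m l \<eta>)" for \<xi> \<eta>
      by (rule sum.reindex_bij_witness[of _ "\<lambda>l. L + l" "\<lambda>l. l - L"]) auto
    then show "AE \<xi> in \<mu>. fourier K (\<phi>s r) \<xi> = (\<Sum>l=1..L. a r (L + l) \<xi> * m l (\<pp> * \<xi>)) * fourier K \<phi> (\<pp> * \<xi>)"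
      using AE_dilate[OF phis[OF r]] unfolding G'_def[OF r] cancel by simp
  qed
qed

end
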